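(* Let $E$ be the energy functional $E(u)=\frac12\int_\Omega (u_x^2-\alpha^2u^2)\,dx-\int_\Omega u\cos x\,dx$ for some $\alpha>0$. For each $M>0$, $E$ has a unique nonnegative minimizer of mass $M$ (that is, a unique minimizer on $\mathcal{C}_M$), denoted $u^*$. The minimizer is strictly symmetric decreasing on its positivity set. It depends continuously on $M$ in $\mathcal{C}^{1,1}$, and increases pointwise with $M$ in the sense that for any pair of minimizers $u_1^*,u_2^*$ of mass $M_1,M_2$, $$M_1<M_2\ \Longrightarrow\ u_1^*(x)<u_2^*(x),\qquad x\in P(u_1^* ).$$ If $\alpha<1$ and $M(1-\alpha^2)>2\pi$, then the minimizer is strictly positive and given by $$u^*(x)=\frac{M}{2\pi}+\frac{1}{1-\alpha^2}\cos x,\qquad x\in\Omega.$$ Otherwise, it is given by $$u^*(x)=u^0(x)+A\cos(\alpha x)-u^0(\tau)-A\cos(\alpha\tau),\qquad |x|<\tau,$$ and vanishes elsewhere. Here, $\tau$ is a smooth increasing function of $M$ with $\tau\cdot\max\{\alpha,1\}<\pi$, the function $u^0$ is given by $$u^0(x)=\begin{cases}-\frac12 x\sin x, & \alpha=1,\\ \frac{1}{1-\alpha^2}\cos x, & \alpha\neq1,\end{cases}$$ and $A=\dfrac{u^0_x(\tau)}{\alpha\sin(\alpha\tau)}$.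
   Context: $\Omega=\mathbb{R}/(2\pi\mathbb{Z})$, identified with $[-\pi,\pi]$ with endpoints glued. $\mathcal{C}_M=\{u\in L^2(\Omega)\mid u\ge0,\ \int_\Omega u\,dx=M\}$; $M$ is called the mass. By convention $E(u)=\infty$ if $u\notin H^1(\Omega)$. $P(u)=\{x\in\Omega\mid u(x)>0\}$ is the positivity set of $u$. "Symmetric decreasing" means even about $x=0$ and nonincreasing in $|x|$ on $[-\pi,\pi]$; "strictly symmetric decreasing on its positivity set" means even and strictly decreasing in $|x|$ there.
   Formalization: Continuity in M is proved in C^{1,γ}, γ<1, with locally bounded C^{1,1} norm, and in C^{1,1} only if α<1, M(1-α²)>2π (it fails otherwise, as u*'' jumps at the contact points); at M(1-α²)=2π, τ=π replaces the strict bound τ·max{α,1}<π. *)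

theory Defs
  imports "HOL-Analysis.Analysis"
begin

text \<open>Functions on the circle \<open>\<Omega> = \<real>/(2\<pi>\<int>)\<close> are represented by \<open>2\<pi>\<close>-periodic functions on \<open>\<real>\<close>;
  integrals over \<open>\<Omega>\<close> are Lebesgue integrals over \<open>[-\<pi>, \<pi>]\<close>. Elements of \<open>L\<^sup>2(\<Omega>)\<close> are
  represented by functions, to be considered up to equality almost everywhere.\<close>

definition periodic_2pi :: "(real \<Rightarrow> real) \<Rightarrow> bool" where
  "periodic_2pi u \<longleftrightarrow> (\<forall>x. u (x + 2 * pi) = u x)"

definition L2_circle :: "(real \<Rightarrow> real) set" where
  "L2_circle = {u. periodic_2pi u \<and> u \<in> borel_measurable lebesgue \<and>
     set_integrable lebesgue {-pi..pi} (\<lambda>x. (u x)\<^sup>2)}"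

text \<open>\<open>S\<close> need not be open: smoothness at a boundary point of \<open>S\<close> means that \<open>f\<close> extends
  smoothly across that point.\<close>

definition smooth_on :: "(real \<Rightarrow> real) \<Rightarrow> real set \<Rightarrow> bool" where
  "smooth_on f S \<longleftrightarrow> (\<exists>T g. open T \<and> S \<subseteq> T \<and> (\<forall>x\<in>S. g x = f x) \<and>
     (\<forall>n. (deriv ^^ n) g differentiable_on T))"

definition weak_deriv_circle :: "(real \<Rightarrow> real) \<Rightarrow> (real \<Rightarrow> real) \<Rightarrow> bool" where
  "weak_deriv_circle u g \<longleftrightarrow> g \<in> L2_circle \<and>
     (\<forall>\<phi>. periodic_2pi \<phi> \<and> smooth_on \<phi> UNIV \<longrightarrow>
        (LINT x:{-pi..pi}|lebesgue. u x * deriv \<phi> x) = - (LINT x:{-pi..pi}|lebesgue. g x * \<phi> x))"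

definition H1_circle :: "(real \<Rightarrow> real) set" where
  "H1_circle = {u \<in> L2_circle. \<exists>g. weak_deriv_circle u g}"

text \<open>Weak derivatives are unique up to null sets, so the choice of \<open>u_x\<close> does not matter.\<close>

definition energy :: "real \<Rightarrow> (real \<Rightarrow> real) \<Rightarrow> ereal" where
  "energy \<alpha> u = (if u \<in> H1_circle
     then let u_x = (SOME g. weak_deriv_circle u g) in
       ereal (1 / 2 * (LINT x:{-pi..pi}|lebesgue. (u_x x)\<^sup>2 - \<alpha>\<^sup>2 * (u x)\<^sup>2)
              - (LINT x:{-pi..pi}|lebesgue. u x * cos x))
     else \<infinity>)"

definition admissible :: "real \<Rightarrow> (real \<Rightarrow> real) set" where
  "admissible M = {u \<in> L2_circle. (AE x in lebesgue. 0 \<le> u x) \<and>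
     (LINT x:{-pi..pi}|lebesgue. u x) = M}"

abbreviation minimizer :: "real \<Rightarrow> real \<Rightarrow> (real \<Rightarrow> real) \<Rightarrow> bool" where
  "minimizer \<alpha> M u \<equiv> is_arg_min (energy \<alpha>) (\<lambda>v. v \<in> admissible M) u"

definition positivity_set :: "(real \<Rightarrow> real) \<Rightarrow> real set" where
  "positivity_set u = {x. u x > 0}"

definition strictly_symmetric_decreasing_on_positivity_set :: "(real \<Rightarrow> real) \<Rightarrow> bool" where
  "strictly_symmetric_decreasing_on_positivity_set u \<longleftrightarrow>
     (\<forall>x. u (- x) = u x) \<and>
     (\<forall>x \<in> positivity_set u \<inter> {-pi..pi}. \<forall>y \<in> positivity_set u \<inter> {-pi..pi}.
        \<bar>x\<bar> < \<bar>y\<bar> \<longrightarrow> u y < u x)"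

definition C11_circle :: "(real \<Rightarrow> real) set" where
  "C11_circle = {u. periodic_2pi u \<and> u differentiable_on UNIV \<and>
     (\<exists>L. L-lipschitz_on UNIV (deriv u))}"

text \<open>The norm of \<open>C\<^sup>1\<^sup>,\<^sup>\<gamma>(\<Omega>)\<close> for \<open>0 < \<gamma> \<le> 1\<close>; the three suprema are finite for
  every \<open>u \<in> C\<^sup>1\<^sup>,\<^sup>1(\<Omega>)\<close>. By periodicity, the supremum over pairs of distinct
  reals agrees with the one taken with respect to the distance on the circle.\<close>

definition C1_holder_norm :: "real \<Rightarrow> (real \<Rightarrow> real) \<Rightarrow> real" where
  "C1_holder_norm \<gamma> u =
     (SUP x. \<bar>u x\<bar>) + (SUP x. \<bar>deriv u x\<bar>) +
     (SUP (x, y) \<in> {(x, y). x \<noteq> y}. \<bar>deriv u x - deriv u y\<bar> / \<bar>x - y\<bar> powr \<gamma>)"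

definition u0 :: "real \<Rightarrow> real \<Rightarrow> real" where
  "u0 \<alpha> x = (if \<alpha> = 1 then - (1 / 2) * x * sin x else 1 / (1 - \<alpha>\<^sup>2) * cos x)"

definition coeff_A :: "real \<Rightarrow> real \<Rightarrow> real" where
  "coeff_A \<alpha> \<tau> = deriv (u0 \<alpha>) \<tau> / (\<alpha> * sin (\<alpha> * \<tau>))"

definition full_support_masses :: "real \<Rightarrow> real set" where
  "full_support_masses \<alpha> = {M. 0 < M \<and> \<alpha> < 1 \<and> M * (1 - \<alpha>\<^sup>2) > 2 * pi}"

text \<open>For \<open>\<alpha> < 1\<close> this contains the critical mass \<open>M = 2\<pi>/(1 - \<alpha>\<^sup>2)\<close>.\<close>

definition droplet_masses :: "real \<Rightarrow> real set" where
  "droplet_masses \<alpha> = {0<..} - full_support_masses \<alpha>"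

end

theory Submission
  imports Defs "HOL-Complex_Analysis.Great_Picard"
begin

text \<open>For \<open>\<alpha> > 1\<close> the energy is not convex, so the minimizer is identified through existence and
  symmetry. The Dirichlet integral is replaced by the supremum of its dyadic difference quotients,
  which is lower semicontinuous under pointwise convergence (so that Arzela-Ascoli yields a
  minimizer) and does not increase under two-point rearrangement with respect to reflections of the
  dyadic grid. Hence every minimizer is even and nonincreasing in \<open>\<bar>x\<bar>\<close>. Testing with dyadic hat
  functions gives the Euler-Lagrange equation inside the support and zero slope at its edge, so the
  minimizer is \<open>u0 + A cos (\<alpha> x) + c\<close> there. The derivative of
  \<open>A(t) = u0'(t) / (\<alpha> sin (\<alpha> t))\<close> has the sign of \<open>\<integral> sin s sin (\<alpha> s) ds\<close> over \<open>[0, t]\<close>, which is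
  positive as long as \<open>t max(\<alpha>, 1) \<le> \<pi>\<close>; this makes the mass a smooth increasing function of the
  support radius, which determines the minimizer and its dependence on the mass.\<close>

section \<open>Smooth functions\<close>

text \<open>The Sobolev energy and the dyadic energy are never identified in general. For an
  \<open>H1_circle\<close> function only one inequality is shown (its continuous representative has
  no larger reduced energy), and the reverse one only for functions with Lipschitz derivative. The
  reduced minimizer turns out to be of this kind, so the two inequalities close up and transfer
  minimality and uniqueness. Polarization and variations thus act on continuous functions through
  finite sums of point values, without weak derivatives of maxima and minima. Existence has a second
  use: that every droplet mass belongs to some radius is read off from the minimizer of that mass,
  not from limits of \<open>droplet_mass\<close>. As to C^{1,1}: just inside the edge of a droplet
  of radius t the second derivative tends to
  \<open>wronskian \<alpha> t / sin (\<alpha> * t)\<close>, which is positive, while it is 0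
  outside. Droplets of nearby different radii therefore have derivatives whose difference keeps a
  Lipschitz constant away from 0. So norm continuity at droplet masses is stated for exponents below
  1, with local boundedness of the C^{1,1} norm.\<close>

inductive_set elementary_on :: "real set \<Rightarrow> (real \<Rightarrow> real) set" for S :: "real set" where
  const: "(\<lambda>x. c) \<in> elementary_on S"
| ident: "(\<lambda>x. x) \<in> elementary_on S"
| sin: "(\<lambda>x. sin (a * x)) \<in> elementary_on S"
| cos: "(\<lambda>x. cos (a * x)) \<in> elementary_on S"
| add: "f \<in> elementary_on S \<Longrightarrow> g \<in> elementary_on S \<Longrightarrow> (\<lambda>x. f x + g x) \<in> elementary_on S"
| mult: "f \<in> elementary_on S \<Longrightarrow> g \<in> elementary_on S \<Longrightarrow> (\<lambda>x. f x * g x) \<in> elementary_on S"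
| inverse: "f \<in> elementary_on S \<Longrightarrow> (\<And>x. x \<in> S \<Longrightarrow> f x \<noteq> 0) \<Longrightarrow> (\<lambda>x. inverse (f x)) \<in> elementary_on S"

lemma elementary_on_uminus: "f \<in> elementary_on S \<Longrightarrow> (\<lambda>x. - f x) \<in> elementary_on S"
  using elementary_on.mult[OF elementary_on.const[of "-1"], of f] by simp

lemma elementary_on_diff:
  "f \<in> elementary_on S \<Longrightarrow> g \<in> elementary_on S \<Longrightarrow> (\<lambda>x. f x - g x) \<in> elementary_on S"
  using elementary_on.add[OF _ elementary_on_uminus, of f S g] by simp

lemma elementary_on_divide:
  "f \<in> elementary_on S \<Longrightarrow> g \<in> elementary_on S \<Longrightarrow> (\<And>x. x \<in> S \<Longrightarrow> g x \<noteq> 0)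
    \<Longrightarrow> (\<lambda>x. f x / g x) \<in> elementary_on S"
  using elementary_on.mult[OF _ elementary_on.inverse, of f S g] by (simp add: divide_inverse)

text \<open>Smoothness is reduced to one differentiation: a class of functions closed under
  derivatives consists of smooth functions. \<open>S\<close> records where denominators are nonzero,
  so the same class serves test functions on the whole line and the derivative of the mass on the
  interval of radii.\<close>

lemma elementary_on_has_derivative:
  assumes "f \<in> elementary_on S"
  shows "\<exists>f' \<in> elementary_on S. \<forall>x\<in>S. (f has_real_derivative f' x) (at x)"
  using assms
proof induction
  case (const c)
  then show ?case by (intro bexI[of _ "\<lambda>x. 0"] elementary_on.intros) auto
next
  case ident
  then show ?case by (intro bexI[of _ "\<lambda>x. 1"] elementary_on.intros) auto
next
  case (sin a)
  show ?case
    by (rule bexI[of _ "\<lambda>x. a * cos (a * x)"])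
      (auto intro!: elementary_on.intros derivative_eq_intros)
next
  case (cos a)
  show ?case
    by (rule bexI[of _ "\<lambda>x. - (a * sin (a * x))"])
      (auto intro!: elementary_on_uminus elementary_on.intros derivative_eq_intros)
next
  case (add f g)
  then obtain f' g' where "f' \<in> elementary_on S" "g' \<in> elementary_on S"
    "\<forall>x\<in>S. (f has_real_derivative f' x) (at x)" "\<forall>x\<in>S. (g has_real_derivative g' x) (at x)"
    by blast
  then show ?case
    by (intro bexI[of _ "\<lambda>x. f' x + g' x"] elementary_on.intros) (auto intro!: derivative_eq_intros)
next
  case (mult f g)
  then obtain f' g' where "f' \<in> elementary_on S" "g' \<in> elementary_on S"
    "\<forall>x\<in>S. (f has_real_derivative f' x) (at x)" "\<forall>x\<in>S. (g has_real_derivative g' x) (at x)"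
    by blast
  with mult show ?case
    by (intro bexI[of _ "\<lambda>x. f' x * g x + f x * g' x"] elementary_on.intros)
      (auto intro!: derivative_eq_intros)
next
  case (inverse f)
  then obtain f' where "f' \<in> elementary_on S" "\<forall>x\<in>S. (f has_real_derivative f' x) (at x)"
    by blast
  with inverse show ?case
    by (intro bexI[of _ "\<lambda>x. - (inverse (f x) * f' x * inverse (f x))"]
          elementary_on_uminus elementary_on.intros)
      (auto intro!: DERIV_inverse')
qed

text \<open>By induction, each iterated derivative of \<open>f\<close> coincides on \<open>T\<close>
  with a member of \<open>F\<close>. Agreement off \<open>T\<close> is not controlled, but openness
  of \<open>T\<close> makes agreement on \<open>T\<close> enough for the next derivative.
  \<open>f\<close> itself is the extension that \<open>smooth_on\<close> asks for.\<close>

lemma smooth_on_if_closed_under_deriv: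
  assumes "open T" "S \<subseteq> T" and f: "f \<in> F" and eq: "\<And>x. x \<in> S \<Longrightarrow> f x = h x"
    and F: "\<And>f. f \<in> F \<Longrightarrow> \<exists>f' \<in> F. \<forall>x\<in>T. (f has_real_derivative f' x) (at x)"
  shows "smooth_on h S"
proof -
  have *: "\<exists>g\<in>F. \<forall>x\<in>T. (deriv ^^ n) f x = g x" for n
  proof (induction n)
    case 0
    then show ?case using f by auto
  next
    case (Suc n)
    then obtain g where g: "g \<in> F" "\<forall>x\<in>T. (deriv ^^ n) f x = g x" by blast
    obtain g' where g': "g' \<in> F" "\<forall>x\<in>T. (g has_real_derivative g' x) (at x)"
      using F[OF g(1)] by blast
    have "((deriv ^^ n) f has_real_derivative g' x) (at x)" if "x \<in> T" for x
      by (rule has_field_derivative_transform_within_open[of g _ _ T])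
        (use g g' that \<open>open T\<close> in auto)
    then show ?case using g' by (auto intro!: bexI[of _ g'] DERIV_imp_deriv)
  qed
  have "(deriv ^^ n) f differentiable_on T" for n
  proof -
    obtain g where g: "g \<in> F" "\<forall>x\<in>T. (deriv ^^ n) f x = g x" using * by blast
    obtain g' where g': "g' \<in> F" "\<forall>x\<in>T. (g has_real_derivative g' x) (at x)"
      using F[OF g(1)] by blast
    have "((deriv ^^ n) f has_real_derivative g' x) (at x)" if "x \<in> T" for x
      by (rule has_field_derivative_transform_within_open[of g _ _ T])
        (use g g' that \<open>open T\<close> in auto)
    then show ?thesis
      unfolding differentiable_on_def
      using real_differentiable_def by (blast intro: differentiable_at_withinI)
  qed
  with assms show ?thesis unfolding smooth_on_def by blast
qed

section \<open>Trigonometric polynomials as test functions, and the fundamental lemma of the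
  calculus of variations\<close>

lemma smooth_on_elementary: "p \<in> elementary_on UNIV \<Longrightarrow> smooth_on p UNIV"
  by (rule smooth_on_if_closed_under_deriv[where F="elementary_on UNIV" and T=UNIV])
    (use elementary_on_has_derivative[of _ UNIV] in simp_all)

text \<open>A real-linear functional of \<open>cis x\<close> is a combination of
  \<open>cos x\<close> and \<open>sin x\<close>, so real polynomials on the plane restrict to
  trigonometric polynomials on the circle. This turns the approximants of Stone-Weierstrass into
  smooth periodic test functions.\<close>

lemma elementary_real_polynomial_cis:
  assumes "real_polynomial_function q"
  shows "(\<lambda>x. q (cis x)) \<in> elementary_on S"
  using assms
proof induction
  case (linear f)
  interpret bounded_linear f by fact
  have "f (cis x) = f 1 * cos (1 * x) + f \<i> * sin (1 * x)" for x
  proof -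
    have "cis x = cos x *\<^sub>R 1 + sin x *\<^sub>R \<i>" by (simp add: complex_eq_iff)
    then show ?thesis by (simp add: add scaleR)
  qed
  then show ?case by (simp only:) (intro elementary_on.intros)
next
  case (const c)
  then show ?case by (rule elementary_on.intros)
next
  case (add f g)
  then show ?case by (intro elementary_on.intros)
next
  case (mult f g)
  then show ?case by (intro elementary_on.intros)
qed

text \<open>If \<open>w\<close> were nonzero on a set of positive measure, one sign would occur on
  such a set, and inner regularity would give a compact subset of positive measure on which
  \<open>w\<close> has that strict sign; its integral could not be 0.\<close>

lemma AE_zero_if_integral_compact_zero:
  fixes w :: "real \<Rightarrow> real"
  assumes int: "w absolutely_integrable_on {a..b}"
    and zero: "\<And>K. compact K \<Longrightarrow> K \<subseteq> {a<..<b} \<Longrightarrow> integral K w = 0"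
  shows "AE x in lebesgue. x \<in> {a..b} \<longrightarrow> w x = 0"
proof -
  have pos: "negligible {x\<in>{a<..<b}. 0 < s * w x}" (is "negligible ?P") if s: "s = 1 \<or> s = -1" for s
  proof (rule ccontr)
    have wm: "(\<lambda>x. w x * indicator {a..b} x) \<in> borel_measurable lebesgue"
      using int by (auto simp: set_integrable_def mult.commute dest: borel_measurable_integrable)
    have "{x \<in> space lebesgue. 0 < s * (w x * indicator {a..b} x)} \<in> sets lebesgue"
      using wm by measurable
    then have "{x. 0 < s * (w x * indicator {a..b} x)} \<inter> {a<..<b} \<in> sets lebesgue"
      by (intro sets.Int) auto
    also have "{x. 0 < s * (w x * indicator {a..b} x)} \<inter> {a<..<b} = ?P"
      by (auto simp: indicator_def)
    finally have sP: "?P \<in> sets lebesgue" .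
    have lP: "?P \<in> lmeasurable"
      by (rule bounded_set_imp_lmeasurable) (use sP in \<open>auto intro: bounded_subset[of "{a<..<b}"]\<close>)
    assume "\<not> negligible ?P"
    then have "measure lebesgue ?P > 0"
      using lP negligible_iff_measure0 by (metis measure_nonneg less_eq_real_def)
    obtain K where K: "closed K" "K \<subseteq> ?P" "?P - K \<in> lmeasurable"
        "emeasure lebesgue (?P - K) < ennreal (measure lebesgue ?P)"
      using sets_lebesgue_inner_closed[OF sP \<open>measure lebesgue ?P > 0\<close>] by blast
    have cK: "compact K"
    proof -
      have "K \<subseteq> {a<..<b}" using K(2) by auto
      moreover have "bounded {a<..<b}" by simp
      ultimately have "bounded K" using bounded_subset by blast
      then show ?thesis using K(1) by (simp add: compact_eq_bounded_closed)
    qed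
    have "measure lebesgue (?P - K) < measure lebesgue ?P"
      using K(4) unfolding emeasure_eq_measure2[OF K(3)] by (simp add: ennreal_less_iff del: emeasure_completion)
    moreover have "measure lebesgue (?P - K) = measure lebesgue ?P - measure lebesgue K"
      by (rule measurable_measure_Diff[OF lP _ K(2)]) (rule fmeasurableD[OF lmeasurable_compact[OF cK]])
    ultimately have mK: "measure lebesgue K > 0" by linarith
    have lK: "K \<in> lmeasurable" using cK by (rule lmeasurable_compact)
    have iK: "w absolutely_integrable_on K"
    proof (rule set_integrable_subset[OF int fmeasurableD[OF lK]])
      show "K \<subseteq> {a..b}" using K(2) by auto
    qed
    have z: "integral K w = 0" using zero cK K by blast
    have "(LINT x:K|lebesgue. s * w x) = 0"
      using set_lebesgue_integral_eq_integral(2)[OF iK] z by simp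
    moreover have "integrable lebesgue (\<lambda>x. indicator K x *\<^sub>R (s * w x))"
      using iK s unfolding set_integrable_def by auto
    moreover have "AE x in lebesgue. 0 \<le> indicator K x *\<^sub>R (s * w x)"
      using K(2) by (intro AE_I2) (auto simp: indicator_def dest!: subsetD)
    ultimately have "AE x in lebesgue. indicator K x *\<^sub>R (s * w x) = 0"
      using integral_nonneg_eq_0_iff_AE unfolding set_lebesgue_integral_def by blast
    then have "AE x in lebesgue. x \<notin> K"
      using K(2) by (elim eventually_mono) (auto simp: indicator_def split: if_splits dest!: subsetD)
    then have "K \<in> null_sets lebesgue"
      using lK by (simp add: AE_iff_null_sets fmeasurableD)
    with mK show False by (simp add: measure_eq_0_null_sets)
  qed
  have "negligible ({x\<in>{a<..<b}. 0 < 1 * w x} \<union> {x\<in>{a<..<b}. 0 < (-1) * w x} \<union> {a, b})"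
    by (intro negligible_Un pos) (simp_all add: negligible_insert)
  then have "AE x in lebesgue. x \<notin> ({x\<in>{a<..<b}. 0 < 1 * w x} \<union> {x\<in>{a<..<b}. 0 < (-1) * w x} \<union> {a, b})"
    unfolding negligible_iff_null_sets by (rule AE_not_in)
  then show ?thesis by (elim eventually_mono) auto
qed

section \<open>Weak derivatives on the circle\<close>

lemma abs_integrable_mult_continuous:
  fixes w f :: "real \<Rightarrow> real"
  assumes "w absolutely_integrable_on {a..b}" "continuous_on {a..b} f"
  shows "(\<lambda>x. w x * f x) absolutely_integrable_on {a..b}"
proof -
  have "(\<lambda>x. f x * w x) absolutely_integrable_on {a..b}"
    by (rule absolutely_integrable_bounded_measurable_product_real)
      (use assms in \<open>auto intro!: continuous_imp_measurable_on_sets_lebesgue compact_imp_bounded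
        compact_continuous_image\<close>)
  then show ?thesis by (simp add: mult.commute)
qed

text \<open>Stone-Weierstrass on the unit circle: replacing \<open>F\<close> by a polynomial within
  \<open>e\<close> changes the integral by at most \<open>e\<close> times the integral of
  \<open>\<bar>w\<bar>\<close>.\<close>

lemma integral_zero_if_orthogonal_trig_poly:
  assumes w: "w absolutely_integrable_on {-pi..pi}"
    and orth: "\<And>p. periodic_2pi p \<Longrightarrow> smooth_on p UNIV \<Longrightarrow> integral {-pi..pi} (\<lambda>x. w x * p x) = 0"
    and F: "continuous_on (sphere 0 1) (F :: complex \<Rightarrow> real)"
  shows "integral {-pi..pi} (\<lambda>x. w x * F (cis x)) = 0"
proof -
  define I where "I = integral {-pi..pi} (\<lambda>x. \<bar>w x\<bar>)"
  have I0: "I \<ge> 0" unfolding I_def by (rule integral_nonneg) (use w in \<open>auto simp: absolutely_integrable_on_def\<close>)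
  have Fc: "continuous_on S (\<lambda>x. F (cis x))" for S
    by (rule continuous_on_compose2[OF F]) (auto intro!: continuous_intros)
  have "\<bar>integral {-pi..pi} (\<lambda>x. w x * F (cis x))\<bar> \<le> e * I" if e: "e > 0" for e
  proof -
    obtain q where q: "real_polynomial_function q" "\<And>z. z \<in> sphere 0 1 \<Longrightarrow> \<bar>F z - q z\<bar> < e"
      using Stone_Weierstrass_real_polynomial_function[OF compact_sphere F e] by blast
    have el: "(\<lambda>x. q (cis x)) \<in> elementary_on UNIV"
      by (rule elementary_real_polynomial_cis[OF q(1)])
    have cq: "continuous_on S (\<lambda>x. q (cis x))" for S
    proof -
      obtain q' where "\<And>x. ((\<lambda>x. q (cis x)) has_real_derivative q' x) (at x)"
        using elementary_on_has_derivative[OF el] by auto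
      then show ?thesis
        by (intro DERIV_continuous_on[of S _ q']) (auto intro: has_field_derivative_at_within)
    qed
    have "integral {-pi..pi} (\<lambda>x. w x * q (cis x)) = 0"
      by (rule orth) (use smooth_on_elementary[OF el] in \<open>simp_all add: periodic_2pi_def cis.ctr\<close>)
    moreover have i1: "(\<lambda>x. w x * q (cis x)) integrable_on {-pi..pi}"
      and i2: "(\<lambda>x. w x * F (cis x)) integrable_on {-pi..pi}"
      by (auto intro!: set_lebesgue_integral_eq_integral(1) abs_integrable_mult_continuous[OF w] cq Fc)
    ultimately have "integral {-pi..pi} (\<lambda>x. w x * F (cis x))
        = integral {-pi..pi} (\<lambda>x. w x * F (cis x) - w x * q (cis x))"
      by (subst Henstock_Kurzweil_Integration.integral_diff) auto
    also have "norm \<dots> \<le> integral {-pi..pi} (\<lambda>x. e * \<bar>w x\<bar>)"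
    proof (rule integral_norm_bound_integral)
      show "(\<lambda>x. w x * F (cis x) - w x * q (cis x)) integrable_on {-pi..pi}"
        using i1 i2 by (rule integrable_diff[rotated])
      show "(\<lambda>x. e * \<bar>w x\<bar>) integrable_on {-pi..pi}"
        using w by (intro integrable_on_mult_right) (auto simp: absolutely_integrable_on_def)
      fix x :: real
      have "\<bar>F (cis x) - q (cis x)\<bar> \<le> e" using q(2)[of "cis x"] by auto
      then have "\<bar>w x\<bar> * \<bar>F (cis x) - q (cis x)\<bar> \<le> \<bar>w x\<bar> * e" by (rule mult_left_mono) auto
      then show "norm (w x * F (cis x) - w x * q (cis x)) \<le> e * \<bar>w x\<bar>"
        by (simp add: abs_mult[symmetric] algebra_simps)
    qed
    finally show ?thesis by (simp add: I_def)
  qed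
  note * = this
  have "\<bar>integral {-pi..pi} (\<lambda>x. w x * F (cis x))\<bar> \<le> 0"
  proof (rule field_le_epsilon)
    fix e :: real assume "e > 0"
    then have "\<bar>integral {-pi..pi} (\<lambda>x. w x * F (cis x))\<bar> \<le> (e / (I + 1)) * I"
      using I0 by (intro *) auto
    also have "\<dots> \<le> e" using I0 \<open>e > 0\<close> by (simp add: field_simps)
    finally show "\<bar>integral {-pi..pi} (\<lambda>x. w x * F (cis x))\<bar> \<le> 0 + e" by simp
  qed
  then show ?thesis by simp
qed

text \<open>The indicator of a compact set in the open interval is a pointwise limit of bounded
  continuous functions on the circle, so \<open>w\<close> integrates to 0 over that set by dominated
  convergence.\<close>

lemma AE_zero_if_orthogonal:
  assumes w: "w absolutely_integrable_on {-pi..pi}"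
    and orth: "\<And>p. periodic_2pi p \<Longrightarrow> smooth_on p UNIV \<Longrightarrow> integral {-pi..pi} (\<lambda>x. w x * p x) = 0"
  shows "AE x in lebesgue. x \<in> {-pi..pi} \<longrightarrow> w x = 0"
proof (rule AE_zero_if_integral_compact_zero[OF w])
  fix K :: "real set" assume K: "compact K" "K \<subseteq> {-pi<..<pi}"
  show "integral K w = 0"
  proof (cases "K = {}")
    case False
    define A where "A = cis ` K"
    have A: "compact A" "A \<noteq> {}"
      using K False by (auto simp: A_def intro!: compact_continuous_image continuous_intros)
    define F where "F n z = max 0 (1 - real n * infdist z A)" for n z
    \<comment> \<open>On this interval \<open>cis\<close> identifies only -pi with pi, and neither
      lies in \<open>K\<close>; so membership in \<open>K\<close> can be tested on the
      circle.\<close>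
    have mem: "cis x \<in> A \<longleftrightarrow> x \<in> K" if x: "x \<in> {-pi..pi}" for x
    proof
      assume "cis x \<in> A"
      then obtain y where y: "y \<in> K" "cis x = cis y" by (auto simp: A_def)
      have "Arg (cis y) = y" using y K by (intro Arg_cis) auto
      moreover have "cis (-pi) = cis pi" by (simp add: complex_eq_iff)
      then have "Arg (cis x) = (if x = -pi then pi else x)"
        using x Arg_cis[of x] Arg_cis[of pi] by auto
      ultimately show "x \<in> K" using y K by (auto split: if_splits)
    qed (auto simp: A_def)
    have lim: "(\<lambda>n. w x * F n (cis x)) \<longlonglongrightarrow> w x * indicator K x" if x: "x \<in> {-pi..pi}" for x
    proof (cases "x \<in> K")
      case True
      then have "F n (cis x) = 1" for n using mem[OF x] by (simp add: F_def)
      then show ?thesis using True by simp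
    next
      case False
      then have "infdist (cis x) A > 0"
        using mem[OF x] A by (metis compact_imp_closed in_closed_iff_infdist_zero infdist_nonneg less_eq_real_def)
      then obtain n0 where n0: "1 < real n0 * infdist (cis x) A"
        using reals_Archimedean3 by blast
      have "F n (cis x) = 0" if "n \<ge> n0" for n
      proof -
        have "real n0 * infdist (cis x) A \<le> real n * infdist (cis x) A"
          using that infdist_nonneg by (intro mult_right_mono) auto
        then show ?thesis using n0 by (simp add: F_def)
      qed
      then have "eventually (\<lambda>n. w x * F n (cis x) = w x * indicator K x) sequentially"
        using False by (auto intro!: eventually_sequentiallyI[of n0])
      then show ?thesis by (rule tendsto_eventually)
    qed
    have Fb: "0 \<le> F n z" "F n z \<le> 1" for n z
      using infdist_nonneg[of z A] by (auto simp: F_def)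
    have Fc: "continuous_on S (F n)" for n S
      unfolding F_def by (intro continuous_intros)
    have "(\<lambda>n. integral {-pi..pi} (\<lambda>x. w x * F n (cis x))) \<longlonglongrightarrow> integral {-pi..pi} (\<lambda>x. w x * indicator K x)"
    proof (rule dominated_convergence(2)[where h="\<lambda>x. \<bar>w x\<bar>"])
      show "(\<lambda>x. w x * F k (cis x)) integrable_on {-pi..pi}" for k
        by (rule set_lebesgue_integral_eq_integral(1), rule abs_integrable_mult_continuous[OF w])
          (auto intro!: continuous_on_compose2[OF Fc[of UNIV]] continuous_intros)
      show "(\<lambda>x. \<bar>w x\<bar>) integrable_on {-pi..pi}"
        using w by (auto simp: absolutely_integrable_on_def)
      show "norm (w x * F k (cis x)) \<le> \<bar>w x\<bar>" for k x
        using Fb[of k "cis x"] by (simp add: abs_mult mult_left_le)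
      show "\<And>x. x \<in> {-pi..pi} \<Longrightarrow> (\<lambda>k. w x * F k (cis x)) \<longlonglongrightarrow> w x * indicator K x"
        by (rule lim)
    qed
    moreover have "integral {-pi..pi} (\<lambda>x. w x * F n (cis x)) = 0" for n
      by (rule integral_zero_if_orthogonal_trig_poly[OF w orth Fc])
    ultimately have "integral {-pi..pi} (\<lambda>x. w x * indicator K x) = 0"
      by (simp add: LIMSEQ_const_iff)
    also have "integral {-pi..pi} (\<lambda>x. w x * indicator K x) = integral {-pi..pi} (\<lambda>x. if x \<in> K then w x else 0)"
      by (rule integral_cong) (auto simp: indicator_def)
    also have "\<dots> = integral K w"
      using K by (simp add: integral_restrict_Int Int_absorb2 subset_trans[of K "{-pi<..<pi}"]
          greaterThanLessThan_subseteq_atLeastAtMost_iff)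
    finally show ?thesis .
  qed simp
qed

section \<open>Periodic extension and integration by parts\<close>

lemma periodic_2pi_int:
  assumes "periodic_2pi u"
  shows "u (x + 2 * pi * of_int k) = u x"
proof (induction k rule: int_induct[where k=0])
  case (step1 k)
  have "u (x + 2 * pi * of_int (k + 1)) = u ((x + 2 * pi * of_int k) + 2 * pi)"
    by (simp add: algebra_simps)
  then show ?case using assms step1 unfolding periodic_2pi_def by simp
next
  case (step2 k)
  have "u (x + 2 * pi * of_int k) = u ((x + 2 * pi * of_int (k - 1)) + 2 * pi)"
    by (simp add: algebra_simps)
  then show ?case using assms step2 unfolding periodic_2pi_def by simp
qed simp

definition wrap :: "real \<Rightarrow> real" where
  "wrap x = x - 2 * pi * of_int \<lfloor>(x + pi) / (2 * pi)\<rfloor>"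

lemma wrap_range: "-pi \<le> wrap x" "wrap x < pi"
proof -
  let ?k = "real_of_int \<lfloor>(x + pi) / (2 * pi)\<rfloor>"
  have "?k \<le> (x + pi) / (2 * pi)" "(x + pi) / (2 * pi) < ?k + 1" by linarith+
  then have "?k * (2 * pi) \<le> x + pi" "x + pi < (?k + 1) * (2 * pi)"
    by (simp_all only: pos_le_divide_eq pos_divide_less_eq pi_gt_zero mult_pos_pos zero_less_numeral)
  then show "-pi \<le> wrap x" "wrap x < pi" by (simp_all add: wrap_def algebra_simps)
qed

lemma wrap_eqI:
  assumes "-pi + 2 * pi * of_int k \<le> x" "x < pi + 2 * pi * of_int k"
  shows "wrap x = x - 2 * pi * of_int k"
proof -
  have "\<lfloor>(x + pi) / (2 * pi)\<rfloor> = k"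
    using assms by (intro floor_unique) (simp_all add: field_simps)
  then show ?thesis by (simp add: wrap_def)
qed

lemma wrap_plus_2pi: "wrap (x + 2 * pi) = wrap x"
proof -
  have "(x + 2 * pi + pi) / (2 * pi) = (x + pi) / (2 * pi) + 1" by (simp add: field_simps)
  then show ?thesis by (simp add: wrap_def algebra_simps)
qed

lemma ex_wrap: "\<exists>k. x = wrap x + 2 * pi * of_int k"
  by (intro exI[of _ "\<lfloor>(x + pi) / (2 * pi)\<rfloor>"]) (simp add: wrap_def)

lemma periodic_2pi_wrap: "periodic_2pi u \<Longrightarrow> u (wrap x) = u x"
  using periodic_2pi_int ex_wrap by metis

lemma periodic_extension:
  assumes f: "continuous_on {-pi..pi} f" and ends: "f (-pi) = f pi"
  obtains F where "periodic_2pi F" "continuous_on UNIV F" "\<And>x. x \<in> {-pi..pi} \<Longrightarrow> F x = f x"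
proof
  define F where "F x = f (wrap x)" for x
  have Fk: "F x = f (x - 2 * pi * of_int k)" if "x \<in> {-pi + 2 * pi * of_int k..pi + 2 * pi * of_int k}" for x k
  proof (cases "x = pi + 2 * pi * of_int k")
    case True
    have "wrap x = x - 2 * pi * of_int (k + 1)"
      using that True by (intro wrap_eqI) (auto simp: algebra_simps)
    then have "wrap x = -pi" using True by (simp add: algebra_simps)
    then show ?thesis using True ends by (simp add: F_def)
  next
    case False
    then show ?thesis using that by (simp add: F_def wrap_eqI[of k])
  qed
  have ck: "continuous_on {-pi + 2 * pi * of_int k..pi + 2 * pi * of_int k} F" for k
  proof -
    have "continuous_on {-pi + 2 * pi * of_int k..pi + 2 * pi * of_int k} (\<lambda>x. f (x - 2 * pi * of_int k))"
      by (rule continuous_on_compose2[OF f]) (auto intro!: continuous_intros)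
    then show ?thesis using Fk by (subst continuous_on_cong[OF refl]) auto
  qed
  have "isCont F x" for x
  proof -
    obtain k where k: "x = wrap x + 2 * pi * of_int k" using ex_wrap by blast
    define I where "I j = {-pi + 2 * pi * of_int j..pi + 2 * pi * of_int j}" for j :: int
    \<comment> \<open>\<open>x\<close> may be the left end of its own cell, so the preceding cell is
      attached to make it an interior point.\<close>
    have "continuous_on (I (k - 1) \<union> I k) F"
      by (rule continuous_on_closed_Un) (auto simp only: I_def closed_atLeastAtMost ck)
    moreover have "I (k - 1) \<union> I k = {-pi + 2 * pi * of_int (k - 1)..pi + 2 * pi * of_int k}"
      unfolding I_def by (subst ivl_disj_un_two_touch(4)[symmetric, of _ "-pi + 2 * pi * of_int k"]) (auto simp: algebra_simps)
    ultimately have "continuous_on {-pi + 2 * pi * of_int (k - 1)..pi + 2 * pi * of_int k} F" by simp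
    then show ?thesis
      by (rule continuous_on_interior) (use k wrap_range[of x] in \<open>simp add: algebra_simps\<close>)
  qed
  then show "continuous_on UNIV F" by (simp add: continuous_at_imp_continuous_on)
  show "periodic_2pi F" by (simp add: periodic_2pi_def F_def wrap_plus_2pi)
  show "F x = f x" if "x \<in> {-pi..pi}" for x using Fk[of x 0] that by simp
qed

lemma AE_periodic:
  assumes ae: "AE x in lebesgue. x \<in> {-pi..pi} \<longrightarrow> P x" and per: "\<And>x. P (x + 2 * pi) = P x"
  shows "AE x in lebesgue. P x"
proof -
  have P: "P (x + 2 * pi * of_int k) = P x" for x k
  proof (induction k rule: int_induct[where k=0])
    case (step1 k)
    then show ?case using per[of "x + 2 * pi * of_int k"] by (simp add: algebra_simps)
  next
    case (step2 k)
    then show ?case using per[of "x + 2 * pi * of_int (k - 1)"] by (simp add: algebra_simps)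
  qed simp
  define N where "N = {x \<in> {-pi..pi}. \<not> P x}"
  have "negligible N"
  proof -
    obtain N' where "N' \<in> null_sets lebesgue" "{x. \<not> (x \<in> {-pi..pi} \<longrightarrow> P x)} \<subseteq> N'"
      using ae unfolding eventually_ae_filter by auto
    then show ?thesis using negligible_subset[of N' N] by (auto simp: negligible_iff_null_sets N_def)
  qed
  then have "negligible (\<Union>k::int. (+) (2 * pi * of_int k) ` N)"
    by (intro negligible_countable_Union) (auto intro: negligible_translation)
  moreover have "{x. \<not> P x} \<subseteq> (\<Union>k::int. (+) (2 * pi * of_int k) ` N)"
  proof
    fix x assume "x \<in> {x. \<not> P x}"
    moreover obtain k where k: "x = wrap x + 2 * pi * of_int k" using ex_wrap by blast
    ultimately have "wrap x \<in> N" using P[of "wrap x" k] wrap_range[of x] by (auto simp: N_def)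
    then show "x \<in> (\<Union>k::int. (+) (2 * pi * of_int k) ` N)"
      using k by (auto simp: image_iff algebra_simps intro!: exI[of _ k] bexI[of _ "wrap x"])
  qed
  ultimately have "negligible {x. \<not> P x}" using negligible_subset by blast
  then show ?thesis by (simp add: negligible_iff_null_sets eventually_ae_filter) blast
qed

text \<open>The two sides differ, between \<open>x\<close> and \<open>y\<close>, by at most a constant times
  \<open>\<bar>y - x\<bar> * \<integral>\<bar>g\<bar>\<close> over the interval, so their difference has derivative zero everywhere although
  the indefinite integral of \<open>g\<close> need not be differentiable.\<close>

lemma integral_by_parts_indefinite:
  fixes g \<phi> \<phi>' :: "real \<Rightarrow> real"
  assumes ab: "a \<le> b" and g: "g absolutely_integrable_on {a..b}"
    and d: "\<And>x. (\<phi> has_real_derivative \<phi>' x) (at x)" and c: "continuous_on {a..b} \<phi>'"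
  defines "G \<equiv> \<lambda>x. integral {a..x} g"
  shows "integral {a..b} (\<lambda>x. G x * \<phi>' x) = G b * \<phi> b - integral {a..b} (\<lambda>x. g x * \<phi> x)"
proof -
  define W where "W x = integral {a..x} (\<lambda>x. \<bar>g x\<bar>)" for x
  have gi: "g integrable_on {a..b}" and agi: "(\<lambda>x. \<bar>g x\<bar>) integrable_on {a..b}"
    using g by (auto simp: absolutely_integrable_on_def)
  have cG: "continuous_on {a..b} G" unfolding G_def by (rule indefinite_integral_continuous_1[OF gi])
  have cW: "continuous_on {a..b} W" unfolding W_def by (rule indefinite_integral_continuous_1[OF agi])
  have c\<phi>: "continuous_on S \<phi>" for S
    by (rule DERIV_continuous_on[of _ _ \<phi>']) (auto intro: has_field_derivative_at_within d)
  obtain C where C: "C > 0" "\<And>x. x \<in> {a..b} \<Longrightarrow> \<bar>\<phi>' x\<bar> \<le> C"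
  proof -
    have "bounded (\<phi>' ` {a..b})" using c by (intro compact_imp_bounded compact_continuous_image) auto
    then show ?thesis using that by (auto simp: bounded_pos)
  qed
  define f where "f x = g x * \<phi> x + G x * \<phi>' x" for x
  have fi1: "(\<lambda>x. g x * \<phi> x) integrable_on {a..b}"
    using abs_integrable_mult_continuous[OF g c\<phi>] set_lebesgue_integral_eq_integral(1) by blast
  have fi2: "(\<lambda>x. G x * \<phi>' x) integrable_on {a..b}"
    by (intro integrable_continuous_real continuous_intros cG c)
  have fi: "f integrable_on {a..b}"
    unfolding f_def by (intro integrable_add fi1 fi2)
  define R where "R x = integral {a..x} f - G x * \<phi> x" for x
  have est: "\<bar>R y - R x\<bar> \<le> 2 * C * \<bar>y - x\<bar> * \<bar>W y - W x\<bar>" if xy: "a \<le> x" "x \<le> y" "y \<le> b" for x y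
  proof -
    have sub: "h integrable_on {x..y}" "h integrable_on {a..y}" if "h integrable_on {a..b}" for h :: "real \<Rightarrow> real"
      using xy by (auto intro: integrable_on_subinterval[OF that])
    have comb: "integral {a..y} h - integral {a..x} h = integral {x..y} h" if "h integrable_on {a..b}" for h :: "real \<Rightarrow> real"
      using Henstock_Kurzweil_Integration.integral_combine[OF xy(1,2) sub(2)[OF that]] by simp
    have Gd: "\<bar>G s - G x\<bar> \<le> W y - W x" if s: "s \<in> {x..y}" for s
    proof -
      have *: "h integrable_on {a..s}" "h integrable_on {x..s}" if "h integrable_on {a..b}" for h :: "real \<Rightarrow> real"
        using xy s by (auto intro: integrable_on_subinterval[OF that])
      have "G s - G x = integral {x..s} g"
        unfolding G_def using Henstock_Kurzweil_Integration.integral_combine[of a x s, OF _ _ *(1)[OF gi]] xy s by auto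
      also have "\<bar>\<dots>\<bar> \<le> integral {x..s} (\<lambda>x. \<bar>g x\<bar>)"
        using integral_norm_bound_integral[OF *(2)[OF gi] *(2)[OF agi]] by auto
      also have "\<dots> \<le> integral {x..y} (\<lambda>x. \<bar>g x\<bar>)"
        by (rule integral_subset_le) (use s * sub agi in auto)
      also have "\<dots> = W y - W x" unfolding W_def using comb[OF agi] by simp
      finally show ?thesis .
    qed
    have \<phi>d: "((\<lambda>s. G x * \<phi>' s) has_integral (G x * (\<phi> y - \<phi> x))) {x..y}"
      by (intro has_integral_mult_right fundamental_theorem_of_calculus)
        (use xy in \<open>auto simp flip: has_real_derivative_iff_has_vector_derivative intro: has_field_derivative_at_within d\<close>)
    have "R y - R x = integral {x..y} f - (G y - G x) * \<phi> y - G x * (\<phi> y - \<phi> x)"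
      unfolding R_def comb[OF fi, symmetric] by (simp add: algebra_simps)
    also have "\<dots> = integral {x..y} f - integral {x..y} (\<lambda>s. g s * \<phi> y) - integral {x..y} (\<lambda>s. G x * \<phi>' s)"
      using comb[OF gi] integral_unique[OF \<phi>d]
      by (simp only: G_def integral_mult_left)
    also have "\<dots> = integral {x..y} (\<lambda>s. f s - g s * \<phi> y - G x * \<phi>' s)"
      using sub(1)[OF fi] sub(1)[OF gi] has_integral_integrable[OF \<phi>d]
      by (simp add: Henstock_Kurzweil_Integration.integral_diff integrable_diff integrable_on_mult_left)
    also have "norm \<dots> \<le> integral {x..y} (\<lambda>s. C * (y - x) * \<bar>g s\<bar> + C * (W y - W x))"
    proof (rule integral_norm_bound_integral)
      show "(\<lambda>s. f s - g s * \<phi> y - G x * \<phi>' s) integrable_on {x..y}"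
        using sub(1)[OF fi] sub(1)[OF gi] has_integral_integrable[OF \<phi>d]
        by (auto intro!: integrable_diff integrable_on_mult_left)
      show "(\<lambda>s. C * (y - x) * \<bar>g s\<bar> + C * (W y - W x)) integrable_on {x..y}"
        using sub(1)[OF agi] by (intro integrable_add integrable_on_mult_right) auto
      fix s assume s: "s \<in> {x..y}"
      have "\<bar>\<phi> s - \<phi> y\<bar> \<le> C * \<bar>s - y\<bar>"
        using field_differentiable_bound[of "{s..y}" \<phi> \<phi>' C s y] d C s xy
        by (auto intro: has_field_derivative_at_within)
      also have "\<dots> \<le> C * (y - x)" using s C by (intro mult_left_mono) auto
      finally have 1: "\<bar>g s\<bar> * \<bar>\<phi> s - \<phi> y\<bar> \<le> \<bar>g s\<bar> * (C * (y - x))" by (intro mult_left_mono) auto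
      have 2: "\<bar>G s - G x\<bar> * \<bar>\<phi>' s\<bar> \<le> (W y - W x) * C"
        using Gd[OF s] C(2)[of s] s xy C(1) abs_ge_zero[of "G s - G x"] by (intro mult_mono) auto
      have "f s - g s * \<phi> y - G x * \<phi>' s = g s * (\<phi> s - \<phi> y) + (G s - G x) * \<phi>' s"
        by (simp add: f_def algebra_simps)
      also have "norm \<dots> \<le> \<bar>g s\<bar> * \<bar>\<phi> s - \<phi> y\<bar> + \<bar>G s - G x\<bar> * \<bar>\<phi>' s\<bar>"
        by (metis abs_mult abs_triangle_ineq real_norm_def)
      finally show "norm (f s - g s * \<phi> y - G x * \<phi>' s) \<le> C * (y - x) * \<bar>g s\<bar> + C * (W y - W x)"
        using 1 2 by (simp add: algebra_simps)
    qed
    also have "\<dots> = C * (y - x) * (W y - W x) + (y - x) * (C * (W y - W x))"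
      using sub(1)[OF agi] comb[OF agi] xy
      by (subst Henstock_Kurzweil_Integration.integral_add)
        (auto intro!: integrable_on_mult_right simp: W_def)
    also have "\<dots> = 2 * C * (y - x) * (W y - W x)" by (simp add: algebra_simps)
    also have "\<dots> \<le> 2 * C * \<bar>y - x\<bar> * \<bar>W y - W x\<bar>"
      using Gd[of x] xy by auto
    finally show ?thesis by simp
  qed
  have est': "\<bar>R y - R x\<bar> \<le> 2 * C * \<bar>y - x\<bar> * \<bar>W y - W x\<bar>" if "x \<in> {a..b}" "y \<in> {a..b}" for x y
    using est[of x y] est[of y x] that by (cases "x \<le> y") (auto simp: abs_minus_commute)
  have "(R has_field_derivative 0) (at x within {a..b})" if x: "x \<in> {a..b}" for x
    unfolding has_field_derivative_iff
  proof (rule Lim_null_comparison)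
    have "((\<lambda>y. 2 * C * \<bar>W y - W x\<bar>) \<longlongrightarrow> 2 * C * \<bar>W x - W x\<bar>) (at x within {a..b})"
      using cW x by (intro tendsto_intros) (auto simp: continuous_on_def)
    then show "((\<lambda>y. 2 * C * \<bar>W y - W x\<bar>) \<longlongrightarrow> 0) (at x within {a..b})" by simp
    show "\<forall>\<^sub>F y in at x within {a..b}. norm ((R y - R x) / (y - x)) \<le> 2 * C * \<bar>W y - W x\<bar>"
      unfolding eventually_at_filter
      using est'[OF x] by (auto simp: field_simps intro!: always_eventually)
  qed
  then have "\<exists>c. \<forall>x\<in>{a..b}. R x = c"
    by (intro has_field_derivative_zero_constant) auto
  then have "R b = R a" using ab by auto
  also have "R a = 0" by (simp add: R_def G_def)
  finally have "integral {a..b} f = G b * \<phi> b" by (simp add: R_def)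
  moreover have "integral {a..b} f = integral {a..b} (\<lambda>x. g x * \<phi> x) + integral {a..b} (\<lambda>x. G x * \<phi>' x)"
    unfolding f_def by (rule Henstock_Kurzweil_Integration.integral_add[OF fi1 fi2])
  ultimately show ?thesis by simp
qed

lemma continuous_primitive:
  fixes f :: "real \<Rightarrow> real"
  assumes "continuous_on UNIV f"
  obtains F where "\<And>x. (F has_real_derivative f x) (at x)" "F 0 = 0"
proof -
  define P where "P x = (LBINT y=ereal 0..x. f y)" for x :: real
  have "(P has_real_derivative f x) (at x)" for x
  proof -
    have "(P has_vector_derivative f x) (at x within {min (x - 1) (-1)..max (x + 1) 1})"
      unfolding P_def by (rule interval_integral_FTC2) (auto intro: continuous_on_subset[OF assms])
    moreover have "at x within {min (x - 1) (-1)..max (x + 1) 1} = at x"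
      by (rule at_within_interior) auto
    ultimately show ?thesis by (simp add: has_real_derivative_iff_has_vector_derivative)
  qed
  moreover have "P 0 = 0" by (simp add: P_def flip: zero_ereal_def)
  ultimately show ?thesis using that by blast
qed

section \<open>Continuous representatives of Sobolev functions\<close>

lemma abs_integrable_if_square_integrable:
  fixes v :: "real \<Rightarrow> real"
  assumes "v \<in> borel_measurable lebesgue" "set_integrable lebesgue {a..b} (\<lambda>x. (v x)\<^sup>2)"
  shows "v absolutely_integrable_on {a..b::real}"
proof (rule set_integrable_bound)
  have "(\<lambda>x. 1 :: real) absolutely_integrable_on {a..b}"
    by (rule absolutely_integrable_continuous_real) auto
  then show "(\<lambda>x. 1 + (v x)\<^sup>2) absolutely_integrable_on {a..b}"
    using assms(2) by (rule set_integral_add(1))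
  show "set_borel_measurable lebesgue {a..b} v"
    unfolding set_borel_measurable_def
    by (intro borel_measurable_scaleR borel_measurable_indicator assms(1)) auto
  have "\<bar>v x\<bar> \<le> 1 + (v x)\<^sup>2" for x
    using zero_le_power2[of "\<bar>v x\<bar> - 1"] zero_le_power2[of "v x"] abs_ge_zero[of "v x"]
    unfolding power2_diff power2_abs by simp
  then show "AE x in lebesgue. x \<in> {a..b} \<longrightarrow> norm (v x) \<le> norm (1 + (v x)\<^sup>2)"
    by (auto intro!: AE_I2)
qed

lemma L2_circle_abs_integrable:
  "v \<in> L2_circle \<Longrightarrow> v absolutely_integrable_on {-pi..pi}"
  by (rule abs_integrable_if_square_integrable) (auto simp: L2_circle_def)

lemma smooth_on_UNIV_iff: "smooth_on f UNIV \<longleftrightarrow> (\<forall>n. (deriv ^^ n) f differentiable_on UNIV)"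
proof
  assume "smooth_on f UNIV"
  then obtain T g where "UNIV \<subseteq> T" "\<forall>x\<in>UNIV. g x = f x" "\<forall>n. (deriv ^^ n) g differentiable_on T"
    unfolding smooth_on_def by blast
  moreover from this have "T = UNIV" "g = f" by auto
  ultimately show "\<forall>n. (deriv ^^ n) f differentiable_on UNIV" by simp
qed (auto simp: smooth_on_def)

lemma smooth_primitive:
  assumes "smooth_on p UNIV" and P: "\<And>x. (P has_real_derivative p x) (at x)"
  shows "smooth_on P UNIV"
  unfolding smooth_on_UNIV_iff
proof
  fix n
  have dP: "deriv P = p" using P by (auto intro: DERIV_imp_deriv)
  show "(deriv ^^ n) P differentiable_on UNIV"
  proof (cases n)
    case 0
    then show ?thesis using P by (auto simp: differentiable_on_def real_differentiable_def)
  next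
    case (Suc m)
    then show ?thesis using assms(1) dP by (simp add: smooth_on_UNIV_iff funpow_Suc_right del: funpow.simps)
  qed
qed

lemma smooth_on_has_derivative:
  assumes "smooth_on p UNIV"
  shows "(p has_real_derivative deriv p x) (at x)" "continuous_on S p" "smooth_on (deriv p) UNIV"
proof -
  have p: "(deriv ^^ n) p differentiable_on UNIV" for n
    using assms by (simp add: smooth_on_UNIV_iff)
  show *: "(p has_real_derivative deriv p x) (at x)" for x
    using p[of 0] by (simp add: differentiable_on_def DERIV_deriv_iff_real_differentiable)
  then show "continuous_on S p"
    by (intro DERIV_continuous_on) (auto intro: has_field_derivative_at_within)
  have "(deriv ^^ n) (deriv p) differentiable_on UNIV" for n
    using p[of "Suc n"] by (simp add: funpow_Suc_right del: funpow.simps)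
  then show "smooth_on (deriv p) UNIV" by (simp add: smooth_on_UNIV_iff)
qed

text \<open>The increment of a primitive over one period does not depend on \<open>x\<close> and
  equals the integral of \<open>p\<close>, which is 0. So every smooth periodic function of mean
  zero is the derivative of an admissible test function.\<close>

lemma periodic_antiderivative:
  assumes p: "periodic_2pi p" "smooth_on p UNIV" and mean: "integral {-pi..pi} p = 0"
  obtains P where "periodic_2pi P" "smooth_on P UNIV" "\<And>x. (P has_real_derivative p x) (at x)"
proof -
  have cp: "continuous_on S p" for S using smooth_on_has_derivative(2)[OF p(2)] .
  obtain P where P: "\<And>x. (P has_real_derivative p x) (at x)"
    using continuous_primitive[OF cp] by blast
  have "P (x + 2 * pi) = P x" for x
  proof -
    have "((\<lambda>x. P (x + 2 * pi) - P x) has_real_derivative p (x + 2 * pi) * 1 - p x) (at x)" for x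
      using P by (auto intro!: derivative_eq_intros DERIV_shift[THEN iffD1])
    then have "((\<lambda>x. P (x + 2 * pi) - P x) has_real_derivative 0) (at x)" for x
      using p(1) by (simp add: periodic_2pi_def)
    then have "P (x + 2 * pi) - P x = P (-pi + 2 * pi) - P (-pi)"
      using DERIV_isconst_all[of "\<lambda>x. P (x + 2 * pi) - P x"] by blast
    also have "(p has_integral (P pi - P (-pi))) {-pi..pi}"
      by (intro fundamental_theorem_of_calculus)
        (auto simp flip: has_real_derivative_iff_has_vector_derivative intro: has_field_derivative_at_within P)
    then have "P (-pi + 2 * pi) - P (-pi) = 0" using mean by (simp add: integral_unique)
    finally show ?thesis by simp
  qed
  then show ?thesis using that[OF _ smooth_primitive[OF p(2) P] P] by (simp add: periodic_2pi_def)
qed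

lemma weak_deriv_circle_integral_zero:
  assumes "weak_deriv_circle v g"
  shows "integral {-pi..pi} g = 0"
proof -
  have g: "g absolutely_integrable_on {-pi..pi}"
    using assms by (intro L2_circle_abs_integrable) (auto simp: weak_deriv_circle_def)
  have "(LINT x:{-pi..pi}|lebesgue. v x * deriv (\<lambda>x. 1) x) = - (LINT x:{-pi..pi}|lebesgue. g x * 1)"
    using assms[unfolded weak_deriv_circle_def, THEN conjunct2, rule_format, of "\<lambda>x. 1"]
      smooth_on_elementary[OF elementary_on.const[of 1]] by (simp add: periodic_2pi_def)
  then show ?thesis using set_lebesgue_integral_eq_integral(2)[OF g] by simp
qed

text \<open>Du Bois-Reymond's argument. With \<open>G\<close> the indefinite integral of
  \<open>g\<close>, integration by parts shows that \<open>v - G\<close> is orthogonal to every test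
  function of mean zero; after subtraction of its mean \<open>m\<close> it is orthogonal to all test
  functions and vanishes almost everywhere.\<close>

lemma weak_deriv_circle_representative:
  assumes v: "v \<in> L2_circle" and g: "weak_deriv_circle v g"
  obtains V where "periodic_2pi V" "continuous_on UNIV V" "AE x in lebesgue. v x = V x"
    "\<And>x y. -pi \<le> x \<Longrightarrow> x \<le> y \<Longrightarrow> y \<le> pi \<Longrightarrow> V y - V x = integral {x..y} g"
proof -
  define G where "G x = integral {-pi..x} g" for x
  have ga: "g absolutely_integrable_on {-pi..pi}"
    using g by (intro L2_circle_abs_integrable) (auto simp: weak_deriv_circle_def)
  have va: "v absolutely_integrable_on {-pi..pi}" using v by (rule L2_circle_abs_integrable)
  have gi: "g integrable_on {-pi..pi}" using ga set_lebesgue_integral_eq_integral(1) by blast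
  have cG: "continuous_on {-pi..pi} G" unfolding G_def by (rule indefinite_integral_continuous_1[OF gi])
  have Gpi: "G pi = 0" using weak_deriv_circle_integral_zero[OF g] by (simp add: G_def)
  define m where "m = integral {-pi..pi} (\<lambda>x. v x - G x) / (2 * pi)"
  define w where "w x = v x - G x - m" for x
  have vGa: "(\<lambda>x. v x - G x) absolutely_integrable_on {-pi..pi}"
    using va absolutely_integrable_continuous_real[OF cG] by (rule set_integral_diff(1))
  have wa: "w absolutely_integrable_on {-pi..pi}"
    unfolding w_def using vGa absolutely_integrable_continuous_real[OF continuous_on_const]
    by (rule set_integral_diff(1))
  have orth: "integral {-pi..pi} (\<lambda>x. w x * p x) = 0" if p: "periodic_2pi p" "smooth_on p UNIV" for p
  proof -
    \<comment> \<open>\<open>p - c\<close> has mean zero, hence a periodic primitive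
      \<open>P\<close> that can be inserted in the weak formulation.\<close>
    define c where "c = integral {-pi..pi} p / (2 * pi)"
    have cp: "continuous_on S p" for S using smooth_on_has_derivative(2)[OF p(2)] .
    have "smooth_on (\<lambda>x. p x - c) UNIV"
    proof (rule smooth_primitive)
      fix x show "((\<lambda>x. p x - c) has_real_derivative deriv p x) (at x)"
        using smooth_on_has_derivative(1)[OF p(2)] by (auto intro!: derivative_eq_intros)
    qed (rule smooth_on_has_derivative(3)[OF p(2)])
    moreover have "periodic_2pi (\<lambda>x. p x - c)" using p(1) by (simp add: periodic_2pi_def)
    moreover have "integral {-pi..pi} (\<lambda>x. p x - c) = 0"
      by (subst Henstock_Kurzweil_Integration.integral_diff)
        (auto simp: c_def intro: integrable_continuous_real cp)
    ultimately obtain P where P: "periodic_2pi P" "smooth_on P UNIV"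
        "\<And>x. (P has_real_derivative p x - c) (at x)"
      using periodic_antiderivative by blast
    have dP: "deriv P = (\<lambda>x. p x - c)" using P(3) by (auto intro: DERIV_imp_deriv)
    have cq: "continuous_on {-pi..pi} (\<lambda>x. p x - c)" by (intro continuous_intros cp)
    have i1: "(\<lambda>x. v x * (p x - c)) absolutely_integrable_on {-pi..pi}"
      "(\<lambda>x. (v x - G x) * (p x - c)) absolutely_integrable_on {-pi..pi}"
      "(\<lambda>x. g x * P x) absolutely_integrable_on {-pi..pi}"
      by (intro abs_integrable_mult_continuous va vGa ga cq smooth_on_has_derivative(2)[OF P(2)])+
    have i2: "(\<lambda>x. (v x - G x)) absolutely_integrable_on {-pi..pi}"
       "(\<lambda>x. (v x - G x) * p x) absolutely_integrable_on {-pi..pi}"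
      by (intro abs_integrable_mult_continuous vGa cp)+
    note i = set_lebesgue_integral_eq_integral(1)
    have i3: "(\<lambda>x. G x * (p x - c)) integrable_on {-pi..pi}"
      by (intro integrable_continuous_real continuous_intros cG cp)
    have "(LINT x:{-pi..pi}|lebesgue. v x * deriv P x) = - (LINT x:{-pi..pi}|lebesgue. g x * P x)"
      using g P unfolding weak_deriv_circle_def by blast
    then have "integral {-pi..pi} (\<lambda>x. v x * (p x - c)) = - integral {-pi..pi} (\<lambda>x. g x * P x)"
      using i1 by (simp add: dP set_lebesgue_integral_eq_integral(2))
    moreover have "integral {-pi..pi} (\<lambda>x. G x * (p x - c)) = - integral {-pi..pi} (\<lambda>x. g x * P x)"
      using integral_by_parts_indefinite[OF _ ga P(3) cq] Gpi by (simp add: G_def)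
    ultimately have "integral {-pi..pi} (\<lambda>x. v x * (p x - c) - G x * (p x - c)) = 0"
      by (subst Henstock_Kurzweil_Integration.integral_diff[OF i[OF i1(1)] i3]) simp
    then have z: "integral {-pi..pi} (\<lambda>x. (v x - G x) * p x - c * (v x - G x)) = 0"
      by (simp add: algebra_simps)
    have "integral {-pi..pi} (\<lambda>x. w x * p x) = integral {-pi..pi} (\<lambda>x. (v x - G x) * p x - m * p x)"
      by (simp add: w_def algebra_simps)
    also have "\<dots> = integral {-pi..pi} (\<lambda>x. (v x - G x) * p x) - m * integral {-pi..pi} p"
      by (subst Henstock_Kurzweil_Integration.integral_diff[OF i[OF i2(2)]])
         (auto intro!: integrable_on_mult_right integrable_continuous_real cp continuous_intros)
    \<comment> \<open>Both sides are the product of the two integrals divided by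
      \<open>2 * pi\<close>: subtracting the mean is a symmetric operation and can be moved from one
      factor to the other.\<close>
    also have "m * integral {-pi..pi} p = c * integral {-pi..pi} (\<lambda>x. v x - G x)"
      by (simp add: m_def c_def)
    also have "integral {-pi..pi} (\<lambda>x. (v x - G x) * p x) - c * integral {-pi..pi} (\<lambda>x. v x - G x)
       = integral {-pi..pi} (\<lambda>x. (v x - G x) * p x - c * (v x - G x))"
      by (subst Henstock_Kurzweil_Integration.integral_diff[OF i[OF i2(2)]])
         (auto intro!: integrable_on_mult_right i[OF i2(1)])
    finally show ?thesis using z by simp
  qed
  obtain V where V: "periodic_2pi V" "continuous_on UNIV V" "\<And>x. x \<in> {-pi..pi} \<Longrightarrow> V x = G x + m"
  proof (rule periodic_extension[of "\<lambda>x. G x + m"])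
    show "continuous_on {-pi..pi} (\<lambda>x. G x + m)" by (intro continuous_intros cG)
    show "G (-pi) + m = G pi + m" using Gpi by (simp add: G_def)
  qed blast
  have "AE x in lebesgue. x \<in> {-pi..pi} \<longrightarrow> v x = V x"
  proof -
    have "AE x in lebesgue. x \<in> {-pi..pi} \<longrightarrow> w x = 0"
      by (rule AE_zero_if_orthogonal[OF wa orth])
    then show ?thesis by (elim eventually_mono) (auto simp: V(3) w_def)
  qed
  then have "AE x in lebesgue. v x = V x"
    by (rule AE_periodic) (use v V(1) in \<open>auto simp: L2_circle_def periodic_2pi_def\<close>)
  moreover have "V y - V x = integral {x..y} g" if xy: "-pi \<le> x" "x \<le> y" "y \<le> pi" for x y
  proof -
    have "g integrable_on {-pi..y}" by (rule integrable_on_subinterval[OF gi]) (use xy in auto)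
    then show ?thesis
      using Henstock_Kurzweil_Integration.integral_combine[OF xy(1,2), of g] xy
      by (simp add: V(3) G_def)
  qed
  ultimately show ?thesis using that V by blast
qed

lemma weak_deriv_circle_unique:
  assumes "weak_deriv_circle v g" "weak_deriv_circle v h"
  shows "AE x in lebesgue. x \<in> {-pi..pi} \<longrightarrow> g x = h x"
proof -
  have a: "g absolutely_integrable_on {-pi..pi}" "h absolutely_integrable_on {-pi..pi}"
    using assms by (auto intro!: L2_circle_abs_integrable simp: weak_deriv_circle_def)
  have "AE x in lebesgue. x \<in> {-pi..pi} \<longrightarrow> g x - h x = 0"
  proof (rule AE_zero_if_orthogonal)
    show "(\<lambda>x. g x - h x) absolutely_integrable_on {-pi..pi}" using a by (rule set_integral_diff(1))
    fix p assume p: "periodic_2pi p" "smooth_on p UNIV"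
    have i: "(\<lambda>x. g x * p x) absolutely_integrable_on {-pi..pi}" "(\<lambda>x. h x * p x) absolutely_integrable_on {-pi..pi}"
      by (intro abs_integrable_mult_continuous a smooth_on_has_derivative(2)[OF p(2)])+
    have "(LINT x:{-pi..pi}|lebesgue. g x * p x) = (LINT x:{-pi..pi}|lebesgue. h x * p x)"
      using assms[unfolded weak_deriv_circle_def, THEN conjunct2, rule_format, OF conjI[OF p]] by linarith
    then have "integral {-pi..pi} (\<lambda>x. g x * p x) = integral {-pi..pi} (\<lambda>x. h x * p x)"
      using i by (simp add: set_lebesgue_integral_eq_integral(2))
    then show "integral {-pi..pi} (\<lambda>x. (g x - h x) * p x) = 0"
      unfolding left_diff_distrib
      by (subst Henstock_Kurzweil_Integration.integral_diff)
        (auto intro: i set_lebesgue_integral_eq_integral(1))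
  qed
  then show ?thesis by simp
qed

section \<open>Dyadic Dirichlet energy\<close>

definition grid :: "nat \<Rightarrow> int \<Rightarrow> real" where
  "grid N i = - pi + 2 * pi * of_int i / 2 ^ N"

text \<open>This is the integral of \<open>u' * v'\<close> for the piecewise linear interpolants of
  \<open>u\<close> and \<open>v\<close> on the grid of level \<open>N\<close>. Only point values
  enter, so it makes sense for every function.\<close>

definition dyadic_form :: "nat \<Rightarrow> (real \<Rightarrow> real) \<Rightarrow> (real \<Rightarrow> real) \<Rightarrow> real" where
  "dyadic_form N u v = (\<Sum>i\<in>{0..<2 ^ N}. (u (grid N (i + 1)) - u (grid N i)) * (v (grid N (i + 1)) - v (grid N i)))
     * (2 ^ N / (2 * pi))"

definition finite_dirichlet :: "(real \<Rightarrow> real) \<Rightarrow> bool" where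
  "finite_dirichlet u \<longleftrightarrow> bdd_above (range (\<lambda>N. dyadic_form N u u))"

text \<open>The real supremum of an unbounded set carries no information; for this reason
  \<open>competitors\<close> contains the condition \<open>finite_dirichlet\<close>.\<close>

definition dirichlet :: "(real \<Rightarrow> real) \<Rightarrow> real" where
  "dirichlet u = (SUP N. dyadic_form N u u)"

definition reduced_energy :: "real \<Rightarrow> (real \<Rightarrow> real) \<Rightarrow> real" where
  "reduced_energy \<alpha> u = dirichlet u / 2 - \<alpha>\<^sup>2 / 2 * integral {-pi..pi} (\<lambda>x. (u x)\<^sup>2)
     - integral {-pi..pi} (\<lambda>x. u x * cos x)"

definition competitors :: "real \<Rightarrow> (real \<Rightarrow> real) set" where
  "competitors M = {u. periodic_2pi u \<and> continuous_on UNIV u \<and> finite_dirichlet u \<and>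
     (\<forall>x. 0 \<le> u x) \<and> integral {-pi..pi} u = M}"

lemma grid_0: "grid N 0 = -pi" and grid_2_power: "grid N (2 ^ N) = pi"
  by (simp_all add: grid_def)

lemma grid_step: "grid N (i + 1) = grid N i + 2 * pi / 2 ^ N"
  by (simp add: grid_def add_divide_distrib distrib_left)

lemma grid_width_le_pi:
  assumes "N \<ge> 1"
  shows "2 * pi / 2 ^ N \<le> pi"
proof -
  have "(2::real) ^ 1 \<le> 2 ^ N" using assms by (intro power_increasing) auto
  then have "2 * pi / 2 ^ N \<le> 2 * pi / 2" by (intro divide_left_mono) auto
  then show ?thesis by simp
qed

lemma grid_mono: "i \<le> j \<Longrightarrow> grid N i \<le> grid N j"
  by (simp add: grid_def divide_right_mono mult_left_mono)

lemma grid_refine: "grid (Suc N) (2 * i) = grid N i"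
  by (simp add: grid_def)

lemma periodic_2pi_grid: "periodic_2pi u \<Longrightarrow> u (grid N (i + 2 ^ N)) = u (grid N i)"
  using periodic_2pi_int[of u "grid N i" 1] by (simp add: grid_def add_divide_distrib distrib_left algebra_simps)

lemma grid_range:
  assumes "i \<in> {0..<2 ^ N}"
  shows "-pi \<le> grid N i" "grid N i \<le> grid N (i + 1)" "grid N (i + 1) \<le> pi"
  using assms grid_mono[of 0 i N] grid_mono[of i "i + 1" N] grid_mono[of "i + 1" "2 ^ N" N]
  by (auto simp: grid_0 grid_2_power)

text \<open>The affine index map permutes the residues modulo \<open>P\<close>. The sign -1 serves
  reflections of the grid, the sign 1 shifts.\<close>

lemma sum_periodic_affine:
  fixes f :: "int \<Rightarrow> 'a :: comm_monoid_add"
  assumes P: "P > 0" and per: "\<And>i. f (i + P) = f i" and s: "s = 1 \<or> s = -1"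
  shows "(\<Sum>i\<in>{0..<P}. f (s * i + c)) = (\<Sum>i\<in>{0..<P}. f i)"
proof -
  have shift: "f (i + P * k) = f i" for i k
  proof (induction k rule: int_induct[where k=0])
    case (step1 k)
    then show ?case using per[of "i + P * k"] by (simp add: algebra_simps)
  next
    case (step2 k)
    then show ?case using per[of "i + P * (k - 1)"] by (simp add: algebra_simps)
  qed simp
  have fmod: "f (i mod P) = f i" for i
    using shift[of "i mod P" "i div P"] by (simp add: mod_mult_div_eq)
  have "inj_on (\<lambda>i. (s * i + c) mod P) {0..<P}"
  proof (rule inj_onI)
    fix i j assume ij: "i \<in> {0..<P}" "j \<in> {0..<P}" and "(s * i + c) mod P = (s * j + c) mod P"
    then have "P dvd (s * i + c) - (s * j + c)" by (simp add: mod_eq_dvd_iff)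
    then have "P dvd s * (i - j)" by (simp add: algebra_simps)
    then have "P dvd i - j" using s by (auto simp: dvd_diff_commute)
    then show "i = j" using ij by (auto dest: zdvd_imp_le simp: mod_eq_dvd_iff[symmetric])
  qed
  moreover have "(\<lambda>i. (s * i + c) mod P) ` {0..<P} \<subseteq> {0..<P}" using P by auto
  ultimately have "bij_betw (\<lambda>i. (s * i + c) mod P) {0..<P} {0..<P}"
    by (simp add: bij_betw_def endo_inj_surj)
  then have "(\<Sum>i\<in>{0..<P}. f ((s * i + c) mod P)) = (\<Sum>i\<in>{0..<P}. f i)"
    by (rule sum.reindex_bij_betw)
  then show ?thesis by (simp add: fmod)
qed

lemma sum_double_int:
  fixes f :: "int \<Rightarrow> 'a :: comm_monoid_add"
  shows "(\<Sum>i\<in>{0..<2 * int n}. f i) = (\<Sum>i\<in>{0..<int n}. f (2 * i) + f (2 * i + 1))"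
proof (induction n)
  case (Suc n)
  have "{0..<2 * int (Suc n)} = insert (2 * int n + 1) (insert (2 * int n) {0..<2 * int n})"
    "{0..<int (Suc n)} = insert (int n) {0..<int n}" by auto
  then show ?case using Suc by (simp add: add.commute add.left_commute add.assoc)
qed simp

lemma dyadic_form_Suc:
  "dyadic_form (Suc N) u v = (\<Sum>i\<in>{0..<2 ^ N}.
      (u (grid (Suc N) (2 * i + 1)) - u (grid N i)) * (v (grid (Suc N) (2 * i + 1)) - v (grid N i))
    + (u (grid N (i + 1)) - u (grid (Suc N) (2 * i + 1))) * (v (grid N (i + 1)) - v (grid (Suc N) (2 * i + 1))))
     * (2 * 2 ^ N / (2 * pi))"
proof -
  have e: "(2::int) ^ Suc N = 2 * int (2 ^ N)" "(2::int) ^ N = int (2 ^ N)" by simp_all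
  have g: "grid (Suc N) (2 * i + 1 + 1) = grid N (i + 1)" for i
    using grid_refine[of N "i + 1"] by (simp add: algebra_simps)
  show ?thesis
    unfolding dyadic_form_def e sum_double_int g grid_refine by simp
qed

lemma dyadic_form_nonneg: "0 \<le> dyadic_form N u u"
  unfolding dyadic_form_def by (rule mult_nonneg_nonneg[OF sum_nonneg]) simp_all

lemma dyadic_form_self:
  "dyadic_form N u u = (\<Sum>i\<in>{0..<2 ^ N}. (u (grid N (i + 1)) - u (grid N i))\<^sup>2 / (2 * pi / 2 ^ N))"
  unfolding dyadic_form_def sum_distrib_right by (simp add: power2_eq_square)

text \<open>Splitting a cell at a midpoint value \<open>m\<close> halves its width, and
  \<open>(b - a)^2 \<le> 2 * ((m - a)^2 + (b - m)^2)\<close> by convexity of the square.\<close>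

lemma dyadic_form_mono_Suc: "dyadic_form N u u \<le> dyadic_form (Suc N) u u"
proof -
  have *: "(b - a) * (b - a) \<le> 2 * ((m - a) * (m - a) + (b - m) * (b - m))" for a b m :: real
    using zero_le_square[of "(m - a) - (b - m)"] by (simp add: algebra_simps)
  have "(\<Sum>i\<in>{0..<2 ^ N}. (u (grid N (i + 1)) - u (grid N i)) * (u (grid N (i + 1)) - u (grid N i)))
    \<le> 2 * (\<Sum>i\<in>{0..<2 ^ N}.
      (u (grid (Suc N) (2 * i + 1)) - u (grid N i)) * (u (grid (Suc N) (2 * i + 1)) - u (grid N i))
    + (u (grid N (i + 1)) - u (grid (Suc N) (2 * i + 1))) * (u (grid N (i + 1)) - u (grid (Suc N) (2 * i + 1))))"
    unfolding sum_distrib_left by (intro sum_mono *)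
  from mult_right_mono[OF this, of "2 ^ N / (2 * pi)"] show ?thesis
    unfolding dyadic_form_Suc unfolding dyadic_form_def by (simp add: mult_ac)
qed

lemma dyadic_form_mono: "N \<le> N' \<Longrightarrow> dyadic_form N u u \<le> dyadic_form N' u u"
  using dyadic_form_mono_Suc by (rule lift_Suc_mono_le)

lemma dyadic_form_le_dirichlet: "finite_dirichlet u \<Longrightarrow> dyadic_form N u u \<le> dirichlet u"
  unfolding dirichlet_def finite_dirichlet_def by (rule cSUP_upper) auto

lemma dirichlet_nonneg: "finite_dirichlet u \<Longrightarrow> 0 \<le> dirichlet u"
  using dyadic_form_le_dirichlet[of u 0] dyadic_form_nonneg[of 0 u] by linarith

text \<open>Coarse levels are dominated by fine ones, so a bound is required only from the level on
  at which a reflection centre or a piecewise affine perturbation is resolved by the grid.\<close>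

lemma dirichlet_leI:
  assumes "\<And>N. N \<ge> n \<Longrightarrow> dyadic_form N u u \<le> C"
  shows "finite_dirichlet u" "dirichlet u \<le> C"
proof -
  have *: "dyadic_form N u u \<le> C" for N
    using assms[of "max n N"] dyadic_form_mono[of N "max n N" u] by simp
  then show "finite_dirichlet u" "dirichlet u \<le> C"
    unfolding finite_dirichlet_def dirichlet_def by (auto intro!: cSUP_least bdd_aboveI)
qed

lemma sum_integral_grid:
  fixes f :: "real \<Rightarrow> real"
  assumes "f integrable_on {-pi..pi}"
  shows "(\<Sum>i\<in>{0..<2 ^ N}. integral {grid N i..grid N (i + 1)} f) = integral {-pi..pi} f"
proof -
  have "(\<Sum>i\<in>{0..<int n}. integral {grid N i..grid N (i + 1)} f) = integral {-pi..grid N (int n)} f"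
    if "n \<le> 2 ^ N" for n
    using that
  proof (induction n)
    case 0
    then show ?case by (simp add: grid_0)
  next
    case (Suc n)
    have e: "{0..<int (Suc n)} = insert (int n) {0..<int n}" by auto
    have r: "int n \<in> {0..<2 ^ N}" using Suc.prems by (simp add: Suc_le_eq flip: of_nat_less_iff)
    have "f integrable_on {-pi..grid N (int n + 1)}"
      by (rule integrable_on_subinterval[OF assms]) (use grid_range[OF r] in auto)
    then have "integral {-pi..grid N (int n)} f + integral {grid N (int n)..grid N (int n + 1)} f
       = integral {-pi..grid N (int n + 1)} f"
      by (intro Henstock_Kurzweil_Integration.integral_combine) (use grid_range[OF r] in auto)
    then show ?case unfolding e using Suc by (simp add: add.commute)
  qed
  from this[of "2 ^ N"] show ?thesis by (simp add: grid_2_power)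
qed

text \<open>Cauchy-Schwarz, in the form that the square of \<open>g - m\<close> has a nonnegative
  integral, with \<open>m\<close> the mean of \<open>g\<close> on the interval.\<close>

lemma square_integral_le:
  fixes g :: "real \<Rightarrow> real"
  assumes "x < y" "g integrable_on {x..y}" "(\<lambda>s. (g s)\<^sup>2) integrable_on {x..y}"
  shows "(integral {x..y} g)\<^sup>2 \<le> (y - x) * integral {x..y} (\<lambda>s. (g s)\<^sup>2)"
proof -
  define m where "m = integral {x..y} g / (y - x)"
  have "0 \<le> integral {x..y} (\<lambda>s. (g s)\<^sup>2 - 2 * m * g s + m\<^sup>2)"
  proof (rule integral_nonneg)
    show "(\<lambda>s. (g s)\<^sup>2 - 2 * m * g s + m\<^sup>2) integrable_on {x..y}"
      using assms by (auto intro!: integrable_add integrable_diff integrable_on_mult_right)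
    show "0 \<le> (g s)\<^sup>2 - 2 * m * g s + m\<^sup>2" for s
      using zero_le_power2[of "g s - m"] by (simp add: power2_diff algebra_simps)
  qed
  also have "\<dots> = integral {x..y} (\<lambda>s. (g s)\<^sup>2) - 2 * m * integral {x..y} g + (y - x) * m\<^sup>2"
    by (rule integral_unique, intro has_integral_add has_integral_diff has_integral_mult_right
        integrable_integral assms) (use has_integral_const_real[of "m\<^sup>2" x y] assms(1) in simp)
  also have "\<dots> = integral {x..y} (\<lambda>s. (g s)\<^sup>2) - (integral {x..y} g)\<^sup>2 / (y - x)"
  proof -
    define d where "d = y - x"
    have "d > 0" using assms(1) by (simp add: d_def)
    then show ?thesis unfolding m_def d_def[symmetric] by (simp add: power2_eq_square field_simps)
  qed
  finally show ?thesis using assms(1) by (simp add: field_simps)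
qed

lemma L2_circle_square_integrable: "g \<in> L2_circle \<Longrightarrow> (\<lambda>x. (g x)\<^sup>2) absolutely_integrable_on {-pi..pi}"
  by (simp add: L2_circle_def)

text \<open>Cauchy-Schwarz on each cell. This is the half of the comparison with the Sobolev energy
  that holds for every function with a square-integrable derivative.\<close>

lemma dyadic_form_le_integral:
  assumes g: "g \<in> L2_circle"
    and V: "\<And>x y. -pi \<le> x \<Longrightarrow> x \<le> y \<Longrightarrow> y \<le> pi \<Longrightarrow> V y - V x = integral {x..y} g"
  shows "dyadic_form N V V \<le> integral {-pi..pi} (\<lambda>x. (g x)\<^sup>2)"
proof -
  let ?h = "2 * pi / 2 ^ N"
  have gi: "g integrable_on {-pi..pi}" "(\<lambda>x. (g x)\<^sup>2) integrable_on {-pi..pi}"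
    using set_lebesgue_integral_eq_integral(1) L2_circle_abs_integrable[OF g] L2_circle_square_integrable[OF g]
    by blast+
  have "dyadic_form N V V = (\<Sum>i\<in>{0..<2 ^ N}. (V (grid N (i + 1)) - V (grid N i))\<^sup>2 / ?h)"
    by (rule dyadic_form_self)
  also have "\<dots> \<le> (\<Sum>i\<in>{0..<2 ^ N}. integral {grid N i..grid N (i + 1)} (\<lambda>x. (g x)\<^sup>2))"
  proof (rule sum_mono)
    fix i :: int assume i: "i \<in> {0..<2 ^ N}"
    note r = grid_range[OF i]
    have "(V (grid N (i + 1)) - V (grid N i))\<^sup>2 \<le> ?h * integral {grid N i..grid N (i + 1)} (\<lambda>x. (g x)\<^sup>2)"
      using square_integral_le[of "grid N i" "grid N (i + 1)" g] r V[OF r]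
        integrable_on_subinterval[OF gi(1), of "grid N i" "grid N (i + 1)"]
        integrable_on_subinterval[OF gi(2), of "grid N i" "grid N (i + 1)"]
      by (simp add: grid_step)
    then show "(V (grid N (i + 1)) - V (grid N i))\<^sup>2 / ?h \<le> integral {grid N i..grid N (i + 1)} (\<lambda>x. (g x)\<^sup>2)"
      by (subst pos_divide_le_eq) (simp_all add: mult.commute)
  qed
  also have "\<dots> = integral {-pi..pi} (\<lambda>x. (g x)\<^sup>2)" by (rule sum_integral_grid[OF gi(2)])
  finally show ?thesis .
qed

text \<open>On a cell of width \<open>h\<close> the mean slope \<open>m\<close> is a value of
  \<open>u'\<close>, so \<open>u'\<close> deviates from it by at most \<open>L * h\<close>, and the
  cell integral of \<open>u'^2\<close> exceeds the difference quotient term by at most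
  \<open>h * (L * h)^2\<close>. Over the circle the error is \<open>2 * pi * (L * h)^2\<close>,
  which tends to 0.\<close>

lemma integral_le_dirichlet:
  assumes d: "\<And>x. (u has_real_derivative u' x) (at x)" and L: "L-lipschitz_on UNIV u'"
    and fin: "finite_dirichlet u"
  shows "integral {-pi..pi} (\<lambda>x. (u' x)\<^sup>2) \<le> dirichlet u"
proof -
  have cu': "continuous_on S u'" for S
    using lipschitz_on_continuous_on[OF L] continuous_on_subset by blast
  have int: "f integrable_on {a..b}" if "continuous_on UNIV f" for f :: "real \<Rightarrow> real" and a b
    using that by (auto intro: integrable_continuous_real continuous_on_subset)
  have L0: "L \<ge> 0" using L by (rule lipschitz_on_nonneg)
  have "integral {-pi..pi} (\<lambda>x. (u' x)\<^sup>2) \<le> dirichlet u + 2 * pi * (L * (2 * pi / 2 ^ N))\<^sup>2" for N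
  proof -
    define h where "h = 2 * pi / 2 ^ N"
    have h: "h > 0" by (simp add: h_def)
    have "integral {-pi..pi} (\<lambda>x. (u' x)\<^sup>2) = (\<Sum>i\<in>{0..<2 ^ N}. integral {grid N i..grid N (i + 1)} (\<lambda>x. (u' x)\<^sup>2))"
      by (rule sum_integral_grid[symmetric]) (intro int continuous_intros cu')
    also have "\<dots> \<le> (\<Sum>i\<in>{0..<2 ^ N}. (u (grid N (i + 1)) - u (grid N i))\<^sup>2 / h + h * (L * h)\<^sup>2)"
    proof (rule sum_mono)
      fix i :: int assume i: "i \<in> {0..<2 ^ N}"
      define x y where "x = grid N i" and "y = grid N (i + 1)"
      have xy: "x < y" "y - x = h" using h by (auto simp: x_def y_def grid_step h_def)
      define m where "m = (u y - u x) / h"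
      obtain \<xi> where \<xi>: "x < \<xi>" "\<xi> < y" "u y - u x = (y - x) * u' \<xi>"
        using MVT2[OF xy(1), of u u'] d by auto
      then have m: "m = u' \<xi>" using xy h by (simp add: m_def)
      have ftc: "(u' has_integral (u y - u x)) {x..y}"
        by (intro fundamental_theorem_of_calculus)
          (use xy in \<open>auto simp flip: has_real_derivative_iff_has_vector_derivative intro: has_field_derivative_at_within d\<close>)
      have "integral {x..y} (\<lambda>s. (u' s)\<^sup>2) = integral {x..y} (\<lambda>s. (u' s - m)\<^sup>2 + (2 * m * u' s - m\<^sup>2))"
        by (intro integral_cong) (simp add: power2_diff algebra_simps)
      also have "\<dots> = integral {x..y} (\<lambda>s. (u' s - m)\<^sup>2) + integral {x..y} (\<lambda>s. 2 * m * u' s - m\<^sup>2)"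
        by (intro Henstock_Kurzweil_Integration.integral_add int continuous_intros cu')
      also have "integral {x..y} (\<lambda>s. 2 * m * u' s - m\<^sup>2) = integral {x..y} (\<lambda>s. 2 * m * u' s) - integral {x..y} (\<lambda>s. m\<^sup>2)"
        by (intro Henstock_Kurzweil_Integration.integral_diff int continuous_intros cu')
      also have "\<dots> = 2 * m * (u y - u x) - (y - x) * m\<^sup>2"
        using integral_unique[OF ftc] xy by simp
      also have "\<dots> = (u y - u x)\<^sup>2 / h"
        using xy h by (simp add: m_def power2_eq_square field_simps)
      also have "integral {x..y} (\<lambda>s. (u' s - m)\<^sup>2) \<le> integral {x..y} (\<lambda>s. (L * h)\<^sup>2)"
      proof (rule integral_le)
        fix s assume s: "s \<in> {x..y}"
        have "\<bar>u' s - m\<bar> \<le> L * \<bar>s - \<xi>\<bar>"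
          using lipschitz_onD[OF L, of s \<xi>] m by (simp add: dist_real_def)
        also have "\<dots> \<le> L * h" using s \<xi> xy L0 by (intro mult_left_mono) auto
        finally show "(u' s - m)\<^sup>2 \<le> (L * h)\<^sup>2"
          by (metis abs_ge_zero power2_abs power_mono)
      qed (intro int continuous_intros cu')+
      also have "\<dots> = h * (L * h)\<^sup>2" using xy by simp
      finally show "integral {grid N i..grid N (i + 1)} (\<lambda>x. (u' x)\<^sup>2)
          \<le> (u (grid N (i + 1)) - u (grid N i))\<^sup>2 / h + h * (L * h)\<^sup>2"
        by (simp add: x_def y_def)
    qed
    also have "\<dots> = dyadic_form N u u + 2 * pi * (L * h)\<^sup>2"
      by (simp add: sum.distrib dyadic_form_self h_def)
    also have "\<dots> \<le> dirichlet u + 2 * pi * (L * h)\<^sup>2"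
      using dyadic_form_le_dirichlet[OF fin] by simp
    finally show ?thesis by (simp add: h_def)
  qed
  moreover have "(\<lambda>N. dirichlet u + 2 * pi * (L * (2 * pi / 2 ^ N))\<^sup>2) \<longlonglongrightarrow> dirichlet u + 2 * pi * (L * 0)\<^sup>2"
    by (intro tendsto_intros) (rule LIMSEQ_divide_realpow_zero, simp)
  ultimately show ?thesis
    by (intro LIMSEQ_le_const[where a="integral {-pi..pi} (\<lambda>x. (u' x)\<^sup>2)"]) auto
qed

section \<open>Existence of minimizers\<close>

lemma dyadic_approx:
  assumes x: "x \<in> {-pi..pi}"
  defines "k \<equiv> \<lambda>N. \<lfloor>(x + pi) * 2 ^ N / (2 * pi)\<rfloor>"
  shows "0 \<le> k N" "k N \<le> 2 ^ N" "grid N (k N) \<le> x" "(\<lambda>N. grid N (k N)) \<longlonglongrightarrow> x"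
proof -
  have g: "grid N (k N) \<le> x" "x - 2 * pi / 2 ^ N \<le> grid N (k N)" for N
  proof -
    have "of_int (k N) \<le> (x + pi) * 2 ^ N / (2 * pi)" "(x + pi) * 2 ^ N / (2 * pi) \<le> of_int (k N) + 1"
      unfolding k_def by linarith+
    then have "of_int (k N) * (2 * pi) \<le> (x + pi) * 2 ^ N" "(x + pi) * 2 ^ N \<le> (of_int (k N) + 1) * (2 * pi)"
      by (simp_all only: pos_le_divide_eq pos_divide_le_eq pi_gt_zero mult_pos_pos zero_less_numeral)
    then have "of_int (k N) * (2 * pi) / 2 ^ N \<le> x + pi" "x + pi \<le> (of_int (k N) + 1) * (2 * pi) / 2 ^ N"
      by (simp_all only: pos_le_divide_eq pos_divide_le_eq zero_less_power zero_less_numeral)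
    then show "grid N (k N) \<le> x" "x - 2 * pi / 2 ^ N \<le> grid N (k N)"
      by (simp_all add: grid_def add_divide_distrib distrib_right distrib_left mult_ac)
  qed
  show "0 \<le> k N" using x by (simp add: k_def)
  have "(x + pi) * 2 ^ N / (2 * pi) \<le> 2 ^ N" using x by (simp add: field_simps)
  then have "k N \<le> \<lfloor>2 ^ N :: real\<rfloor>" unfolding k_def by (rule floor_mono)
  also have "\<lfloor>2 ^ N :: real\<rfloor> = 2 ^ N" by (metis floor_of_int of_int_numeral of_int_power)
  finally show "k N \<le> 2 ^ N" .
  show "grid N (k N) \<le> x" by (rule g)
  have "(\<lambda>N. x - 2 * pi / 2 ^ N) \<longlonglongrightarrow> x - 0"
    by (intro tendsto_intros) (rule LIMSEQ_divide_realpow_zero, simp)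
  then have "(\<lambda>N. x - 2 * pi / 2 ^ N) \<longlonglongrightarrow> x" by simp
  then show "(\<lambda>N. grid N (k N)) \<longlonglongrightarrow> x"
    by (rule real_tendsto_sandwich[rotated 2]) (use g in auto)
qed

text \<open>Cauchy-Schwarz over the consecutive edges between two nodes bounds their squared
  increment by the energy times their distance; density of the nodes and continuity do the rest. It
  provides the equicontinuity for Arzela-Ascoli and the upper bound for competitors.\<close>

lemma holder_if_dyadic_form_bounded:
  assumes C: "\<And>N. dyadic_form N u u \<le> C" and cu: "continuous_on UNIV u"
    and x: "x \<in> {-pi..pi}" and y: "y \<in> {-pi..pi}"
  shows "(u y - u x)\<^sup>2 \<le> C * \<bar>y - x\<bar>"
proof -
  have grid: "(u (grid N j) - u (grid N i))\<^sup>2 \<le> C * (grid N j - grid N i)"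
    if ij: "0 \<le> i" "i \<le> j" "j \<le> 2 ^ N" for N i j
  proof -
    define \<Delta> where "\<Delta> k = u (grid N (k + 1)) - u (grid N k)" for k
    have tel: "(\<Sum>k\<in>{i..<i + int n}. \<Delta> k) = u (grid N (i + int n)) - u (grid N i)" for n
    proof (induction n)
      case (Suc n)
      have "{i..<i + int (Suc n)} = insert (i + int n) {i..<i + int n}" by auto
      then show ?case using Suc by (simp add: \<Delta>_def algebra_simps)
    qed simp
    have "(u (grid N j) - u (grid N i))\<^sup>2 = (\<Sum>k\<in>{i..<j}. 1 * \<Delta> k)\<^sup>2"
      using tel[of "nat (j - i)"] ij by simp
    also have "\<dots> \<le> (\<Sum>k\<in>{i..<j}. 1\<^sup>2) * (\<Sum>k\<in>{i..<j}. (\<Delta> k)\<^sup>2)"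
      by (rule Cauchy_Schwarz_ineq_sum)
    also have "(\<Sum>k\<in>{i..<j}. 1\<^sup>2) = real_of_int (j - i)" using ij by simp
    also have "(\<Sum>k\<in>{i..<j}. (\<Delta> k)\<^sup>2) \<le> (\<Sum>k\<in>{0..<2 ^ N}. (\<Delta> k)\<^sup>2)"
      by (rule sum_mono2) (use ij in auto)
    also have "(\<Sum>k\<in>{0..<2 ^ N}. (\<Delta> k)\<^sup>2) = dyadic_form N u u * (2 * pi / 2 ^ N)"
      by (simp add: dyadic_form_def \<Delta>_def power2_eq_square)
    also have "dyadic_form N u u * (2 * pi / 2 ^ N) \<le> C * (2 * pi / 2 ^ N)"
      by (intro mult_right_mono C) auto
    also have "real_of_int (j - i) * (C * (2 * pi / 2 ^ N)) = C * (grid N j - grid N i)"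
      by (simp add: grid_def field_simps)
    finally show ?thesis using ij by (simp add: mult_left_mono)
  qed
  have le: "(u y - u x)\<^sup>2 \<le> C * \<bar>y - x\<bar>" if xy: "x \<le> y" "x \<in> {-pi..pi}" "y \<in> {-pi..pi}" for x y
  proof -
    define k where "k x N = \<lfloor>(x + pi) * 2 ^ N / (2 * pi)\<rfloor>" for x :: real and N :: nat
    note ax = dyadic_approx[OF xy(2), folded k_def] and ay = dyadic_approx[OF xy(3), folded k_def]
    have "k x N \<le> k y N" for N
      unfolding k_def by (intro floor_mono divide_right_mono mult_right_mono) (use xy in auto)
    then have *: "(u (grid N (k y N)) - u (grid N (k x N)))\<^sup>2 \<le> C * (grid N (k y N) - grid N (k x N))" for N
      by (intro grid ax ay)
    have "(\<lambda>N. (u (grid N (k y N)) - u (grid N (k x N)))\<^sup>2) \<longlonglongrightarrow> (u y - u x)\<^sup>2"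
      using cu by (intro tendsto_intros isCont_tendsto_compose[of _ u] ax ay) (auto simp: continuous_on_eq_continuous_at)
    moreover have "(\<lambda>N. C * (grid N (k y N) - grid N (k x N))) \<longlonglongrightarrow> C * (y - x)"
      by (intro tendsto_intros ax ay)
    ultimately show ?thesis using LIMSEQ_le * xy by fastforce
  qed
  show ?thesis
    using le[of x y] le[of y x] x y by (cases "x \<le> y") (auto simp: abs_minus_commute power2_commute)
qed

lemma integrable_continuous_UNIV:
  fixes f :: "real \<Rightarrow> real"
  shows "continuous_on UNIV f \<Longrightarrow> f integrable_on {a..b}"
  by (auto intro: integrable_continuous_real continuous_on_subset)

text \<open>By the Hoelder bound \<open>u\<close> varies by at most
  \<open>sqrt (2 * pi * C)\<close>, and its mean is \<open>M / (2 * pi)\<close>.\<close>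

lemma competitor_upper_bound:
  assumes u: "u \<in> competitors M" and C: "dirichlet u \<le> C" and x: "x \<in> {-pi..pi}"
  shows "u x \<le> M / (2 * pi) + sqrt (2 * pi * C)"
proof -
  have fin: "finite_dirichlet u" and cu: "continuous_on UNIV u" and M: "integral {-pi..pi} u = M"
    using u by (auto simp: competitors_def)
  have C0: "C \<ge> 0" using dirichlet_nonneg[OF fin] C by simp
  have N: "dyadic_form N u u \<le> C" for N
    using dyadic_form_le_dirichlet[OF fin, of N] C by simp
  have "integral {-pi..pi} (\<lambda>y. u x - sqrt (2 * pi * C)) \<le> integral {-pi..pi} u"
  proof (rule integral_le)
    fix y assume y: "y \<in> {-pi..pi}"
    have "(u x - u y)\<^sup>2 \<le> C * \<bar>x - y\<bar>" by (rule holder_if_dyadic_form_bounded[OF N cu y x])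
    also have "\<dots> \<le> C * (2 * pi)" using x y C0 by (intro mult_left_mono) auto
    finally have "u x - u y \<le> sqrt (2 * pi * C)" by (intro real_le_rsqrt) (simp add: mult.commute)
    then show "u x - sqrt (2 * pi * C) \<le> u y" by simp
  qed (auto intro: integrable_continuous_UNIV cu)
  then show ?thesis using M by (simp add: field_simps)
qed

text \<open>For nonnegative \<open>u\<close> of mass \<open>M\<close> the integral of
  \<open>u^2\<close> is at most \<open>M\<close> times the maximum, and the maximum grows only like
  the square root of the Dirichlet energy. So the negative quadratic term is absorbed for every size
  of \<open>\<alpha>\<close>, where a Poincare inequality would restrict
  \<open>\<alpha>\<close>.\<close>

lemma reduced_energy_coercive:
  obtains B where "\<And>u. u \<in> competitors M \<Longrightarrow> dirichlet u / 4 - B \<le> reduced_energy \<alpha> u"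
proof
  fix u assume u: "u \<in> competitors M"
  then have fin: "finite_dirichlet u" and cu: "continuous_on UNIV u" and M: "integral {-pi..pi} u = M"
    and pos: "\<And>x. 0 \<le> u x" by (auto simp: competitors_def)
  define s where "s = sqrt (2 * pi * dirichlet u)"
  have s: "s \<ge> 0" "s\<^sup>2 = 2 * pi * dirichlet u" using dirichlet_nonneg[OF fin] by (auto simp: s_def)
  have ui: "u integrable_on {-pi..pi}" by (rule integrable_continuous_UNIV[OF cu])
  have M0: "M \<ge> 0" using integral_nonneg[OF ui] pos M by auto
  have "integral {-pi..pi} (\<lambda>x. (u x)\<^sup>2) \<le> integral {-pi..pi} (\<lambda>x. (M / (2 * pi) + s) * u x)"
  proof (rule integral_le)
    show "(u x)\<^sup>2 \<le> (M / (2 * pi) + s) * u x" if "x \<in> {-pi..pi}" for x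
      using competitor_upper_bound[OF u order_refl that] pos[of x]
      by (simp add: power2_eq_square s_def mult_right_mono)
  qed (auto intro!: integrable_continuous_UNIV continuous_intros cu)
  also have "\<dots> = (M / (2 * pi) + s) * M" using M by simp
  finally have 1: "integral {-pi..pi} (\<lambda>x. (u x)\<^sup>2) \<le> (M / (2 * pi) + s) * M" .
  have "integral {-pi..pi} (\<lambda>x. u x * cos x) \<le> integral {-pi..pi} u"
    by (rule integral_le) (auto intro!: integrable_continuous_UNIV continuous_intros cu simp: pos mult_left_le)
  then have 2: "integral {-pi..pi} (\<lambda>x. u x * cos x) \<le> M" using M by simp
  define p where "p = \<alpha>\<^sup>2 / 2 * M"
  have "\<alpha>\<^sup>2 / 2 * integral {-pi..pi} (\<lambda>x. (u x)\<^sup>2) \<le> \<alpha>\<^sup>2 / 2 * ((M / (2 * pi) + s) * M)"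
    by (rule mult_left_mono[OF 1]) simp
  also have "\<dots> = p * (M / (2 * pi)) + p * s" by (simp add: p_def algebra_simps)
  also have "p * s \<le> dirichlet u / 4 + 2 * pi * p\<^sup>2"
  proof -
    \<comment> \<open>Young's inequality; the coefficient \<open>4 * pi\<close> is the one for which
      \<open>s^2 = 2 * pi * dirichlet u\<close> leaves exactly a quarter of the Dirichlet
      energy.\<close>
    have "0 \<le> (s - 4 * pi * p)\<^sup>2" by simp
    also have "\<dots> = 2 * pi * dirichlet u - 8 * pi * (p * s) + 16 * pi * (pi * p\<^sup>2)"
      by (simp add: power2_diff s power_mult_distrib) (simp add: power2_eq_square)
    also have "\<dots> = (8 * pi) * (dirichlet u / 4 - p * s + 2 * pi * p\<^sup>2)" by (simp add: algebra_simps)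
    finally have "0 \<le> dirichlet u / 4 - p * s + 2 * pi * p\<^sup>2"
      using pi_gt_zero by (auto simp: zero_le_mult_iff)
    then show ?thesis by simp
  qed
  finally show "dirichlet u / 4 - (\<alpha>\<^sup>2 / 2 * M * (M / (2 * pi)) + 2 * pi * (\<alpha>\<^sup>2 / 2 * M)\<^sup>2 + M) \<le> reduced_energy \<alpha> u"
    using 2 unfolding reduced_energy_def p_def[symmetric] by linarith
qed

lemma const_competitor: "0 \<le> M \<Longrightarrow> (\<lambda>x. M / (2 * pi)) \<in> competitors M"
  by (auto simp: competitors_def periodic_2pi_def finite_dirichlet_def dyadic_form_def intro!: integral_unique)

lemma reduced_minimizer_exists:
  assumes M: "0 \<le> M"
  obtains u where "u \<in> competitors M" "\<And>v. v \<in> competitors M \<Longrightarrow> reduced_energy \<alpha> u \<le> reduced_energy \<alpha> v"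
proof -
  define J where "J = reduced_energy \<alpha>"
  obtain B where B: "\<And>u. u \<in> competitors M \<Longrightarrow> dirichlet u / 4 - B \<le> J u"
    using reduced_energy_coercive unfolding J_def by blast
  define m where "m = (INF u\<in>competitors M. J u)"
  have ne: "competitors M \<noteq> {}" using const_competitor[OF M] by blast
  have bdd: "bdd_below (J ` competitors M)"
  proof (rule bdd_belowI2)
    fix u assume "u \<in> competitors M"
    then show "- B \<le> J u" using B[of u] dirichlet_nonneg[of u] by (auto simp: competitors_def)
  qed
  have m_le: "m \<le> J u" if "u \<in> competitors M" for u
    unfolding m_def by (rule cINF_lower[OF bdd that])
  have "\<exists>u\<in>competitors M. J u < m + 1 / real (Suc n)" for n
    using cINF_less_iff[OF ne bdd, of "m + 1 / real (Suc n)"] by (simp add: m_def)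
  then obtain U where U: "\<And>n. U n \<in> competitors M" "\<And>n. J (U n) < m + 1 / real (Suc n)" by metis
  \<comment> \<open>The bound on the Dirichlet energy that coercivity yields for energies up to
    \<open>m + 1\<close>.\<close>
  define C where "C = 4 * (m + 1 + B)"
  have D: "dirichlet (U n) \<le> C" for n
  proof -
    define r where "r = 1 / real (Suc n)"
    have "r \<le> 1" by (simp add: r_def)
    then show ?thesis using B[OF U(1)[of n]] U(2)[of n] unfolding C_def r_def[symmetric] by argo
  qed
  have Uc: "continuous_on UNIV (U n)" and Ufin: "finite_dirichlet (U n)" and Upos: "0 \<le> U n x"
    and Uper: "periodic_2pi (U n)" and UM: "integral {-pi..pi} (U n) = M" for n x
    using U(1)[of n] by (auto simp: competitors_def)
  have C0: "C \<ge> 0" using D[of 0] dirichlet_nonneg[OF Ufin[of 0]] by simp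
  have UN: "dyadic_form N (U n) (U n) \<le> C" for N n
    using dyadic_form_le_dirichlet[OF Ufin, of N n] D[of n] by simp
  define K where "K = M / (2 * pi) + sqrt (2 * pi * C)"
  have UK: "norm (U n x) \<le> K" if "x \<in> {-pi..pi}" for n x
    using competitor_upper_bound[OF U(1) D that, of n] Upos[of n x] by (simp add: K_def)
  have "\<exists>d>0. \<forall>n y. y \<in> {-pi..pi} \<and> norm (x - y) < d \<longrightarrow> norm (U n x - U n y) < e"
    if x: "x \<in> {-pi..pi}" and e: "e > 0" for x e
  proof (intro exI[of _ "e\<^sup>2 / (C + 1)"] conjI allI impI)
    show "0 < e\<^sup>2 / (C + 1)" using e C0 by simp
    fix n y assume y: "y \<in> {-pi..pi} \<and> norm (x - y) < e\<^sup>2 / (C + 1)"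
    have "(U n x - U n y)\<^sup>2 \<le> C * \<bar>x - y\<bar>"
      by (rule holder_if_dyadic_form_bounded[OF UN Uc]) (use x y in auto)
    also have "\<dots> \<le> (C + 1) * \<bar>x - y\<bar>" by (intro mult_right_mono) auto
    also have "\<dots> < e\<^sup>2" using y C0 by (simp add: field_simps)
    finally show "norm (U n x - U n y) < e"
      using e by (metis abs_le_square_iff abs_of_pos linorder_not_less real_norm_def)
  qed
  then obtain g k where g: "continuous_on {-pi..pi} g" "strict_mono (k :: nat \<Rightarrow> nat)"
    and unif: "\<And>e. 0 < e \<Longrightarrow> \<exists>N. \<forall>n x. n \<ge> N \<and> x \<in> {-pi..pi} \<longrightarrow> norm (U (k n) x - g x) < e"
    using Arzela_Ascoli[of "{-pi..pi}" U K] UK by (metis compact_Icc)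
  have lim: "(\<lambda>n. U (k n) x) \<longlonglongrightarrow> g x" if "x \<in> {-pi..pi}" for x
    using unif that by (force simp: LIMSEQ_iff)
  have "U n (-pi) = U n pi" for n
    using Uper[of n] by (simp add: periodic_2pi_def) (metis add.commute add_diff_cancel_left' diff_minus_eq_add minus_diff_eq mult_2)
  then have "g (-pi) = g pi" using lim[of "-pi"] lim[of pi] LIMSEQ_unique by simp
  then obtain u where u: "periodic_2pi u" "continuous_on UNIV u" "\<And>x. x \<in> {-pi..pi} \<Longrightarrow> u x = g x"
    using periodic_extension[OF g(1)] by blast
  have limu: "(\<lambda>n. U (k n) x) \<longlonglongrightarrow> u x" if "x \<in> {-pi..pi}" for x
    using lim[OF that] u(3)[OF that] by simp
  have upos: "0 \<le> u x" for x
  proof -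
    have "wrap x \<in> {-pi..pi}" using wrap_range[of x] by simp
    then have "0 \<le> u (wrap x)" using limu LIMSEQ_le_const Upos by (metis (mono_tags))
    then show ?thesis using periodic_2pi_wrap[OF u(1)] by simp
  qed
  \<comment> \<open>At a fixed level the form is a finite sum of point values, so pointwise
    convergence suffices.\<close>
  have limf: "(\<lambda>n. dyadic_form N (U (k n)) (U (k n))) \<longlonglongrightarrow> dyadic_form N u u" for N
    unfolding dyadic_form_def using grid_range[of _ N]
    by (intro tendsto_intros limu) fastforce+
  have limi: "(\<lambda>n. integral {-pi..pi} (\<lambda>x. f x * (U (k n) x) ^ j)) \<longlonglongrightarrow> integral {-pi..pi} (\<lambda>x. f x * (u x) ^ j)"
    if f: "continuous_on UNIV f" "\<And>x. \<bar>f x\<bar> \<le> 1" for f j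
  proof (rule dominated_convergence(2)[where h="\<lambda>x. K ^ j"])
    show "(\<lambda>x. f x * U (k n) x ^ j) integrable_on {-pi..pi}" for n
      by (intro integrable_continuous_UNIV continuous_intros f Uc)
    show "norm (f x * U (k n) x ^ j) \<le> K ^ j" if "x \<in> {-pi..pi}" for n x
    proof -
      have "\<bar>f x\<bar> * \<bar>U (k n) x\<bar> ^ j \<le> 1 * K ^ j"
        using UK[OF that] f by (intro mult_mono power_mono) auto
      then show ?thesis by (simp add: abs_mult power_abs)
    qed
    show "\<And>x. x \<in> {-pi..pi} \<Longrightarrow> (\<lambda>n. f x * U (k n) x ^ j) \<longlonglongrightarrow> f x * u x ^ j"
      by (intro tendsto_intros limu)
  qed auto
  have l1: "(\<lambda>n. integral {-pi..pi} (U (k n))) \<longlonglongrightarrow> integral {-pi..pi} u"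
    using limi[of "\<lambda>_. 1" 1] by simp
  have l2: "(\<lambda>n. integral {-pi..pi} (\<lambda>x. (U (k n) x)\<^sup>2)) \<longlonglongrightarrow> integral {-pi..pi} (\<lambda>x. (u x)\<^sup>2)"
    using limi[of "\<lambda>_. 1" 2] by simp
  have l3: "(\<lambda>n. integral {-pi..pi} (\<lambda>x. U (k n) x * cos x)) \<longlonglongrightarrow> integral {-pi..pi} (\<lambda>x. u x * cos x)"
    using limi[of cos 1] by (simp add: mult.commute continuous_on_cos)
  have iM: "integral {-pi..pi} u = M" using l1 UM by (simp add: LIMSEQ_const_iff)
  define R where "R = \<alpha>\<^sup>2 / 2 * integral {-pi..pi} (\<lambda>x. (u x)\<^sup>2) + integral {-pi..pi} (\<lambda>x. u x * cos x)"
  \<comment> \<open>Lower semicontinuity: the estimate is proved level by level with a bound free of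
    \<open>N\<close>, and only then is the supremum over \<open>N\<close> taken.\<close>
  have uN: "dyadic_form N u u \<le> 2 * (m + R)" for N
  proof -
    have "(\<lambda>n. dyadic_form N (U (k n)) (U (k n)) / 2 - \<alpha>\<^sup>2 / 2 * integral {-pi..pi} (\<lambda>x. (U (k n) x)\<^sup>2)
       - integral {-pi..pi} (\<lambda>x. U (k n) x * cos x)) \<longlonglongrightarrow> dyadic_form N u u / 2
       - \<alpha>\<^sup>2 / 2 * integral {-pi..pi} (\<lambda>x. (u x)\<^sup>2) - integral {-pi..pi} (\<lambda>x. u x * cos x)"
      by (intro tendsto_intros limf l2 l3) auto
    moreover have "(\<lambda>n. m + 1 / real (Suc (k n))) \<longlonglongrightarrow> m + 0"
      using LIMSEQ_subseq_LIMSEQ[OF LIMSEQ_inverse_real_of_nat g(2)]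
      by (intro tendsto_intros) (simp add: o_def inverse_eq_divide)
    moreover have "dyadic_form N (U (k n)) (U (k n)) / 2 - \<alpha>\<^sup>2 / 2 * integral {-pi..pi} (\<lambda>x. (U (k n) x)\<^sup>2)
       - integral {-pi..pi} (\<lambda>x. U (k n) x * cos x) \<le> m + 1 / real (Suc (k n))" for n
      using U(2)[of "k n"] dyadic_form_le_dirichlet[OF Ufin, of N "k n"]
      unfolding J_def reduced_energy_def by linarith
    ultimately have "dyadic_form N u u / 2
       - \<alpha>\<^sup>2 / 2 * integral {-pi..pi} (\<lambda>x. (u x)\<^sup>2) - integral {-pi..pi} (\<lambda>x. u x * cos x) \<le> m + 0"
      by (intro LIMSEQ_le) auto
    then show ?thesis by (simp add: R_def)
  qed
  note d = dirichlet_leI[of 0, OF uN]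
  have "u \<in> competitors M" using u upos iM d(1) by (simp add: competitors_def)
  moreover have "J u \<le> m" using d(2) by (simp add: J_def reduced_energy_def R_def)
  ultimately show ?thesis using that m_le unfolding J_def by (meson order_trans)
qed

section \<open>Polarization\<close>

lemma integral_periodic_shift:
  assumes f: "periodic_2pi f" "continuous_on UNIV f"
  shows "integral {a..a + 2 * pi} f = integral {-pi..pi} f"
proof -
  have cf: "continuous_on S f" for S using f(2) continuous_on_subset by blast
  obtain F where F: "\<And>x. (F has_real_derivative f x) (at x)"
    using continuous_primitive[OF f(2)] by blast
  have I: "integral {x..x + 2 * pi} f = F (x + 2 * pi) - F x" for x
    by (intro integral_unique fundamental_theorem_of_calculus)
      (auto simp flip: has_real_derivative_iff_has_vector_derivative intro: has_field_derivative_at_within F)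
  have "((\<lambda>x. F (x + 2 * pi) - F x) has_real_derivative f (x + 2 * pi) - f x) (at x)" for x
    using F by (auto intro!: derivative_eq_intros DERIV_shift[THEN iffD1])
  then have "((\<lambda>x. F (x + 2 * pi) - F x) has_real_derivative 0) (at x)" for x
    using f(1) by (simp add: periodic_2pi_def)
  then have "F (a + 2 * pi) - F a = F (-pi + 2 * pi) - F (-pi)"
    using DERIV_isconst_all[of "\<lambda>x. F (x + 2 * pi) - F x"] by blast
  then have "integral {a..a + 2 * pi} f = integral {-pi..-pi + 2 * pi} f" by (simp only: I)
  then show ?thesis by simp
qed

lemma integral_periodic_reflect:
  assumes f: "periodic_2pi f" "continuous_on UNIV f"
  shows "integral {-pi..pi} (\<lambda>x. f (c - x)) = integral {-pi..pi} f"
proof -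
  have cf: "continuous_on S f" for S using f(2) continuous_on_subset by blast
  have "(f has_integral integral {c - pi..c - pi + 2 * pi} f) (cbox (c - pi) (c - pi + 2 * pi))"
    using cf by (auto intro!: integrable_integral integrable_continuous_real)
  then have "((\<lambda>x. f ((-1) *\<^sub>R x + c)) has_integral (1 / \<bar>-1\<bar> ^ DIM(real)) *\<^sub>R integral {c - pi..c - pi + 2 * pi} f)
      ((\<lambda>x. (1 / (-1)) *\<^sub>R x + -((1 / (-1)) *\<^sub>R c)) ` cbox (c - pi) (c - pi + 2 * pi))"
    by (rule has_integral_affinity) simp
  moreover have "(\<lambda>x. (1 / (-1)) *\<^sub>R x + -((1 / (-1)) *\<^sub>R c)) ` cbox (c - pi) (c - pi + 2 * pi) = {-pi..pi}"
    by (auto simp: image_iff intro!: bexI[of _ "c - _"])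
  ultimately have "((\<lambda>x. f (c - x)) has_integral integral {c - pi..c - pi + 2 * pi} f) {-pi..pi}"
    by (simp add: add.commute)
  then show ?thesis using integral_periodic_shift[OF f, of "c - pi"] by (simp add: integral_unique)
qed

text \<open>Two-point rearrangement for the reflection \<open>x \<mapsto> c - x\<close>: of each
  mirror pair, the point with the larger cosine, that is, the one nearer to 0 on the circle,
  receives the larger value.\<close>

definition polarize :: "real \<Rightarrow> (real \<Rightarrow> real) \<Rightarrow> real \<Rightarrow> real" where
  "polarize c u x = (if cos x \<ge> cos (c - x) then max (u x) (u (c - x)) else min (u x) (u (c - x)))"

lemma polarize_cases:
  assumes eq: "cos x = cos (c - x) \<Longrightarrow> u (c - x) = u x"
  shows "polarize c u x = u x \<and> polarize c u (c - x) = u (c - x)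
    \<or> polarize c u x = u (c - x) \<and> polarize c u (c - x) = u x"
  using eq by (cases "cos x" "cos (c - x)" rule: linorder_cases) (auto simp: polarize_def max_def min_def)

text \<open>\<open>sin (c / 2) \<noteq> 0\<close> says that the reflection moves the point 0. Equal
  cosines then occur only at its fixed points on the circle, where both branches of
  \<open>polarize\<close> agree by periodicity.\<close>

lemma cos_eq_reflect:
  assumes u: "periodic_2pi u" and c: "sin (c / 2) \<noteq> 0" and eq: "cos x = cos (c - x)"
  shows "u (c - x) = u x"
proof -
  have "cos x - cos (c - x) = 2 * sin (c / 2) * sin ((c - x - x) / 2)"
    by (simp add: cos_diff_cos)
  then have "sin (c / 2 - x) = 0" using eq c by (simp add: diff_divide_distrib)
  then obtain k :: int where "c / 2 - x = of_int k * pi" by (auto simp: sin_zero_iff_int2)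
  then have "c - x = x + 2 * pi * of_int k" by (simp add: field_simps)
  then show ?thesis using periodic_2pi_int[OF u] by simp
qed

lemma continuous_polarize:
  assumes u: "periodic_2pi u" "continuous_on UNIV u" and c: "sin (c / 2) \<noteq> 0"
  shows "continuous_on UNIV (polarize c u)"
proof -
  have cr: "continuous_on S (\<lambda>x. u (c - x))" "continuous_on S u" for S
    using u(2) by (auto intro!: continuous_on_compose2[OF u(2)] continuous_intros intro: continuous_on_subset)
  have "continuous_on ({x. cos (c - x) \<le> cos x} \<union> {x. cos x \<le> cos (c - x)}) (polarize c u)"
  proof (rule continuous_on_closed_Un)
    show "closed {x. cos (c - x) \<le> cos x}" "closed {x. cos x \<le> cos (c - x)}"
      by (intro closed_Collect_le continuous_intros)+
    show "continuous_on {x. cos (c - x) \<le> cos x} (polarize c u)"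
      by (subst continuous_on_cong[OF refl, where g="\<lambda>x. max (u x) (u (c - x))"])
        (auto simp: polarize_def intro!: continuous_intros cr)
    have "polarize c u x = min (u x) (u (c - x))" if "cos x \<le> cos (c - x)" for x
      using that cos_eq_reflect[OF u(1) c, of x] by (cases "cos x = cos (c - x)") (auto simp: polarize_def)
    then show "continuous_on {x. cos x \<le> cos (c - x)} (polarize c u)"
      by (subst continuous_on_cong[OF refl, where g="\<lambda>x. min (u x) (u (c - x))"])
        (auto intro!: continuous_intros cr)
  qed
  moreover have "{x. cos (c - x) \<le> cos x} \<union> {x. cos x \<le> cos (c - x)} = UNIV" by auto
  ultimately show ?thesis by simp
qed

lemma periodic_polarize: "periodic_2pi u \<Longrightarrow> periodic_2pi (polarize c u)"
proof -
  assume u: "periodic_2pi u"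
  have "u (c - (x + 2 * pi)) = u (c - x)" "cos (c - (x + 2 * pi)) = cos (c - x)" for x
    using u[unfolded periodic_2pi_def, rule_format, of "c - (x + 2 * pi)"]
      cos_periodic[of "c - (x + 2 * pi)"] by (simp_all add: algebra_simps)
  then show ?thesis using u by (simp add: periodic_2pi_def polarize_def)
qed

text \<open>On each mirror pair the two values are kept or exchanged, so
  \<open>f (u x) + f (u (c - x))\<close> is unchanged; integrals are therefore added to their
  reflections.\<close>

lemma integral_polarize:
  assumes u: "periodic_2pi u" "continuous_on UNIV u" and c: "sin (c / 2) \<noteq> 0"
    and f: "continuous_on UNIV (f :: real \<Rightarrow> real)"
  shows "integral {-pi..pi} (\<lambda>x. f (polarize c u x)) = integral {-pi..pi} (\<lambda>x. f (u x))"
proof -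
  let ?v = "polarize c u"
  have cv: "continuous_on UNIV ?v" and pv: "periodic_2pi ?v"
    using continuous_polarize[OF u c] periodic_polarize[OF u(1)] by auto
  have cf: "continuous_on UNIV (\<lambda>x. f (w x))" if "continuous_on UNIV w" for w :: "real \<Rightarrow> real"
    by (rule continuous_on_compose2[OF f that]) auto
  have cr: "continuous_on UNIV (\<lambda>x. w (c - x))" if "continuous_on UNIV w" for w :: "real \<Rightarrow> real"
    by (rule continuous_on_compose2[OF that]) (auto intro!: continuous_intros)
  have i2: "2 * integral {-pi..pi} (\<lambda>x. f (w x)) = integral {-pi..pi} (\<lambda>x. f (w x) + f (w (c - x)))"
    if w: "continuous_on UNIV w" "periodic_2pi w" for w
    using integral_periodic_reflect[of "\<lambda>x. f (w x)" c] cf[OF w(1)] w(2) cr[OF cf[OF w(1)]]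
    by (subst Henstock_Kurzweil_Integration.integral_add)
      (auto intro: integrable_continuous_UNIV simp: periodic_2pi_def)
  have "f (?v x) + f (?v (c - x)) = f (u x) + f (u (c - x))" for x
    using polarize_cases[of x c u] cos_eq_reflect[OF u(1) c, of x] by (auto simp: add.commute)
  then have "2 * integral {-pi..pi} (\<lambda>x. f (?v x)) = 2 * integral {-pi..pi} (\<lambda>x. f (u x))"
    unfolding i2[OF cv pv] i2[OF u(2,1)] by simp
  then show ?thesis by simp
qed

text \<open>Sorting two pairs in the same order cannot increase the sum of squared differences. The
  hypothesis \<open>side\<close> puts \<open>x\<close> and \<open>y\<close> in the same half circle,
  which makes the orders the same.\<close>

lemma polarize_increments:
  assumes u: "periodic_2pi u" and c: "sin (c / 2) \<noteq> 0"
    and side: "cos x \<ge> cos (c - x) \<and> cos y \<ge> cos (c - y) \<or> cos x \<le> cos (c - x) \<and> cos y \<le> cos (c - y)"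
  shows "(polarize c u x - polarize c u y)\<^sup>2 + (polarize c u (c - x) - polarize c u (c - y))\<^sup>2
    \<le> (u x - u y)\<^sup>2 + (u (c - x) - u (c - y))\<^sup>2"
proof -
  have key: "(max a b - max a' b')\<^sup>2 + (min a b - min a' b')\<^sup>2 \<le> (a - a')\<^sup>2 + (b - b')\<^sup>2" for a b a' b' :: real
  proof -
    have 1: "0 \<le> (a - b) * (b' - a')" if "b \<le> a" "a' \<le> b'" using that by simp
    have 2: "0 \<le> (b - a) * (a' - b')" if "a \<le> b" "b' \<le> a'" using that by simp
    show ?thesis
      using 1 2 by (auto simp: max_def min_def power2_eq_square algebra_simps)
  qed
  have pm: "polarize c u z = max (u z) (u (c - z)) \<and> polarize c u (c - z) = min (u z) (u (c - z))"
    if "cos z \<ge> cos (c - z)" for z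
    using that cos_eq_reflect[OF u c, of z] by (cases "cos z = cos (c - z)") (auto simp: polarize_def max_def min_def)
  have pn: "polarize c u z = min (u z) (u (c - z)) \<and> polarize c u (c - z) = max (u z) (u (c - z))"
    if "cos z \<le> cos (c - z)" for z
    using that cos_eq_reflect[OF u c, of z] by (cases "cos z = cos (c - z)") (auto simp: polarize_def max_def min_def)
  show ?thesis
    using side pm[of x] pm[of y] pn[of x] pn[of y] key[of "u x" "u (c - x)" "u y" "u (c - y)"]
    by (elim disjE) (auto simp: add.commute)
qed

text \<open>The fixed points of the reflection are themselves grid points, so no grid edge crosses them.\<close>

lemma grid_edge_side:
  fixes i j :: int and N :: nat
  defines "c \<equiv> 2 * grid N j" and "x \<equiv> grid N i" and "y \<equiv> grid N (i + 1)"
  assumes "N \<ge> 1"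
  shows "cos x \<ge> cos (c - x) \<and> cos y \<ge> cos (c - y) \<or> cos x \<le> cos (c - x) \<and> cos y \<le> cos (c - y)"
proof -
  have diff: "cos z - cos (c - z) = 2 * sin (grid N j) * sin (grid N j - z)" for z
    using cos_diff_cos[of z "c - z"] by (simp add: c_def diff_divide_distrib)
  obtain n where n: "N = Suc n" using assms(4) by (cases N) auto
  \<comment> \<open>The spacing is \<open>pi / 2 ^ n\<close>, so \<open>grid N j - x\<close> and
    \<open>grid N j - y\<close> lie in one interval from \<open>q * pi\<close> to
    \<open>(q + 1) * pi\<close>, where the sine has constant sign. Dividing \<open>j - i - 1\<close>
    rather than \<open>j - i\<close> keeps \<open>x\<close> in the same interval even if its
    distance is a multiple of pi.\<close>
  define q where "q = (j - i - 1) div 2 ^ n"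
  define r where "r = (j - i - 1) mod 2 ^ n"
  have qr: "j - i = 2 ^ n * q + r + 1" "0 \<le> r" "r + 1 \<le> 2 ^ n"
    using mult_div_mod_eq[of "2 ^ n" "j - i - 1"] pos_mod_bound[of "2 ^ n" "j - i - 1"]
      pos_mod_sign[of "2 ^ n" "j - i - 1"] unfolding q_def[symmetric] r_def[symmetric] by simp_all
  have g: "grid N j - grid N k = pi * of_int (j - k) / 2 ^ n" for k
    by (simp add: grid_def n field_simps)
  have ji: "real_of_int (j - i) = 2 ^ n * of_int q + of_int r + 1"
    using arg_cong[OF qr(1), of real_of_int] by simp
  have ex: "grid N j - x = of_int q * pi + pi * (of_int r + 1) / 2 ^ n"
    unfolding x_def g ji by (simp add: field_simps)
  have ey: "grid N j - y = of_int q * pi + pi * of_int r / 2 ^ n"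
    unfolding y_def g using ji by (simp add: field_simps)
  have r: "real_of_int r + 1 \<le> 2 ^ n"
  proof -
    have "real_of_int (r + 1) \<le> real_of_int (2 ^ n)" using qr(3) by (simp only: of_int_le_iff)
    then show ?thesis by simp
  qed
  have s: "0 \<le> sin (pi * (of_int r + 1) / 2 ^ n)" "0 \<le> sin (pi * of_int r / 2 ^ n)"
  proof -
    have "pi * (of_int r + 1) \<le> pi * 2 ^ n" using r by (rule mult_left_mono) simp
    moreover have "pi * of_int r \<le> pi * 2 ^ n"
      by (rule mult_left_mono) (use r in \<open>linarith, simp\<close>)
    ultimately show "0 \<le> sin (pi * (of_int r + 1) / 2 ^ n)" "0 \<le> sin (pi * of_int r / 2 ^ n)"
      using qr(2) by (auto intro!: sin_ge_zero simp: pos_divide_le_eq)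
  qed
  have sh: "sin (of_int q * pi + z) = cos (of_int q * pi) * sin z" for z
    by (simp add: sin_add sin_zero_iff_int2)
  have "0 \<le> sin (grid N j) * cos (of_int q * pi) \<or> sin (grid N j) * cos (of_int q * pi) \<le> 0" by linarith
  then show ?thesis
  proof
    assume "0 \<le> sin (grid N j) * cos (of_int q * pi)"
    then have "0 \<le> cos x - cos (c - x)" "0 \<le> cos y - cos (c - y)"
      unfolding diff ex ey sh using s by (simp_all add: mult.assoc[symmetric])
    then show ?thesis by simp
  next
    assume "sin (grid N j) * cos (of_int q * pi) \<le> 0"
    then have "cos x - cos (c - x) \<le> 0" "cos y - cos (c - y) \<le> 0"
      unfolding diff ex ey sh using s by (simp_all add: mult.assoc[symmetric] mult_nonpos_nonneg)
    then show ?thesis by simp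
  qed
qed

text \<open>The grid is invariant under reflection about one of its nodes, so each edge can be
  summed together with its mirror edge and the inequality for pairs of increments applies.\<close>

lemma dyadic_form_polarize:
  assumes u: "periodic_2pi u" and N: "N \<ge> 1" and c: "c = 2 * grid N j" and s: "sin (c / 2) \<noteq> 0"
  shows "dyadic_form N (polarize c u) (polarize c u) \<le> dyadic_form N u u"
proof -
  define E where "E w i = (w (grid N (i + 1)) - w (grid N i))\<^sup>2" for w :: "real \<Rightarrow> real" and i
  \<comment> \<open>The mirror image of the edge from node \<open>i\<close> to \<open>i + 1\<close>
    joins the nodes \<open>2 * j - i - 1\<close> and \<open>2 * j - i\<close>; it is indexed by its
    left node.\<close>
  define k where "k = 2 * j - 1"
  have c_grid: "c - grid N i = grid N (2 * j - i)" for i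
    by (simp add: c grid_def field_simps)
  have refl: "E w (-1 * i + k) = (w (c - grid N i) - w (c - grid N (i + 1)))\<^sup>2" for w i
    by (simp add: E_def c_grid k_def algebra_simps)
  have two: "2 * (\<Sum>i\<in>{0..<2 ^ N}. E w i) = (\<Sum>i\<in>{0..<2 ^ N}. E w i + E w (-1 * i + k))"
    if w: "periodic_2pi w" for w
  proof -
    have "E w (i + 2 ^ N) = E w i" for i
      using periodic_2pi_grid[OF w, of N i] periodic_2pi_grid[OF w, of N "i + 1"]
      by (simp add: E_def algebra_simps)
    then have "(\<Sum>i\<in>{0..<2 ^ N}. E w (-1 * i + k)) = (\<Sum>i\<in>{0..<2 ^ N}. E w i)"
      by (intro sum_periodic_affine) auto
    then show ?thesis by (simp only: sum.distrib)
  qed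
  have "2 * (\<Sum>i\<in>{0..<2 ^ N}. E (polarize c u) i) \<le> 2 * (\<Sum>i\<in>{0..<2 ^ N}. E u i)"
    unfolding two[OF u] two[OF periodic_polarize[OF u]]
  proof (rule sum_mono)
    fix i :: int
    show "E (polarize c u) i + E (polarize c u) (-1 * i + k) \<le> E u i + E u (-1 * i + k)"
      unfolding refl using polarize_increments[OF u s, of "grid N i" "grid N (i + 1)"]
        grid_edge_side[where i=i and j=j and N=N] N c by (simp add: E_def power2_commute)
  qed
  then show ?thesis
    unfolding dyadic_form_self E_def sum_divide_distrib[symmetric] by (intro divide_right_mono) auto
qed

section \<open>Symmetry and monotonicity of minimizers\<close>

definition reduced_minimizer :: "real \<Rightarrow> real \<Rightarrow> (real \<Rightarrow> real) \<Rightarrow> bool" where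
  "reduced_minimizer \<alpha> M u \<longleftrightarrow> u \<in> competitors M \<and> (\<forall>v\<in>competitors M. reduced_energy \<alpha> u \<le> reduced_energy \<alpha> v)"

lemma reduced_minimizerD:
  assumes "reduced_minimizer \<alpha> M u"
  shows "periodic_2pi u" "continuous_on UNIV u" "finite_dirichlet u" "\<And>x. 0 \<le> u x" "integral {-pi..pi} u = M"
  using assms by (auto simp: reduced_minimizer_def competitors_def)

text \<open>Polarization keeps mass and squared norm and does not raise the Dirichlet term, while it
  raises the integral against \<open>cos\<close> strictly unless the values are already ordered.
  Minimality leaves no room for a strict gain.\<close>

lemma reduced_minimizer_polarize:
  assumes min: "reduced_minimizer \<alpha> M u" and c: "c = 2 * grid N j" and gt: "cos (c - x) < cos x"
    and x: "x \<in> {-pi..pi}"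
  shows "u (c - x) \<le> u x"
proof -
  note u = reduced_minimizerD[OF min]
  have "cos x - cos (c - x) = 2 * sin (c / 2) * sin ((c - x - x) / 2)"
    by (simp add: cos_diff_cos)
  then have s: "sin (c / 2) \<noteq> 0" using gt by auto
  define v where "v = polarize c u"
  have pv: "periodic_2pi v" and cv: "continuous_on UNIV v"
    using periodic_polarize[OF u(1)] continuous_polarize[OF u(1,2) s] by (auto simp: v_def)
  \<comment> \<open>A node of level \<open>N\<close> is a node of all finer levels, so the
    comparison is available from there on. Level 0 is left out because \<open>grid_edge_side\<close>
    concerns edges of at most half a circle.\<close>
  have form: "dyadic_form N' v v \<le> dirichlet u" if N': "N' \<ge> max 1 N" for N'
  proof -
    have "grid N j = grid N' (j * 2 ^ (N' - N))"
    proof -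
      obtain k where "N' = N + k" using N' le_Suc_ex[of N N'] by auto
      then show ?thesis by (simp add: grid_def power_add)
    qed
    then have "dyadic_form N' v v \<le> dyadic_form N' u u"
      unfolding v_def using N' c s by (intro dyadic_form_polarize[OF u(1)]) auto
    also have "\<dots> \<le> dirichlet u" by (rule dyadic_form_le_dirichlet[OF u(3)])
    finally show ?thesis .
  qed
  note fin = dirichlet_leI[of "max 1 N", OF form]
  have vpos: "0 \<le> v x" for x unfolding v_def polarize_def using u(4) by (auto simp: le_max_iff_disj)
  have vM: "integral {-pi..pi} v = M"
    using integral_polarize[OF u(1,2) s, of "\<lambda>x. x"] u(5) by (simp add: v_def)
  have "v \<in> competitors M"
    using pv cv fin(1) vpos vM by (simp add: competitors_def)
  then have "reduced_energy \<alpha> u \<le> reduced_energy \<alpha> v" using min by (simp add: reduced_minimizer_def)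
  moreover have "integral {-pi..pi} (\<lambda>x. (v x)\<^sup>2) = integral {-pi..pi} (\<lambda>x. (u x)\<^sup>2)"
    unfolding v_def by (rule integral_polarize[OF u(1,2) s]) (intro continuous_intros)
  ultimately have "integral {-pi..pi} (\<lambda>x. v x * cos x) \<le> integral {-pi..pi} (\<lambda>x. u x * cos x)"
    using fin(2) by (simp add: reduced_energy_def)
  then have le0: "integral {-pi..pi} (\<lambda>x. (v x - u x) * cos x) \<le> 0"
    unfolding left_diff_distrib
    by (subst Henstock_Kurzweil_Integration.integral_diff)
      (auto intro!: integrable_continuous_UNIV continuous_intros cv u(2))
  have cr: "continuous_on UNIV (\<lambda>x. w (c - x))" if "continuous_on UNIV w" for w :: "real \<Rightarrow> real"
    by (rule continuous_on_compose2[OF that]) (auto intro!: continuous_intros)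
  define d where "d x = (v x - u x) * cos x" for x
  have cd: "continuous_on UNIV d" unfolding d_def by (intro continuous_intros cv u(2))
  have pd: "periodic_2pi d" using pv u(1) by (simp add: d_def periodic_2pi_def)
  have dd: "d x + d (c - x) = (v x - u x) * (cos x - cos (c - x))" for x
    using polarize_cases[of x c u] cos_eq_reflect[OF u(1) s, of x]
    by (auto simp: d_def v_def algebra_simps)
  have nonneg: "0 \<le> (v x - u x) * (cos x - cos (c - x))" for x
    by (cases "cos (c - x) \<le> cos x") (auto simp: v_def polarize_def mult_nonpos_nonpos)
  have "integral {-pi..pi} (\<lambda>x. d x + d (c - x)) = integral {-pi..pi} d + integral {-pi..pi} d"
    using integral_periodic_reflect[OF pd cd]
    by (subst Henstock_Kurzweil_Integration.integral_add) (auto intro: integrable_continuous_UNIV cd cr)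
  also have "\<dots> \<le> 0" using le0 unfolding d_def by simp
  finally have "integral {-pi..pi} (\<lambda>x. (v x - u x) * (cos x - cos (c - x))) \<le> 0" unfolding dd .
  moreover have "0 \<le> integral {-pi..pi} (\<lambda>x. (v x - u x) * (cos x - cos (c - x)))"
    using nonneg by (intro integral_nonneg integrable_continuous_UNIV continuous_intros cv u(2) cr) auto
  \<comment> \<open>A continuous nonnegative function with integral 0 vanishes at every point, so
    the conclusion holds at the given \<open>x\<close> and not merely almost everywhere.\<close>
  moreover have "(integral {-pi..pi} (\<lambda>x. (v x - u x) * (cos x - cos (c - x))) = 0)
      = (\<forall>x\<in>{-pi..pi}. (v x - u x) * (cos x - cos (c - x)) = 0)"
    using nonneg
    by (intro integral_eq_0_iff) (auto intro!: continuous_intros continuous_on_subset[OF cv] continuous_on_subset[OF u(2)])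
  ultimately have "(v x - u x) * (cos x - cos (c - x)) = 0" using x by auto
  then have "v x = u x" using gt by auto
  then show ?thesis using gt by (auto simp: v_def polarize_def max_def split: if_splits)
qed

text \<open>The reflection centre midway between \<open>x\<close> and \<open>y\<close> need not be
  dyadic. Dyadic centres near it send \<open>x\<close> close to \<open>y\<close>, and the strict
  inequality of the cosines survives the approximation.\<close>

lemma reduced_minimizer_cos_mono:
  assumes min: "reduced_minimizer \<alpha> M u" and x: "x \<in> {-pi..pi}" and y: "y \<in> {-pi..pi}"
    and gt: "cos y < cos x"
  shows "u y \<le> u x"
proof -
  note u = reduced_minimizerD[OF min]
  have z: "(x + y) / 2 \<in> {-pi..pi}" using x y by auto
  define k where "k N = \<lfloor>((x + y) / 2 + pi) * 2 ^ N / (2 * pi)\<rfloor>" for N :: nat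
  have lim: "(\<lambda>N. 2 * grid N (k N) - x) \<longlonglongrightarrow> 2 * ((x + y) / 2) - x"
    by (intro tendsto_intros dyadic_approx(4)[OF z, folded k_def])
  have yy: "2 * ((x + y) / 2) - x = y" by (simp add: field_simps)
  have "(\<lambda>N. cos (2 * grid N (k N) - x)) \<longlonglongrightarrow> cos y"
    using tendsto_cos[OF lim] unfolding yy .
  then have "eventually (\<lambda>N. cos (2 * grid N (k N) - x) < cos x) sequentially"
    using gt by (rule order_tendstoD(2))
  then have ev: "eventually (\<lambda>N. u (2 * grid N (k N) - x) \<le> u x) sequentially"
    by (elim eventually_mono) (rule reduced_minimizer_polarize[OF min refl _ x])
  have "isCont u y" using u(2) by (simp add: continuous_on_eq_continuous_at)
  then have "(\<lambda>N. u (2 * grid N (k N) - x)) \<longlonglongrightarrow> u y"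
    using isCont_tendsto_compose lim unfolding yy by blast
  then show ?thesis by (rule tendsto_upperbound[OF _ ev]) simp
qed

lemma reduced_minimizer_decreasing:
  assumes min: "reduced_minimizer \<alpha> M u" and xy: "0 \<le> x" "x \<le> y" "y \<le> pi"
  shows "u y \<le> u x"
proof (cases "x = y")
  case False
  then show ?thesis
    using xy by (intro reduced_minimizer_cos_mono[OF min] cos_monotone_0_pi) auto
qed simp

text \<open>The points \<open>x\<close> and \<open>-x\<close> have equal cosines and are not
  compared directly. Comparing \<open>-x\<close> with \<open>x + e\<close>, whose cosine is smaller,
  and letting \<open>e\<close> tend to 0 gives one inequality; the sign \<open>s\<close> gives the
  other.\<close>

lemma reduced_minimizer_even:
  assumes min: "reduced_minimizer \<alpha> M u"
  shows "u (- x) = u x"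
proof -
  note u = reduced_minimizerD[OF min]
  have le: "u (s * x) \<le> u (- s * x)" if x: "0 < x" "x < pi" and s: "s = 1 \<or> s = -1" for x s
  proof -
    have "((\<lambda>e. u (s * (x + e))) \<longlongrightarrow> u (s * (x + 0))) (at_right 0)"
      using u(2) by (intro isCont_tendsto_compose[of _ u] tendsto_intros)
        (auto simp: continuous_on_eq_continuous_at)
    then have lim: "((\<lambda>e. u (s * (x + e))) \<longlongrightarrow> u (s * x)) (at_right 0)" by simp
    have "eventually (\<lambda>e. e \<in> {0<..<pi - x}) (at_right 0)"
      using x by (intro eventually_at_right_real) auto
    then have ev: "eventually (\<lambda>e. u (s * (x + e)) \<le> u (- s * x)) (at_right 0)"
    proof (elim eventually_mono)
      fix e assume e: "e \<in> {0<..<pi - x}"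
      have "cos (x + e) < cos x" using x e by (intro cos_monotone_0_pi) auto
      then show "u (s * (x + e)) \<le> u (- s * x)"
        using s x e cos_minus[of "x + e"] by (intro reduced_minimizer_cos_mono[OF min]) auto
    qed
    show ?thesis by (rule tendsto_upperbound[OF lim ev]) simp
  qed
  have even_wrap: "u (- z) = u z" if "z \<in> {-pi..pi}" for z
  proof -
    have "u (- pi) = u pi" using u(1)[unfolded periodic_2pi_def, rule_format, of "-pi"] by simp
    then show ?thesis
      using that le[of z 1] le[of z "-1"] le[of "-z" 1] le[of "-z" "-1"]
      by (cases "z = pi \<or> z = - pi \<or> z = 0"; cases "z > 0") (auto intro: antisym)
  qed
  obtain k where k: "x = wrap x + 2 * pi * of_int k" using ex_wrap by blast
  have "2 * pi * of_int (- k) = - (2 * pi * real_of_int k)" by simp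
  then have "- x = - wrap x + 2 * pi * of_int (- k)" using k by linarith
  then have "u (- x) = u (- wrap x + 2 * pi * of_int (- k))" by (rule arg_cong)
  also have "\<dots> = u (wrap x)"
    using even_wrap[of "wrap x"] wrap_range[of x] by (simp only: periodic_2pi_int[OF u(1)]) auto
  finally show ?thesis using periodic_2pi_wrap[OF u(1)] by simp
qed

lemma reduced_minimizer_pos_0:
  assumes min: "reduced_minimizer \<alpha> M u" and M: "M > 0"
  shows "u 0 > 0"
proof (rule ccontr)
  note u = reduced_minimizerD[OF min]
  assume n: "\<not> u 0 > 0"
  have "u x = 0" if "x \<in> {-pi..pi}" for x
  proof -
    have "u x = u \<bar>x\<bar>" using reduced_minimizer_even[OF min, of x] by (cases "x \<ge> 0") auto
    moreover have "u \<bar>x\<bar> \<le> u 0" using that by (intro reduced_minimizer_decreasing[OF min]) auto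
    ultimately show ?thesis using n u(4)[of x] by linarith
  qed
  then have "integral {-pi..pi} u = integral {-pi..pi} (\<lambda>x. 0)" by (intro integral_cong) auto
  then show False using u(5) M by simp
qed

section \<open>Euler-Lagrange equation\<close>

text \<open>\<open>arccos (cos _)\<close> is the distance on the circle, which makes the piecewise
  linear hat function at node \<open>j\<close> periodic by construction.\<close>

definition hat :: "nat \<Rightarrow> int \<Rightarrow> real \<Rightarrow> real" where
  "hat N j x = max 0 (1 - arccos (cos (x - grid N j)) / (2 * pi / 2 ^ N))"

definition pl_on_grid :: "nat \<Rightarrow> (real \<Rightarrow> real) \<Rightarrow> bool" where
  "pl_on_grid N \<phi> \<longleftrightarrow> (\<forall>i s. 0 \<le> s \<and> s \<le> 1 \<longrightarrow>
     \<phi> (grid N i + s * (2 * pi / 2 ^ N)) = (1 - s) * \<phi> (grid N i) + s * \<phi> (grid N (i + 1)))"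

lemma periodic_hat: "periodic_2pi (hat N j)"
proof -
  have "cos (x + 2 * pi - grid N j) = cos (x - grid N j)" for x
    using cos_periodic[of "x - grid N j"] by (simp add: algebra_simps)
  then show ?thesis by (simp add: periodic_2pi_def hat_def)
qed

lemma continuous_hat: "continuous_on S (hat N j)"
  unfolding hat_def by (intro continuous_intros) auto

lemma hat_nonneg: "0 \<le> hat N j x"
  by (simp add: hat_def)

lemma hat_le_1: "hat N j x \<le> 1"
  using arccos_lbound[of "cos (x - grid N j)"] by (simp add: hat_def)

lemma hat_near:
  assumes "N \<ge> 1" "\<bar>t\<bar> \<le> 2 * pi / 2 ^ N"
  shows "hat N j (grid N j + t) = 1 - \<bar>t\<bar> / (2 * pi / 2 ^ N)"
proof -
  have "\<bar>t\<bar> \<le> pi" using assms grid_width_le_pi[of N] by linarith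
  then have "arccos (cos t) = \<bar>t\<bar>" using arccos_cos[of "\<bar>t\<bar>"] by simp
  moreover have "0 \<le> 1 - \<bar>t\<bar> / (2 * pi / 2 ^ N)"
  proof -
    have "\<bar>t\<bar> / (2 * pi / 2 ^ N) \<le> 1" using assms(2) by (subst pos_divide_le_eq) auto
    then show ?thesis by linarith
  qed
  ultimately show ?thesis unfolding hat_def by (simp only: add_diff_cancel_left' max_absorb2)
qed

lemma hat_far:
  assumes N: "N \<ge> 1" and t: "2 * pi / 2 ^ N \<le> t" "t \<le> 2 * pi - 2 * pi / 2 ^ N"
  shows "hat N j (grid N j + t) = 0"
proof -
  define \<delta> where "\<delta> = 2 * pi / 2 ^ N"
  have \<delta>: "0 < \<delta>" "\<delta> \<le> pi" using grid_width_le_pi[OF N] by (auto simp: \<delta>_def)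
  have "cos t \<le> cos \<delta>"
  proof (cases "t \<le> pi")
    case True
    then show ?thesis using t \<delta> by (intro cos_monotone_0_pi_le) (auto simp: \<delta>_def)
  next
    case False
    have "cos t = cos (2 * pi - t)" by (simp add: cos_diff)
    also have "\<dots> \<le> cos \<delta>" using t \<delta> False by (intro cos_monotone_0_pi_le) (auto simp: \<delta>_def)
    finally show ?thesis .
  qed
  then have "arccos (cos \<delta>) \<le> arccos (cos t)" by (intro arccos_le_arccos) auto
  then have "\<delta> \<le> arccos (cos t)" using \<delta> by (simp add: arccos_cos)
  then show ?thesis using \<delta> by (simp add: hat_def \<delta>_def[symmetric])
qed

lemma hat_periodic_index: "hat N j (x + 2 * pi * of_int k) = hat N j x"
  by (rule periodic_2pi_int[OF periodic_hat])

lemma pl_on_grid_hat: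
  assumes N: "N \<ge> 1"
  shows "pl_on_grid N (hat N j)"
  unfolding pl_on_grid_def
proof (intro allI impI)
  fix i :: int and s :: real assume s: "0 \<le> s \<and> s \<le> 1"
  define \<delta> where "\<delta> = 2 * pi / 2 ^ N"
  have \<delta>: "\<delta> > 0" by (simp add: \<delta>_def)
  have P: "2 ^ N * \<delta> = 2 * pi" by (simp add: \<delta>_def)
  define q where "q = (i - j) div 2 ^ N"
  define r where "r = (i - j) mod 2 ^ N"
  have ij: "i = j + r + 2 ^ N * q" and r: "0 \<le> r" "r < 2 ^ N"
    using mult_div_mod_eq[of "2 ^ N" "i - j"] by (simp_all add: q_def r_def)
  have "r + 1 \<le> 2 ^ N" using r by simp
  then have "real_of_int (r + 1) \<le> real_of_int (2 ^ N)" by (simp only: of_int_le_iff)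
  then have rr: "real_of_int r + 1 \<le> 2 ^ N" by simp
  have gi: "grid N i = grid N j + of_int r * \<delta> + 2 * pi * of_int q"
    by (simp add: grid_def ij \<delta>_def field_simps)
  have h: "hat N j (grid N i + t * \<delta>) = hat N j (grid N j + (of_int r + t) * \<delta>)" for t
    using hat_periodic_index[of N j "grid N j + (of_int r + t) * \<delta>" q]
    by (simp add: gi algebra_simps)
  have h0: "hat N j (grid N i) = hat N j (grid N j + of_int r * \<delta>)" using h[of 0] by simp
  have h1: "hat N j (grid N (i + 1)) = hat N j (grid N j + (of_int r + 1) * \<delta>)"
    using h[of 1] by (simp add: grid_step \<delta>_def)
  \<comment> \<open>The hat lives on two cells: the one to the right of its node
    (\<open>r = 0\<close>) and the one to its left, which modulo a period has index
    \<open>2 ^ N - 1\<close>.\<close>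
  consider "r = 0" | "r = 2 ^ N - 1" "r \<noteq> 0" | "1 \<le> r" "r + 2 \<le> 2 ^ N" using r by linarith
  then have "hat N j (grid N i + s * \<delta>) = (1 - s) * hat N j (grid N i) + s * hat N j (grid N (i + 1))"
  proof cases
    case 1
    have near: "hat N j (grid N j + t * \<delta>) = 1 - t" if "0 \<le> t" "t \<le> 1" for t
      using hat_near[OF N, of "t * \<delta>" j] that \<delta> by (simp add: \<delta>_def[symmetric] mult_left_le_one_le)
    show ?thesis using near[of s] near[of 0] near[of 1] s unfolding h h0 h1 by (simp add: 1)
  next
    case 2
    then have rr: "real_of_int r = 2 ^ N - 1" by simp
    have near: "hat N j (grid N j + (of_int r + t) * \<delta>) = t" if t: "0 \<le> t" "t \<le> 1" for t
    proof -
      have "(of_int r + t) * \<delta> = (t - 1) * \<delta> + 2 * pi * of_int 1"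
        using P by (simp add: rr algebra_simps)
      then have "hat N j (grid N j + (of_int r + t) * \<delta>) = hat N j (grid N j + (t - 1) * \<delta>)"
        using hat_periodic_index[of N j "grid N j + (t - 1) * \<delta>" 1] by (simp add: add.assoc)
      also have "\<dots> = 1 - \<bar>(t - 1) * \<delta>\<bar> / \<delta>"
        unfolding \<delta>_def using t \<delta>
        by (intro hat_near[OF N]) (auto simp: abs_mult \<delta>_def[symmetric] mult_left_le_one_le)
      also have "\<dots> = t" using t \<delta> by (simp add: abs_mult)
      finally show ?thesis .
    qed
    show ?thesis using near[of s] near[of 0] near[of 1] s unfolding h h0 h1 by simp
  next
    case 3
    then have "real_of_int (r + 2) \<le> real_of_int (2 ^ N)" by (simp only: of_int_le_iff)
    then have rr: "1 \<le> real_of_int r" "real_of_int r + 2 \<le> 2 ^ N" using 3(1) by simp_all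
    have far: "hat N j (grid N j + (of_int r + t) * \<delta>) = 0" if t: "0 \<le> t" "t \<le> 1" for t
    proof (rule hat_far[OF N]; fold \<delta>_def)
      show "\<delta> \<le> (of_int r + t) * \<delta>" using rr t \<delta> by (simp add: mult_le_cancel_right1)
      have "(of_int r + t) * \<delta> \<le> (2 ^ N - 1) * \<delta>" using rr t \<delta> by (intro mult_right_mono) auto
      then show "(of_int r + t) * \<delta> \<le> 2 * pi - \<delta>" using P by (simp add: algebra_simps)
    qed
    show ?thesis using far[of s] far[of 0] far[of 1] s unfolding h h0 h1 by simp
  qed
  then show "hat N j (grid N i + s * (2 * pi / 2 ^ N)) = (1 - s) * hat N j (grid N i) + s * hat N j (grid N (i + 1))"
    by (simp add: \<delta>_def)
qed

lemma pl_on_grid_Suc: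
  assumes "pl_on_grid N \<phi>"
  shows "pl_on_grid (Suc N) \<phi>"
  unfolding pl_on_grid_def
proof (intro allI impI)
  fix i :: int and s :: real assume s: "0 \<le> s \<and> s \<le> 1"
  define \<delta> where "\<delta> = 2 * pi / 2 ^ N"
  note pl = assms[unfolded pl_on_grid_def \<delta>_def[symmetric], rule_format]
  have half: "2 * pi / 2 ^ Suc N = \<delta> / 2" by (simp add: \<delta>_def)
  define k where "k = i div 2"
  have gk1: "grid (Suc N) (2 * k + 1) = grid N k + (1 / 2) * \<delta>"
    using grid_step[of "Suc N" "2 * k"] unfolding grid_refine half by simp
  have gk2: "grid (Suc N) (2 * k + 1 + 1) = grid N (k + 1)"
    using grid_refine[of N "k + 1"] by (simp add: algebra_simps)
  have mid: "\<phi> (grid N k + (1 / 2) * \<delta>) = \<phi> (grid N k) / 2 + \<phi> (grid N (k + 1)) / 2"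
    using pl[of "1 / 2" k] by simp
  consider "i = 2 * k" | "i = 2 * k + 1" unfolding k_def by linarith
  then show "\<phi> (grid (Suc N) i + s * (2 * pi / 2 ^ Suc N)) = (1 - s) * \<phi> (grid (Suc N) i) + s * \<phi> (grid (Suc N) (i + 1))"
  proof cases
    case 1
    have "\<phi> (grid (Suc N) i + s * (2 * pi / 2 ^ Suc N)) = \<phi> (grid N k + (s / 2) * \<delta>)"
      unfolding half 1 grid_refine by simp
    also have "\<dots> = (1 - s / 2) * \<phi> (grid N k) + s / 2 * \<phi> (grid N (k + 1))"
      using s by (intro pl) auto
    also have "\<dots> = (1 - s) * \<phi> (grid (Suc N) i) + s * \<phi> (grid (Suc N) (i + 1))"
      unfolding 1 gk1 mid grid_refine by (simp add: field_simps)
    finally show ?thesis .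
  next
    case 2
    have "\<phi> (grid (Suc N) i + s * (2 * pi / 2 ^ Suc N)) = \<phi> (grid N k + (1 / 2 + s / 2) * \<delta>)"
      unfolding half 2 gk1 by (simp add: algebra_simps)
    also have "\<dots> = (1 - (1 / 2 + s / 2)) * \<phi> (grid N k) + (1 / 2 + s / 2) * \<phi> (grid N (k + 1))"
      using s by (intro pl) auto
    also have "\<dots> = (1 - s) * \<phi> (grid (Suc N) i) + s * \<phi> (grid (Suc N) (i + 1))"
      unfolding 2 gk1 gk2 mid by (simp add: field_simps)
    finally show ?thesis .
  qed
qed

lemma pl_on_grid_mono:
  assumes "pl_on_grid N \<phi>" "N \<le> N'"
  shows "pl_on_grid N' \<phi>"
  using assms(2) by (induction N' rule: dec_induct) (auto intro: pl_on_grid_Suc assms(1))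

lemma pl_on_grid_combination:
  "pl_on_grid N \<phi> \<Longrightarrow> pl_on_grid N \<psi> \<Longrightarrow> pl_on_grid N (\<lambda>x. a * \<phi> x + b * \<psi> x)"
  unfolding pl_on_grid_def by (intro allI impI) (simp only: , simp add: algebra_simps)

text \<open>On each cell the increments of a function that is affine there split evenly, hence the
  cross terms of the increments of \<open>u\<close> telescope.\<close>

lemma dyadic_form_pl_Suc:
  assumes "pl_on_grid N \<phi>"
  shows "dyadic_form (Suc N) u \<phi> = dyadic_form N u \<phi>"
proof -
  have mid: "\<phi> (grid (Suc N) (2 * i + 1)) = (\<phi> (grid N i) + \<phi> (grid N (i + 1))) / 2" for i
    using assms[unfolded pl_on_grid_def, rule_format, of "1 / 2" i] grid_step[of "Suc N" "2 * i"]
    by (simp add: grid_refine add_divide_distrib)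
  have "(u (grid (Suc N) (2 * i + 1)) - u (grid N i)) * (\<phi> (grid (Suc N) (2 * i + 1)) - \<phi> (grid N i))
    + (u (grid N (i + 1)) - u (grid (Suc N) (2 * i + 1))) * (\<phi> (grid N (i + 1)) - \<phi> (grid (Suc N) (2 * i + 1)))
    = (u (grid N (i + 1)) - u (grid N i)) * (\<phi> (grid N (i + 1)) - \<phi> (grid N i)) / 2" for i
    unfolding mid by (simp add: field_simps)
  then show ?thesis
    unfolding dyadic_form_Suc by (simp only: dyadic_form_def sum_divide_distrib[symmetric])
qed

text \<open>The mixed form with a grid function stops changing at the level of that function,
  whatever \<open>u\<close> is. Hence first variations in such directions are computed exactly at
  one finite level.\<close>

lemma dyadic_form_pl_mono:
  assumes "pl_on_grid N \<phi>" "N \<le> N'"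
  shows "dyadic_form N' u \<phi> = dyadic_form N u \<phi>"
  using assms(2)
proof (induction N' rule: dec_induct)
  case (step n)
  then show ?case using dyadic_form_pl_Suc[OF pl_on_grid_mono[OF assms(1)]] by simp
qed simp

text \<open>Only the two edges at node \<open>j\<close> contribute, which leaves the discrete
  Laplacian of \<open>u\<close>.\<close>

lemma dyadic_form_hat:
  assumes u: "periodic_2pi u" and N: "N \<ge> 1"
  shows "dyadic_form N u (hat N j) = (2 * u (grid N j) - u (grid N (j - 1)) - u (grid N (j + 1))) / (2 * pi / 2 ^ N)"
proof -
  define P where "P = (2::int) ^ N"
  have P: "P \<ge> 2" using N power_increasing[of 1 N "2::int"] by (simp add: P_def)
  define f where "f i = (u (grid N (i + 1)) - u (grid N i)) * (hat N j (grid N (i + 1)) - hat N j (grid N i))" for i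
  define \<delta> where "\<delta> = 2 * pi / 2 ^ N"
  have \<delta>: "\<delta> > 0" "2 ^ N * \<delta> = 2 * pi" by (simp_all add: \<delta>_def)
  have gj: "grid N (i + j) = grid N j + of_int i * \<delta>" for i by (simp add: grid_def \<delta>_def field_simps)
  have h1: "hat N j (grid N j) = 1" using hat_near[OF N, of 0 j] by simp
  have h0: "hat N j (grid N (i + j)) = 0" if i: "1 \<le> i" "i + 1 \<le> P" for i
  proof -
    have "real_of_int (i + 1) \<le> real_of_int P" using i by (simp only: of_int_le_iff)
    then have i': "1 \<le> real_of_int i" "real_of_int i + 1 \<le> 2 ^ N" using i by (simp_all add: P_def)
    have "of_int i * \<delta> \<le> (2 ^ N - 1) * \<delta>" using i' \<delta> by (intro mult_right_mono) auto
    then show ?thesis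
      unfolding gj using i' \<delta> by (intro hat_far[OF N]; fold \<delta>_def) (auto simp: algebra_simps mult_le_cancel_right1)
  qed
  have hp: "hat N j (grid N (P + j)) = 1"
    using periodic_2pi_grid[OF periodic_hat, of N j N j] h1 by (simp add: P_def add.commute)
  \<comment> \<open>The summation index is shifted so that the two relevant edges get the numbers 0
    and 1 for every \<open>j\<close>, also at the ends of the period.\<close>
  have "(\<Sum>i\<in>{0..<P}. f i) = (\<Sum>i\<in>{0..<P}. f (1 * i + (j - 1)))"
  proof (rule sum_periodic_affine[symmetric])
    fix i
    have "grid N (i + P + 1) = grid N (i + 1 + 2 ^ N)" by (simp add: P_def algebra_simps)
    then show "f (i + P) = f i"
      using periodic_2pi_grid[OF u, of N i] periodic_2pi_grid[OF u, of N "i + 1"]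
        periodic_2pi_grid[OF periodic_hat, of N j N i] periodic_2pi_grid[OF periodic_hat, of N j N "i + 1"]
      by (simp add: f_def P_def)
  qed (use P in auto)
  also have "\<dots> = (\<Sum>i\<in>{0, 1}. f (1 * i + (j - 1)))"
  proof (rule sum.mono_neutral_right)
    show "\<forall>i\<in>{0..<P} - {0, 1}. f (1 * i + (j - 1)) = 0"
    proof
      fix i assume i: "i \<in> {0..<P} - {0, 1}"
      then have "hat N j (grid N (i + j)) = 0" "hat N j (grid N ((i - 1) + j)) = 0" by (intro h0; auto)+
      then show "f (1 * i + (j - 1)) = 0" by (simp add: f_def algebra_simps)
    qed
  qed (use P in auto)
  also have "\<dots> = f (j - 1) + f j" by simp
  also have "\<dots> = 2 * u (grid N j) - u (grid N (j - 1)) - u (grid N (j + 1))"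
  proof -
    have "hat N j (grid N (j + 1)) = 0" using h0[of 1] P by (simp add: add.commute)
    moreover have "hat N j (grid N (j - 1)) = 0"
    proof -
      have "hat N j (grid N (j - 1)) = hat N j (grid N (j - 1 + 2 ^ N))"
        using periodic_2pi_grid[OF periodic_hat, of N j N "j - 1"] by simp
      also have "j - 1 + 2 ^ N = (P - 1) + j" by (simp add: P_def)
      also have "hat N j (grid N ((P - 1) + j)) = 0" using P by (intro h0) auto
      finally show ?thesis .
    qed
    ultimately show ?thesis by (simp add: f_def h1)
  qed
  finally show ?thesis by (simp add: dyadic_form_def f_def P_def)
qed

text \<open>Integration by parts twice: the second derivative of a hat is a second difference of
  point masses, so what remains is the second difference of \<open>U\<close>, a second primitive of
  \<open>-f\<close>. With \<open>dyadic_form_hat\<close> this turns the Euler-Lagrange equation into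
  an equality of second differences.\<close>

lemma integral_hat:
  assumes N: "N \<ge> 1" and f: "periodic_2pi f" "continuous_on UNIV f"
    and V: "\<And>x. (V has_real_derivative - f x) (at x)" and U: "\<And>x. (U has_real_derivative V x) (at x)"
  shows "integral {-pi..pi} (\<lambda>x. f x * hat N j x)
    = (2 * U (grid N j) - U (grid N (j - 1)) - U (grid N (j + 1))) / (2 * pi / 2 ^ N)"
proof -
  define g where "g = grid N j"
  define \<delta> where "\<delta> = 2 * pi / 2 ^ N"
  have \<delta>: "\<delta> > 0" "\<delta> \<le> pi" using grid_width_le_pi[OF N] by (auto simp: \<delta>_def)
  have gm: "grid N (j - 1) = g - \<delta>" "grid N (j + 1) = g + \<delta>"
    using grid_step[of N "j - 1"] grid_step[of N j] by (simp_all add: g_def \<delta>_def)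
  have near: "hat N j x = 1 - \<bar>x - g\<bar> / \<delta>" if "\<bar>x - g\<bar> \<le> \<delta>" for x
    using hat_near[OF N, of "x - g" j] that by (simp add: g_def \<delta>_def)
  have far1: "hat N j x = 0" if "g + \<delta> \<le> x" "x \<le> g + pi" for x
    using hat_far[OF N, of "x - g" j] that \<delta> by (simp add: g_def \<delta>_def)
  have far2: "hat N j x = 0" if "g - pi \<le> x" "x \<le> g - \<delta>" for x
    using hat_far[OF N, of "x + 2 * pi - g" j] hat_periodic_index[of N j x 1] that \<delta> by (simp add: g_def \<delta>_def)
  let ?F = "\<lambda>x. f x * hat N j x"
  have 1: "(?F has_integral 0) {g - pi..g - \<delta>}"
    by (rule has_integral_is_0) (simp add: far2)
  have 2: "(?F has_integral (- V g + U g / \<delta>) - (U (g - \<delta>) / \<delta>)) {g - \<delta>..g}"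
  proof -
    define Q where "Q x = - ((1 + (x - g) / \<delta>) * V x) + U x / \<delta>" for x
    have "((\<lambda>x. f x * (1 + (x - g) / \<delta>)) has_integral (Q g - Q (g - \<delta>))) {g - \<delta>..g}"
    proof (rule fundamental_theorem_of_calculus)
      fix x
      have "(Q has_real_derivative f x * (1 + (x - g) / \<delta>)) (at x)"
        unfolding Q_def using \<delta> V[of x] U[of x]
        by (auto intro!: derivative_eq_intros simp: field_simps)
      then show "(Q has_vector_derivative f x * (1 + (x - g) / \<delta>)) (at x within {g - \<delta>..g})"
        by (simp add: has_real_derivative_iff_has_vector_derivative has_vector_derivative_at_within)
    qed (use \<delta> in auto)
    also have "Q g - Q (g - \<delta>) = (- V g + U g / \<delta>) - (U (g - \<delta>) / \<delta>)"
      using \<delta> by (simp add: Q_def)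
    finally show ?thesis
      by (rule has_integral_eq[rotated]) (auto simp: near abs_if field_simps)
  qed
  have 3: "(?F has_integral - (U (g + \<delta>) / \<delta>) + V g + U g / \<delta>) {g..g + \<delta>}"
  proof -
    define Q where "Q x = - ((1 - (x - g) / \<delta>) * V x) - U x / \<delta>" for x
    have "((\<lambda>x. f x * (1 - (x - g) / \<delta>)) has_integral (Q (g + \<delta>) - Q g)) {g..g + \<delta>}"
    proof (rule fundamental_theorem_of_calculus)
      fix x
      have "(Q has_real_derivative f x * (1 - (x - g) / \<delta>)) (at x)"
        unfolding Q_def using \<delta> V[of x] U[of x]
        by (auto intro!: derivative_eq_intros simp: field_simps)
      then show "(Q has_vector_derivative f x * (1 - (x - g) / \<delta>)) (at x within {g..g + \<delta>})"
        by (simp add: has_real_derivative_iff_has_vector_derivative has_vector_derivative_at_within)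
    qed (use \<delta> in auto)
    also have "Q (g + \<delta>) - Q g = - (U (g + \<delta>) / \<delta>) + V g + U g / \<delta>"
      using \<delta> by (simp add: Q_def)
    finally show ?thesis
      by (rule has_integral_eq[rotated]) (auto simp: near abs_if field_simps)
  qed
  have 4: "(?F has_integral 0) {g + \<delta>..g + pi}"
    by (rule has_integral_is_0) (simp add: far1)
  have "(?F has_integral 0 + ((- V g + U g / \<delta>) - (U (g - \<delta>) / \<delta>)) + (- (U (g + \<delta>) / \<delta>) + V g + U g / \<delta>) + 0)
      {g - pi..g + pi}"
    by (rule has_integral_combine[OF _ _ has_integral_combine[OF _ _ has_integral_combine[OF _ _ 1 2] 3] 4])
      (use \<delta> in auto)
  then have "integral {g - pi..g - pi + 2 * pi} ?F = (2 * U g - U (g - \<delta>) - U (g + \<delta>)) / \<delta>"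
    by (simp add: integral_unique diff_divide_distrib add.commute)
  moreover have "integral {g - pi..g - pi + 2 * pi} ?F = integral {-pi..pi} ?F"
  proof (rule integral_periodic_shift)
    show "periodic_2pi ?F" using f(1) periodic_hat[of N j] by (simp add: periodic_2pi_def)
    show "continuous_on UNIV ?F" by (intro continuous_intros f continuous_hat)
  qed
  ultimately show ?thesis by (simp add: gm g_def \<delta>_def)
qed

section \<open>First variation in the direction of grid functions\<close>

lemma integral_combination:
  fixes f g :: "real \<Rightarrow> real"
  assumes "continuous_on UNIV f" "continuous_on UNIV g"
  shows "integral {a..b} (\<lambda>x. c * f x + d * g x) = c * integral {a..b} f + d * integral {a..b} g"
  using assms by (subst Henstock_Kurzweil_Integration.integral_add)
    (auto intro!: integrable_continuous_UNIV continuous_intros)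

lemma dyadic_form_combination:
  "dyadic_form N u (\<lambda>x. c * f x + d * g x) = c * dyadic_form N u f + d * dyadic_form N u g"
proof -
  have "(\<Sum>i\<in>{0..<2 ^ N}. (u (grid N (i + 1)) - u (grid N i)) *
      (c * f (grid N (i + 1)) + d * g (grid N (i + 1)) - (c * f (grid N i) + d * g (grid N i))))
    = c * (\<Sum>i\<in>{0..<2 ^ N}. (u (grid N (i + 1)) - u (grid N i)) * (f (grid N (i + 1)) - f (grid N i)))
    + d * (\<Sum>i\<in>{0..<2 ^ N}. (u (grid N (i + 1)) - u (grid N i)) * (g (grid N (i + 1)) - g (grid N i)))"
    unfolding sum_distrib_left sum.distrib[symmetric] by (rule sum.cong) (auto simp: algebra_simps)
  then show ?thesis unfolding dyadic_form_def by (simp add: algebra_simps)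
qed

lemma dyadic_form_perturb:
  "dyadic_form N (\<lambda>x. u x + e * f x) (\<lambda>x. u x + e * f x)
    = dyadic_form N u u + 2 * e * dyadic_form N u f + e\<^sup>2 * dyadic_form N f f"
proof -
  have "(\<Sum>i\<in>{0..<2 ^ N}. (u (grid N (i + 1)) + e * f (grid N (i + 1)) - (u (grid N i) + e * f (grid N i))) *
      (u (grid N (i + 1)) + e * f (grid N (i + 1)) - (u (grid N i) + e * f (grid N i))))
    = (\<Sum>i\<in>{0..<2 ^ N}. (u (grid N (i + 1)) - u (grid N i)) * (u (grid N (i + 1)) - u (grid N i)))
    + 2 * e * (\<Sum>i\<in>{0..<2 ^ N}. (u (grid N (i + 1)) - u (grid N i)) * (f (grid N (i + 1)) - f (grid N i)))
    + e\<^sup>2 * (\<Sum>i\<in>{0..<2 ^ N}. (f (grid N (i + 1)) - f (grid N i)) * (f (grid N (i + 1)) - f (grid N i)))"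
    unfolding sum_distrib_left sum.distrib[symmetric]
    by (rule sum.cong) (auto simp: algebra_simps power2_eq_square)
  then show ?thesis unfolding dyadic_form_def by (simp add: algebra_simps)
qed

text \<open>The derivative of the reduced energy at \<open>u\<close> in the direction
  \<open>\<phi>\<close>, intended for \<open>\<phi>\<close> piecewise affine on the grid of level
  \<open>N\<close>.\<close>

definition first_variation :: "real \<Rightarrow> (real \<Rightarrow> real) \<Rightarrow> nat \<Rightarrow> (real \<Rightarrow> real) \<Rightarrow> real" where
  "first_variation \<alpha> u N \<phi> = dyadic_form N u \<phi> - integral {-pi..pi} (\<lambda>x. (\<alpha>\<^sup>2 * u x + cos x) * \<phi> x)"

lemma first_variation_combination:
  assumes "continuous_on UNIV u" "continuous_on UNIV f" "continuous_on UNIV g"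
  shows "first_variation \<alpha> u N (\<lambda>x. c * f x + d * g x) = c * first_variation \<alpha> u N f + d * first_variation \<alpha> u N g"
proof -
  have "integral {-pi..pi} (\<lambda>x. (\<alpha>\<^sup>2 * u x + cos x) * (c * f x + d * g x))
     = integral {-pi..pi} (\<lambda>x. c * ((\<alpha>\<^sup>2 * u x + cos x) * f x) + d * ((\<alpha>\<^sup>2 * u x + cos x) * g x))"
    by (rule integral_cong) (simp add: algebra_simps)
  also have "\<dots> = c * integral {-pi..pi} (\<lambda>x. (\<alpha>\<^sup>2 * u x + cos x) * f x)
      + d * integral {-pi..pi} (\<lambda>x. (\<alpha>\<^sup>2 * u x + cos x) * g x)"
    by (intro integral_combination continuous_intros assms)
  finally show ?thesis
    unfolding first_variation_def dyadic_form_combination by (simp add: algebra_simps)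
qed

text \<open>Along \<open>u + e * \<phi>\<close> the energy is bounded above by a quadratic
  polynomial in \<open>e\<close> with constant term \<open>reduced_energy \<alpha> u\<close> and
  linear coefficient \<open>first_variation\<close>; dividing by \<open>e\<close> and letting it
  tend to 0 gives the sign. Only \<open>e > 0\<close> is admissible in general, since
  \<open>u\<close> may vanish.\<close>

lemma first_variation_nonneg:
  assumes min: "reduced_minimizer \<alpha> M u"
    and \<phi>: "periodic_2pi \<phi>" "continuous_on UNIV \<phi>" "pl_on_grid N \<phi>" "integral {-pi..pi} \<phi> = 0"
    and e0: "0 < e0" "\<And>x. 0 \<le> u x + e0 * \<phi> x"
  shows "0 \<le> first_variation \<alpha> u N \<phi>"
proof -
  note u = reduced_minimizerD[OF min]
  define b where "b = dyadic_form N u \<phi>"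
  define q where "q = dyadic_form N \<phi> \<phi>"
  define I where "I = integral {-pi..pi} (\<lambda>x. (\<phi> x)\<^sup>2)"
  have key: "0 \<le> first_variation \<alpha> u N \<phi> + e * ((q - \<alpha>\<^sup>2 * I) / 2)" if e: "0 < e" "e \<le> e0" for e
  proof -
    define v where "v x = u x + e * \<phi> x" for x
    have cv: "continuous_on UNIV v" unfolding v_def by (intro continuous_intros u \<phi>)
    have form: "dyadic_form N' v v \<le> dirichlet u + 2 * e * b + e\<^sup>2 * q" if "N' \<ge> N" for N'
      using dyadic_form_perturb[of N' u e \<phi>] dyadic_form_pl_mono[OF \<phi>(3) that]
        dyadic_form_le_dirichlet[OF u(3), of N'] by (simp add: v_def[abs_def] b_def q_def)
    note fin = dirichlet_leI[of N, OF form]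
    have vpos: "0 \<le> v x" for x
    proof -
      \<comment> \<open>Convexity: nonnegativity at \<open>e0\<close> is inherited by all smaller
        \<open>e\<close>.\<close>
      have "v x = (1 - e / e0) * u x + e / e0 * (u x + e0 * \<phi> x)"
        using e0 by (simp add: v_def field_simps)
      moreover have "0 \<le> (1 - e / e0) * u x" "0 \<le> e / e0 * (u x + e0 * \<phi> x)"
        using e e0(1) u(4)[of x] e0(2)[of x] by (simp_all only: mult_nonneg_nonneg divide_nonneg_pos
          diff_ge_0_iff_ge divide_le_eq_1_pos less_imp_le)
      ultimately show ?thesis by simp
    qed
    have "integral {-pi..pi} v = M"
      using integral_combination[OF u(2) \<phi>(2), of "-pi" pi 1 e] u(5) \<phi>(4) by (simp add: v_def[abs_def])
    moreover have "periodic_2pi v" using u(1) \<phi>(1) by (simp add: v_def periodic_2pi_def)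
    ultimately have "v \<in> competitors M" using cv fin(1) vpos by (simp add: competitors_def)
    then have le: "reduced_energy \<alpha> u \<le> reduced_energy \<alpha> v" using min by (simp add: reduced_minimizer_def)
    have sq: "integral {-pi..pi} (\<lambda>x. (v x)\<^sup>2) = integral {-pi..pi} (\<lambda>x. (u x)\<^sup>2)
        + 2 * e * integral {-pi..pi} (\<lambda>x. u x * \<phi> x) + e\<^sup>2 * I"
    proof -
      have "integral {-pi..pi} (\<lambda>x. (v x)\<^sup>2)
        = integral {-pi..pi} (\<lambda>x. 1 * (1 * (u x)\<^sup>2 + 2 * e * (u x * \<phi> x)) + e\<^sup>2 * (\<phi> x)\<^sup>2)"
        by (rule integral_cong) (simp add: v_def power2_eq_square algebra_simps)
      also have "\<dots> = 1 * integral {-pi..pi} (\<lambda>x. 1 * (u x)\<^sup>2 + 2 * e * (u x * \<phi> x)) + e\<^sup>2 * I"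
        unfolding I_def by (intro integral_combination continuous_intros u \<phi>)
      also have "integral {-pi..pi} (\<lambda>x. 1 * (u x)\<^sup>2 + 2 * e * (u x * \<phi> x))
        = 1 * integral {-pi..pi} (\<lambda>x. (u x)\<^sup>2) + 2 * e * integral {-pi..pi} (\<lambda>x. u x * \<phi> x)"
        by (intro integral_combination continuous_intros u \<phi>)
      finally show ?thesis by simp
    qed
    have cs: "integral {-pi..pi} (\<lambda>x. v x * cos x) = integral {-pi..pi} (\<lambda>x. u x * cos x)
        + e * integral {-pi..pi} (\<lambda>x. cos x * \<phi> x)"
    proof -
      have "integral {-pi..pi} (\<lambda>x. v x * cos x) = integral {-pi..pi} (\<lambda>x. 1 * (u x * cos x) + e * (cos x * \<phi> x))"
        by (rule integral_cong) (simp add: v_def algebra_simps)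
      also have "\<dots> = 1 * integral {-pi..pi} (\<lambda>x. u x * cos x) + e * integral {-pi..pi} (\<lambda>x. cos x * \<phi> x)"
        by (intro integral_combination continuous_intros u \<phi>)
      finally show ?thesis by simp
    qed
    have fv: "first_variation \<alpha> u N \<phi> = b - \<alpha>\<^sup>2 * integral {-pi..pi} (\<lambda>x. u x * \<phi> x)
        - integral {-pi..pi} (\<lambda>x. cos x * \<phi> x)"
    proof -
      have "integral {-pi..pi} (\<lambda>x. (\<alpha>\<^sup>2 * u x + cos x) * \<phi> x)
        = integral {-pi..pi} (\<lambda>x. \<alpha>\<^sup>2 * (u x * \<phi> x) + 1 * (cos x * \<phi> x))"
        by (rule integral_cong) (simp add: algebra_simps)
      also have "\<dots> = \<alpha>\<^sup>2 * integral {-pi..pi} (\<lambda>x. u x * \<phi> x) + 1 * integral {-pi..pi} (\<lambda>x. cos x * \<phi> x)"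
        by (intro integral_combination continuous_intros u \<phi>)
      finally show ?thesis by (simp add: first_variation_def b_def)
    qed
    have "0 \<le> e * (first_variation \<alpha> u N \<phi> + e * ((q - \<alpha>\<^sup>2 * I) / 2))"
      using le fin(2) unfolding reduced_energy_def sq cs fv
      by (simp add: power2_eq_square algebra_simps diff_divide_distrib add_divide_distrib)
    then show ?thesis using e by (simp add: zero_le_mult_iff)
  qed
  have "((\<lambda>e. first_variation \<alpha> u N \<phi> + e * ((q - \<alpha>\<^sup>2 * I) / 2)) \<longlongrightarrow> first_variation \<alpha> u N \<phi> + 0 * ((q - \<alpha>\<^sup>2 * I) / 2)) (at_right 0)"
    by (intro tendsto_intros)
  moreover have "eventually (\<lambda>e. e \<in> {0<..<e0}) (at_right 0)"
    using e0(1) by (intro eventually_at_right_real) auto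
  then have "eventually (\<lambda>e. 0 \<le> first_variation \<alpha> u N \<phi> + e * ((q - \<alpha>\<^sup>2 * I) / 2)) (at_right 0)"
  proof (elim eventually_mono)
    fix e assume "e \<in> {0<..<e0}"
    then show "0 \<le> first_variation \<alpha> u N \<phi> + e * ((q - \<alpha>\<^sup>2 * I) / 2)" by (intro key) auto
  qed
  ultimately have "0 \<le> first_variation \<alpha> u N \<phi> + 0 * ((q - \<alpha>\<^sup>2 * I) / 2)"
    by (rule tendsto_lowerbound) simp
  then show ?thesis by simp
qed

lemma integral_hat_mass:
  assumes "N \<ge> 1"
  shows "integral {-pi..pi} (hat N j) = 2 * pi / 2 ^ N"
proof -
  have "integral {-pi..pi} (\<lambda>x. 1 * hat N j x) = (2 * (\<lambda>x. - x\<^sup>2 / 2) (grid N j) - (\<lambda>x. - x\<^sup>2 / 2) (grid N (j - 1))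
      - (\<lambda>x. - x\<^sup>2 / 2) (grid N (j + 1))) / (2 * pi / 2 ^ N)"
    by (rule integral_hat[OF assms, where V="\<lambda>x. - x"])
      (auto simp: periodic_2pi_def intro!: derivative_eq_intros)
  also have "grid N (j - 1) = grid N j - 2 * pi / 2 ^ N" using grid_step[of N "j - 1"] by simp
  also have "grid N (j + 1) = grid N j + 2 * pi / 2 ^ N" by (rule grid_step)
  finally show ?thesis by (simp add: power2_eq_square algebra_simps) (simp add: field_simps)
qed

lemma hat_supportD:
  assumes N: "N \<ge> 1" and x: "x \<in> {-pi..pi}" and pos: "hat N j x > 0"
    and g: "grid N j \<in> {-pi..pi}" "\<bar>grid N j\<bar> + 2 * pi / 2 ^ N \<le> pi"
  shows "\<bar>x\<bar> \<le> \<bar>grid N j\<bar> + 2 * pi / 2 ^ N"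
proof (rule ccontr)
  assume "\<not> ?thesis"
  then consider "x - grid N j > 2 * pi / 2 ^ N" "grid N j \<ge> - x + 2 * pi / 2 ^ N" "x \<ge> 0"
    | "x - grid N j < - (2 * pi / 2 ^ N)" "grid N j \<le> - x - 2 * pi / 2 ^ N" "x \<le> 0"
    by linarith
  then have "hat N j x = 0"
  proof cases
    case 1
    then show ?thesis using hat_far[OF N, of "x - grid N j" j] x g by simp
  next
    case 2
    then show ?thesis using hat_far[OF N, of "x + 2 * pi - grid N j" j] hat_periodic_index[of N j x 1] x g by simp
  qed
  then show False using pos by simp
qed

text \<open>\<open>lam\<close> is the Lagrange multiplier of the mass constraint, normalised by a
  fixed hat \<open>\<psi>\<close> at 0 on whose support \<open>u\<close> is bounded below. A small
  hat may always be added, with its mass taken from \<open>\<psi>\<close>, which gives the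
  inequality; it may be subtracted where \<open>u\<close> is positive on its support, which gives
  the equality.\<close>

lemma first_variation_hat_bounds:
  assumes min: "reduced_minimizer \<alpha> M u" and M: "M > 0"
  obtains N0 lam where "N0 \<ge> 1"
    "\<And>N j. N \<ge> N0 \<Longrightarrow> lam * (2 * pi / 2 ^ N) \<le> first_variation \<alpha> u N (hat N j)"
    "\<And>N j. N \<ge> N0 \<Longrightarrow> grid N j \<in> {-pi..pi} \<Longrightarrow> \<bar>grid N j\<bar> + 2 * pi / 2 ^ N \<le> pi
      \<Longrightarrow> u (\<bar>grid N j\<bar> + 2 * pi / 2 ^ N) > 0 \<Longrightarrow> first_variation \<alpha> u N (hat N j) = lam * (2 * pi / 2 ^ N)"
proof -
  note u = reduced_minimizerD[OF min]
  note dec = reduced_minimizer_decreasing[OF min] and ev = reduced_minimizer_even[OF min]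
  have abs: "u x = u \<bar>x\<bar>" for x using ev[of x] by (cases "x \<ge> 0") auto
  have dec': "u y \<le> u x" if "\<bar>x\<bar> \<le> y" "y \<le> pi" for x y
    using dec[of "\<bar>x\<bar>" y] abs[of x] that by simp
  have u0: "u 0 > 0" by (rule reduced_minimizer_pos_0[OF min M])
  have "(\<lambda>N. u (2 * pi / 2 ^ N)) \<longlonglongrightarrow> u 0"
    using u(2) by (intro isCont_tendsto_compose[of _ u] LIMSEQ_divide_realpow_zero)
      (auto simp: continuous_on_eq_continuous_at)
  then have "eventually (\<lambda>N. u (2 * pi / 2 ^ N) > 0) sequentially" using u0 by (rule order_tendstoD)
  then obtain N0 where N0: "N0 \<ge> 1" "u (2 * pi / 2 ^ N0) > 0"
    unfolding eventually_sequentially by (metis max.cobounded1 max.cobounded2)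
  define m0 where "m0 = u (2 * pi / 2 ^ N0)"
  define j0 where "j0 = (2::int) ^ (N0 - 1)"
  obtain n where n: "N0 = Suc n" using N0(1) by (cases N0) auto
  have g0: "grid N0 j0 = 0" by (simp add: grid_def j0_def n)
  have \<delta>0: "2 * pi / 2 ^ N0 \<le> pi" by (simp add: n field_simps)
  define \<psi> where "\<psi> = hat N0 j0"
  have \<psi>: "periodic_2pi \<psi>" "continuous_on UNIV \<psi>" "integral {-pi..pi} \<psi> = 2 * pi / 2 ^ N0"
    "pl_on_grid N0 \<psi>"
    using periodic_hat continuous_hat integral_hat_mass[OF N0(1)] pl_on_grid_hat[OF N0(1)] by (auto simp: \<psi>_def)
  have \<psi>u: "m0 \<le> u x" if "\<psi> x > 0" for x
  proof -
    have "\<psi> (wrap x) > 0" using that periodic_2pi_wrap[OF \<psi>(1)] by simp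
    then have "\<bar>wrap x\<bar> \<le> 2 * pi / 2 ^ N0"
      using hat_supportD[OF N0(1), of "wrap x" j0] wrap_range[of x] g0 \<delta>0 by (simp add: \<psi>_def)
    then have "m0 \<le> u (wrap x)" unfolding m0_def using \<delta>0 by (rule dec')
    then show ?thesis using periodic_2pi_wrap[OF u(1)] by simp
  qed
  have \<psi>b: "0 \<le> \<psi> x" "\<psi> x \<le> 1" for x using hat_nonneg hat_le_1 by (auto simp: \<psi>_def)
  define lam where "lam = first_variation \<alpha> u N0 \<psi> / (2 * pi / 2 ^ N0)"
  have fv\<psi>: "first_variation \<alpha> u N \<psi> = lam * (2 * pi / 2 ^ N0)" if "N \<ge> N0" for N
    using dyadic_form_pl_mono[OF \<psi>(4) that] by (simp add: lam_def first_variation_def)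
  have comb: "0 \<le> s * (first_variation \<alpha> u N (hat N j) - lam * (2 * pi / 2 ^ N))"
    if N: "N \<ge> N0" and e: "e0 > 0" "\<And>x. 0 \<le> u x + e0 * (s * hat N j x + - (s * 2 ^ N0 / 2 ^ N) * \<psi> x)" for N j s e0
  proof -
    have N1: "N \<ge> 1" using N N0(1) by simp
    \<comment> \<open>\<open>2 ^ N0 / 2 ^ N\<close> is the ratio of the masses of the two hats, so
      \<open>\<phi>\<close> has mass 0.\<close>
    define \<phi> where "\<phi> = (\<lambda>x. s * hat N j x + - (s * 2 ^ N0 / 2 ^ N) * \<psi> x)"
    have "0 \<le> first_variation \<alpha> u N \<phi>"
    proof (rule first_variation_nonneg[OF min _ _ _ _ e(1)])
      show "periodic_2pi \<phi>" using periodic_hat[of N j] \<psi>(1) by (simp add: \<phi>_def periodic_2pi_def)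
      show "continuous_on UNIV \<phi>" unfolding \<phi>_def by (intro continuous_intros continuous_hat \<psi>)
      show "pl_on_grid N \<phi>"
        unfolding \<phi>_def using pl_on_grid_hat[OF N1] pl_on_grid_mono[OF \<psi>(4) N]
        by (rule pl_on_grid_combination)
      show "integral {-pi..pi} \<phi> = 0"
        unfolding \<phi>_def integral_combination[OF continuous_hat \<psi>(2)]
        using integral_hat_mass[OF N1, of j] \<psi>(3) by simp
      show "0 \<le> u x + e0 * \<phi> x" for x using e(2)[of x] by (simp add: \<phi>_def)
    qed
    also have "first_variation \<alpha> u N \<phi> = s * first_variation \<alpha> u N (hat N j) + - (s * 2 ^ N0 / 2 ^ N) * first_variation \<alpha> u N \<psi>"
      unfolding \<phi>_def by (rule first_variation_combination[OF u(2) continuous_hat \<psi>(2)])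
    also have "\<dots> = s * (first_variation \<alpha> u N (hat N j) - lam * (2 * pi / 2 ^ N))"
      unfolding fv\<psi>[OF N] by (simp add: field_simps)
    finally show ?thesis .
  qed
  have ratio: "0 < (2::real) ^ N0 / 2 ^ N" "(2::real) ^ N0 / 2 ^ N \<le> 1" if "N \<ge> N0" for N
    using power_increasing[OF that, of "2::real"] by simp_all
  have lower: "lam * (2 * pi / 2 ^ N) \<le> first_variation \<alpha> u N (hat N j)" if N: "N \<ge> N0" for N j
  proof -
    have "0 \<le> u x + m0 * (1 * hat N j x + - (1 * 2 ^ N0 / 2 ^ N) * \<psi> x)" for x
    proof -
      have "m0 * ((2 ^ N0 / 2 ^ N) * \<psi> x) \<le> u x"
      proof (cases "\<psi> x > 0")
        case True
        have "(2 ^ N0 / 2 ^ N) * \<psi> x \<le> 1" using ratio[OF N] \<psi>b[of x] by (intro mult_le_one) auto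
        then have "m0 * ((2 ^ N0 / 2 ^ N) * \<psi> x) \<le> m0 * 1" using N0 by (intro mult_left_mono) (auto simp: m0_def)
        then show ?thesis using \<psi>u[OF True] by simp
      next
        case False
        then have "\<psi> x = 0" using \<psi>b[of x] by simp
        then show ?thesis using u(4) by simp
      qed
      moreover have "0 \<le> m0 * hat N j x" using N0 hat_nonneg by (simp add: m0_def)
      ultimately show ?thesis by (simp add: algebra_simps)
    qed
    then show ?thesis using comb[OF N, of m0 1 j] N0(2) by (simp add: m0_def)
  qed
  have upper: "first_variation \<alpha> u N (hat N j) \<le> lam * (2 * pi / 2 ^ N)"
    if N: "N \<ge> N0" and j: "grid N j \<in> {-pi..pi}" "\<bar>grid N j\<bar> + 2 * pi / 2 ^ N \<le> pi"
      and pos: "u (\<bar>grid N j\<bar> + 2 * pi / 2 ^ N) > 0" for N j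
  proof -
    define m where "m = u (\<bar>grid N j\<bar> + 2 * pi / 2 ^ N)"
    have "0 \<le> u x + m * (- 1 * hat N j x + - (- 1 * 2 ^ N0 / 2 ^ N) * \<psi> x)" for x
    proof -
      have "m * hat N j x \<le> u x"
      proof (cases "hat N j x > 0")
        case True
        then have "hat N j (wrap x) > 0" using periodic_2pi_wrap[OF periodic_hat] by simp
        then have "\<bar>wrap x\<bar> \<le> \<bar>grid N j\<bar> + 2 * pi / 2 ^ N"
          using hat_supportD[of N "wrap x" j] N N0(1) wrap_range[of x] j by simp
        then have "m \<le> u (wrap x)" unfolding m_def using j by (intro dec')
        then have "m \<le> u x" using periodic_2pi_wrap[OF u(1)] by simp
        moreover have "m * hat N j x \<le> m * 1" using pos hat_le_1 by (intro mult_left_mono) (auto simp: m_def)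
        ultimately show ?thesis by simp
      next
        case False
        then have "hat N j x = 0" using hat_nonneg[of N j x] by simp
        then show ?thesis using u(4) by simp
      qed
      moreover have "0 \<le> m * ((2 ^ N0 / 2 ^ N) * \<psi> x)"
        using ratio[OF N] \<psi>b[of x] pos by (intro mult_nonneg_nonneg) (auto simp: m_def)
      ultimately show ?thesis by (simp add: algebra_simps)
    qed
    then show ?thesis using comb[OF N, of m "- 1" j] pos by (simp add: m_def)
  qed
  show ?thesis using that[OF N0(1)] lower upper by (meson antisym)
qed

lemma DERIV_reflect:
  assumes "\<And>x::real. (F has_real_derivative f x) (at x)"
  shows "((\<lambda>x. F (- x)) has_real_derivative - f (- x)) (at x)"
  using DERIV_chain2[OF assms DERIV_minus[OF DERIV_ident], of x] by simp

lemma primitive_parity: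
  fixes f F :: "real \<Rightarrow> real"
  assumes F: "\<And>x. (F has_real_derivative f x) (at x)" and f: "\<And>x. f (- x) = s * f x"
    and s: "s = 1 \<or> s = -1" and F0: "s = 1 \<Longrightarrow> F 0 = 0"
  shows "F (- x) = - s * F x"
proof -
  have "((\<lambda>x. F (- x) + s * F x) has_real_derivative - f (- x) + s * f x) (at x)" for x
    by (intro DERIV_add DERIV_cmult DERIV_reflect F)
  then have "((\<lambda>x. F (- x) + s * F x) has_real_derivative 0) (at x)" for x by (simp add: f)
  then have "F (- x) + s * F x = F (- 0) + s * F 0"
    using DERIV_isconst_all[of "\<lambda>x. F (- x) + s * F x"] by blast
  then show ?thesis using s F0 by auto
qed

text \<open>\<open>V\<close> and \<open>U\<close> are the first and second primitives of the right-hand side of the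
  Euler-Lagrange equation \<open>u'' = - (\<alpha>\<^sup>2 u + cos + lam)\<close>.\<close>

lemma euler_lagrange_dyadic:
  assumes min: "reduced_minimizer \<alpha> M u" and M: "M > 0"
  obtains N0 lam U V where "N0 \<ge> 1"
    "\<And>x. (V has_real_derivative - (\<alpha>\<^sup>2 * u x + cos x + lam)) (at x)" "V 0 = 0"
    "\<And>x. (U has_real_derivative V x) (at x)" "\<And>x. U (- x) = U x"
    "\<And>N j. N \<ge> N0 \<Longrightarrow> 2 * U (grid N j) - U (grid N (j - 1)) - U (grid N (j + 1))
        \<le> 2 * u (grid N j) - u (grid N (j - 1)) - u (grid N (j + 1))"
    "\<And>N j. N \<ge> N0 \<Longrightarrow> grid N j \<in> {-pi..pi} \<Longrightarrow> \<bar>grid N j\<bar> + 2 * pi / 2 ^ N \<le> pi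
      \<Longrightarrow> u (\<bar>grid N j\<bar> + 2 * pi / 2 ^ N) > 0 \<Longrightarrow> 2 * U (grid N j) - U (grid N (j - 1)) - U (grid N (j + 1))
        = 2 * u (grid N j) - u (grid N (j - 1)) - u (grid N (j + 1))"
proof -
  note u = reduced_minimizerD[OF min]
  obtain N0 lam where N0: "N0 \<ge> 1"
    and low: "\<And>N j. N \<ge> N0 \<Longrightarrow> lam * (2 * pi / 2 ^ N) \<le> first_variation \<alpha> u N (hat N j)"
    and eq: "\<And>N j. N \<ge> N0 \<Longrightarrow> grid N j \<in> {-pi..pi} \<Longrightarrow> \<bar>grid N j\<bar> + 2 * pi / 2 ^ N \<le> pi
      \<Longrightarrow> u (\<bar>grid N j\<bar> + 2 * pi / 2 ^ N) > 0 \<Longrightarrow> first_variation \<alpha> u N (hat N j) = lam * (2 * pi / 2 ^ N)"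
    using first_variation_hat_bounds[OF min M] by blast
  define h where "h x = \<alpha>\<^sup>2 * u x + cos x + lam" for x
  have ch: "continuous_on UNIV h" unfolding h_def by (intro continuous_intros u)
  have ph: "periodic_2pi h" using u(1) by (simp add: h_def periodic_2pi_def)
  have cmh: "continuous_on UNIV (\<lambda>x. - h x)" by (intro continuous_intros ch)
  obtain V where V: "\<And>x. (V has_real_derivative - h x) (at x)" "V 0 = 0"
    using continuous_primitive[OF cmh] by blast
  have cV: "continuous_on UNIV V" using V(1) by (intro DERIV_continuous_on) auto
  obtain U where U: "\<And>x. (U has_real_derivative V x) (at x)" "U 0 = 0"
    using continuous_primitive[OF cV] by blast
  have odd: "V (- x) = - V x" for x
    using primitive_parity[where s=1, OF V(1)] V(2) reduced_minimizer_even[OF min] by (simp add: h_def)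
  have even: "U (- x) = U x" for x
    using primitive_parity[where s="-1", OF U(1)] odd by simp
  \<comment> \<open>Both terms of the first variation at a hat are second differences divided by the
    grid width.\<close>
  have fv: "first_variation \<alpha> u N (hat N j) - lam * (2 * pi / 2 ^ N)
     = ((2 * u (grid N j) - u (grid N (j - 1)) - u (grid N (j + 1)))
       - (2 * U (grid N j) - U (grid N (j - 1)) - U (grid N (j + 1)))) / (2 * pi / 2 ^ N)" if N: "N \<ge> 1" for N j
  proof -
    have "integral {-pi..pi} (\<lambda>x. (\<alpha>\<^sup>2 * u x + cos x) * hat N j x) + lam * (2 * pi / 2 ^ N)
      = integral {-pi..pi} (\<lambda>x. 1 * ((\<alpha>\<^sup>2 * u x + cos x) * hat N j x) + lam * hat N j x)"
      using integral_hat_mass[OF N, of j]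
      by (subst integral_combination) (auto intro!: continuous_intros u continuous_hat)
    also have "\<dots> = integral {-pi..pi} (\<lambda>x. h x * hat N j x)"
      by (rule integral_cong) (simp add: h_def algebra_simps)
    also have "\<dots> = (2 * U (grid N j) - U (grid N (j - 1)) - U (grid N (j + 1))) / (2 * pi / 2 ^ N)"
      by (rule integral_hat[OF N ph ch V(1) U(1)])
    finally show ?thesis
      unfolding first_variation_def dyadic_form_hat[OF u(1) N] diff_divide_distrib by linarith
  qed
  show ?thesis
  proof (rule that[OF N0 V(1)[unfolded h_def] V(2) U(1) even])
    fix N j assume N: "N \<ge> N0"
    then have "0 \<le> ((2 * u (grid N j) - u (grid N (j - 1)) - u (grid N (j + 1)))
       - (2 * U (grid N j) - U (grid N (j - 1)) - U (grid N (j + 1)))) / (2 * pi / 2 ^ N)"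
      using fv[of N j] low[OF N, of j] N0 by simp
    then show "2 * U (grid N j) - U (grid N (j - 1)) - U (grid N (j + 1))
        \<le> 2 * u (grid N j) - u (grid N (j - 1)) - u (grid N (j + 1))"
      by (subst (asm) pos_le_divide_eq) auto
  next
    fix N j assume N: "N \<ge> N0" and j: "grid N j \<in> {-pi..pi}" "\<bar>grid N j\<bar> + 2 * pi / 2 ^ N \<le> pi"
      "u (\<bar>grid N j\<bar> + 2 * pi / 2 ^ N) > 0"
    then have "0 = ((2 * u (grid N j) - u (grid N (j - 1)) - u (grid N (j + 1)))
       - (2 * U (grid N j) - U (grid N (j - 1)) - U (grid N (j + 1)))) / (2 * pi / 2 ^ N)"
      using fv[of N j] eq[OF N j] N0 by simp
    then show "2 * U (grid N j) - U (grid N (j - 1)) - U (grid N (j + 1))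
        = 2 * u (grid N j) - u (grid N (j - 1)) - u (grid N (j + 1))"
      by simp
  qed
qed

text \<open>The second differences of \<open>u - U\<close> vanish at nodes in the positivity region,
  so it is affine along the nodes of each fine grid there; evenness about the node 0 removes the
  slope, and density of the nodes finishes the argument.\<close>

lemma minimizer_eq_primitive_on_positivity:
  assumes min: "reduced_minimizer \<alpha> M u"
    and even: "\<And>x. U (- x) = U x" and cU: "continuous_on UNIV U" and N0: "N0 \<ge> 1"
    and eq: "\<And>N j. N \<ge> N0 \<Longrightarrow> grid N j \<in> {-pi..pi} \<Longrightarrow> \<bar>grid N j\<bar> + 2 * pi / 2 ^ N \<le> pi
      \<Longrightarrow> u (\<bar>grid N j\<bar> + 2 * pi / 2 ^ N) > 0 \<Longrightarrow> 2 * U (grid N j) - U (grid N (j - 1)) - U (grid N (j + 1))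
        = 2 * u (grid N j) - u (grid N (j - 1)) - u (grid N (j + 1))"
    and x: "0 \<le> x" "x \<le> pi" "u x > 0"
  shows "u x - U x = u 0 - U 0"
proof (cases "x = 0")
  case False
  note u = reduced_minimizerD[OF min]
  note dec = reduced_minimizer_decreasing[OF min] and ev = reduced_minimizer_even[OF min]
  define w where "w x = u x - U x" for x
  have wev: "w (- x) = w x" for x using ev even by (simp add: w_def)
  have const: "w (of_int (int k) * (2 * pi / 2 ^ N)) = w 0"
    if N: "N \<ge> N0" and k: "of_int (int k) * (2 * pi / 2 ^ N) \<le> pi" "u (of_int (int k) * (2 * pi / 2 ^ N)) > 0" for N k
  proof -
    define \<delta> where "\<delta> = 2 * pi / 2 ^ N"
    have \<delta>: "\<delta> > 0" by (simp add: \<delta>_def)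
    obtain n where n: "N = Suc n" using N N0 by (cases N) auto
    define c where "c = (2::int) ^ n"
    have g: "grid N (c + i) = of_int i * \<delta>" for i by (simp add: grid_def c_def n \<delta>_def field_simps)
    have second: "w (of_int (i + 1) * \<delta>) = 2 * w (of_int i * \<delta>) - w (of_int (i - 1) * \<delta>)"
      if i: "0 \<le> i" "of_int (i + 1) * \<delta> \<le> pi" "u (of_int (i + 1) * \<delta>) > 0" for i
    proof -
      have e: "\<bar>grid N (c + i)\<bar> + 2 * pi / 2 ^ N = of_int (i + 1) * \<delta>"
        using i \<delta> unfolding \<delta>_def[symmetric] by (simp add: g abs_mult algebra_simps)
      have g': "grid N (c + i - 1) = of_int (i - 1) * \<delta>" "grid N (c + i + 1) = of_int (i + 1) * \<delta>"
        using g[of "i - 1"] g[of "i + 1"] by (simp_all add: algebra_simps)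
      have r: "grid N (c + i) \<in> {-pi..pi}" using i \<delta> unfolding g
        by (auto simp: algebra_simps intro: order_trans[of _ 0])
      from eq[OF N r, unfolded e, OF i(2,3)] show ?thesis
        unfolding g g' w_def by argo
    qed
    \<comment> \<open>The value at the preceding node is carried along for the two-term recursion.
      For \<open>k = 0\<close> that node would be negative; the step from 0 to 1 uses evenness
      instead.\<close>
    have "w (of_int (int k) * \<delta>) = w 0 \<and> w ((of_int (int k) - 1) * \<delta>) = w (0 :: real)
      \<or> k = 0" if "of_int (int k) * \<delta> \<le> pi" "u (of_int (int k) * \<delta>) > 0" for k
      using that
    proof (induction k)
      case (Suc k)
      have le: "of_int (int k) * \<delta> \<le> of_int (int (Suc k)) * \<delta>" using \<delta> by (intro mult_right_mono) auto
      have p: "0 \<le> of_int (int k) * \<delta>" using \<delta> by simp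
      have uk: "u (of_int (int k) * \<delta>) > 0" using dec[OF p le Suc.prems(1)] Suc.prems(2) by linarith
      have s: "w (of_int (int (Suc k)) * \<delta>) = 2 * w (of_int (int k) * \<delta>) - w ((of_int (int k) - 1) * \<delta>)"
        using second[of "int k"] Suc.prems by (simp add: add.commute)
      show ?case
      proof (cases "k = 0")
        case True
        then show ?thesis using s wev[of \<delta>] by simp
      next
        case False
        then show ?thesis using Suc.IH[OF order_trans[OF le Suc.prems(1)] uk] s by simp
      qed
    qed simp
    from this[of k] k show ?thesis by (cases "k = 0") (auto simp: \<delta>_def)
  qed
  have xr: "x \<in> {-pi..pi}" using x by auto
  define k where "k N = \<lfloor>(x + pi) * 2 ^ N / (2 * pi)\<rfloor>" for N :: nat
  note ap = dyadic_approx[OF xr, folded k_def]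
  have "eventually (\<lambda>N. grid N (k N) > 0) sequentially"
    by (rule order_tendstoD(1)[OF ap(4)]) (use x False in auto)
  then have "eventually (\<lambda>N. w (grid N (k N)) = w 0) sequentially"
    using eventually_ge_at_top[of N0]
  proof eventually_elim
    case (elim N)
    obtain n where n: "N = Suc n" using elim N0 by (cases N) auto
    define i where "i = k N - 2 ^ n"
    have g: "grid N (k N) = of_int i * (2 * pi / 2 ^ N)" by (simp add: grid_def i_def n field_simps)
    then have "i > 0" using elim(1) by (simp add: zero_less_divide_iff zero_less_mult_iff)
    then have i: "i = int (nat i)" by simp
    have "u x \<le> u (grid N (k N))" using elim ap(3)[of N] x by (intro dec) auto
    then show ?case
      using const[OF elim(2), of "nat i"] ap(3)[of N] x unfolding i[symmetric] g[symmetric] by simp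
  qed
  then have "(\<lambda>N. w (grid N (k N))) \<longlonglongrightarrow> w 0" by (rule tendsto_eventually)
  moreover have "isCont w x"
    using u(2) cU unfolding w_def by (auto simp: continuous_on_eq_continuous_at intro!: continuous_intros)
  then have "(\<lambda>N. w (grid N (k N))) \<longlonglongrightarrow> w x" using ap(4) by (rule isCont_tendsto_compose)
  ultimately show ?thesis using LIMSEQ_unique by (auto simp: w_def)
qed simp

section \<open>Structure of minimizers\<close>

definition du0 :: "real \<Rightarrow> real \<Rightarrow> real" where
  "du0 \<alpha> x = (if \<alpha> = 1 then - (sin x + x * cos x) / 2 else - sin x / (1 - \<alpha>\<^sup>2))"

lemma DERIV_u0: "(u0 \<alpha> has_real_derivative du0 \<alpha> x) (at x)"
proof (cases "\<alpha> = 1")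
  case True
  have "((\<lambda>x. - (1 / 2) * x * sin x) has_real_derivative - (sin x + x * cos x) / 2) (at x)"
    by (auto intro!: derivative_eq_intros simp: field_simps)
  then show ?thesis using True by (simp add: u0_def[abs_def] du0_def)
next
  case False
  have "((\<lambda>x. 1 / (1 - \<alpha>\<^sup>2) * cos x) has_real_derivative - sin x / (1 - \<alpha>\<^sup>2)) (at x)"
    using DERIV_cmult[OF DERIV_cos, of "1 / (1 - \<alpha>\<^sup>2)" x] by simp
  then show ?thesis using False by (simp add: u0_def[abs_def] du0_def)
qed

lemma deriv_u0: "deriv (u0 \<alpha>) = du0 \<alpha>"
  using DERIV_u0 by (auto intro: DERIV_imp_deriv)

text \<open>\<open>u0\<close> is a particular solution of
  \<open>y'' + \<alpha>^2 * y = - cos\<close>. For \<open>\<alpha> = 1\<close> the forcing is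
  resonant, which is the origin of the factor \<open>x\<close> in \<open>u0\<close>.\<close>

lemma DERIV_du0:
  assumes "\<alpha> > 0"
  shows "(du0 \<alpha> has_real_derivative - cos x - \<alpha>\<^sup>2 * u0 \<alpha> x) (at x)"
proof (cases "\<alpha> = 1")
  case True
  have "((\<lambda>x. - (sin x + x * cos x) / 2) has_real_derivative - cos x - (- (1 / 2) * x * sin x)) (at x)"
    by (auto intro!: derivative_eq_intros simp: field_simps)
  then show ?thesis using True by (simp add: u0_def du0_def[abs_def])
next
  case False
  then have "1 - \<alpha>\<^sup>2 \<noteq> 0" using assms by (simp add: power2_eq_1_iff)
  moreover have "((\<lambda>x. - sin x / (1 - \<alpha>\<^sup>2)) has_real_derivative - cos x / (1 - \<alpha>\<^sup>2)) (at x)"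
    by (rule DERIV_cdivide[OF DERIV_minus[OF DERIV_sin]])
  ultimately show ?thesis using False by (simp add: u0_def du0_def[abs_def] field_simps)
qed

lemma du0_0: "du0 \<alpha> 0 = 0" and u0_even: "u0 \<alpha> (- x) = u0 \<alpha> x"
  by (auto simp: du0_def u0_def)

text \<open>\<open>P\<close> and \<open>Q\<close> are the coordinates of the pair of
  \<open>y\<close> and \<open>y' / \<alpha>\<close> in a frame rotating with frequency
  \<open>\<alpha>\<close>, and both are constant. The equation is assumed only in the open interval
  because it is known only where the minimizer is positive.\<close>

lemma harmonic_oscillator:
  fixes y y' :: "real \<Rightarrow> real"
  assumes \<alpha>: "\<alpha> > 0" and T: "0 < T"
    and y: "\<And>x. (y has_real_derivative y' x) (at x)" and cy': "continuous_on {0..T} y'"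
    and y': "\<And>x. 0 < x \<Longrightarrow> x < T \<Longrightarrow> (y' has_real_derivative - \<alpha>\<^sup>2 * y x) (at x)"
    and init: "y' 0 = 0" and x: "0 \<le> x" "x \<le> T"
  shows "y x = y 0 * cos (\<alpha> * x)" "y' x = - \<alpha> * y 0 * sin (\<alpha> * x)"
proof -
  have cy: "continuous_on {0..T} y"
    by (rule DERIV_continuous_on) (rule has_field_derivative_at_within[OF y])
  define z where "z x = y' x / \<alpha>" for x
  define P where "P x = y x * cos (\<alpha> * x) - z x * sin (\<alpha> * x)" for x
  define Q where "Q x = y x * sin (\<alpha> * x) + z x * cos (\<alpha> * x)" for x
  have cz: "continuous_on {0..T} z" unfolding z_def using \<alpha> by (intro continuous_intros cy') auto
  have dy: "(y has_real_derivative \<alpha> * z x) (at x)" for x using y[of x] \<alpha> by (simp add: z_def)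
  have dz: "(z has_real_derivative - \<alpha> * y x) (at x)" if "0 < x" "x < T" for x
    using DERIV_cdivide[OF y'[OF that], of \<alpha>] \<alpha> by (simp add: z_def[abs_def] power2_eq_square)
  have "P x = P 0"
  proof (rule DERIV_isconst2[OF T _ _ x])
    show "continuous_on {0..T} P" unfolding P_def by (intro continuous_intros cy cz)
    show "(P has_real_derivative 0) (at x)" if "0 < x" "x < T" for x
      unfolding P_def by (auto intro!: derivative_eq_intros dy dz[OF that] simp: algebra_simps)
  qed
  moreover have "Q x = Q 0"
  proof (rule DERIV_isconst2[OF T _ _ x])
    show "continuous_on {0..T} Q" unfolding Q_def by (intro continuous_intros cy cz)
    show "(Q has_real_derivative 0) (at x)" if "0 < x" "x < T" for x
      unfolding Q_def by (auto intro!: derivative_eq_intros dy dz[OF that] simp: algebra_simps)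
  qed
  ultimately have PQ: "P x = y 0" "Q x = 0" using init by (simp_all add: P_def Q_def z_def)
  have sc: "cos (\<alpha> * x) * cos (\<alpha> * x) + sin (\<alpha> * x) * sin (\<alpha> * x) = 1"
    using sin_cos_squared_add2[of "\<alpha> * x"] by (simp add: power2_eq_square)
  have "P x * cos (\<alpha> * x) + Q x * sin (\<alpha> * x)
      = y x * (cos (\<alpha> * x) * cos (\<alpha> * x) + sin (\<alpha> * x) * sin (\<alpha> * x))"
    unfolding P_def Q_def by algebra
  then show "y x = y 0 * cos (\<alpha> * x)" using PQ unfolding sc by simp
  have "Q x * cos (\<alpha> * x) - P x * sin (\<alpha> * x)
      = z x * (cos (\<alpha> * x) * cos (\<alpha> * x) + sin (\<alpha> * x) * sin (\<alpha> * x))"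
    unfolding P_def Q_def by algebra
  then have "z x = - (y 0 * sin (\<alpha> * x))" using PQ unfolding sc by simp
  then show "y' x = - \<alpha> * y 0 * sin (\<alpha> * x)" using \<alpha> by (simp add: z_def field_simps)
qed

text \<open>\<open>T\<close> is the supremum of the positivity set in \<open>[0, pi]\<close>. If
  \<open>T = pi\<close>, the value at pi is left open: it later separates a droplet that just closes
  up at pi from full support.\<close>

lemma positivity_radius:
  assumes min: "reduced_minimizer \<alpha> M u" and M: "M > 0"
  obtains T where "0 < T" "T \<le> pi" "\<And>x. 0 \<le> x \<Longrightarrow> x < T \<Longrightarrow> u x > 0"
    "\<And>x. T < pi \<Longrightarrow> T \<le> x \<Longrightarrow> x \<le> pi \<Longrightarrow> u x = 0"
proof -
  note u = reduced_minimizerD[OF min]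
  note dec = reduced_minimizer_decreasing[OF min]
  define S where "S = {x \<in> {0..pi}. u x > 0}"
  have u0: "u 0 > 0" by (rule reduced_minimizer_pos_0[OF min M])
  have S: "0 \<in> S" "bdd_above S" using u0 by (auto simp: S_def)
  define T where "T = Sup S"
  have open_S: "\<exists>y\<in>S. x < y" if x: "0 \<le> x" "x < pi" "u x > 0" for x
  proof -
    have "(u \<longlongrightarrow> u x) (at_right x)"
      using u(2) by (simp add: continuous_on_eq_continuous_at isCont_def filterlim_at_split)
    then have "eventually (\<lambda>y. u y > 0) (at_right x)" using x(3) by (rule order_tendstoD)
    moreover have "eventually (\<lambda>y. y \<in> {x<..<pi}) (at_right x)"
      using x by (intro eventually_at_right_real) auto
    ultimately have "eventually (\<lambda>y. u y > 0 \<and> y \<in> {x<..<pi}) (at_right x)" by eventually_elim auto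
    then obtain y where "u y > 0" "y \<in> {x<..<pi}"
      using eventually_happens trivial_limit_at_right_real by blast
    then show ?thesis using x by (intro bexI[of _ y]) (auto simp: S_def)
  qed
  have le: "y \<le> T" if "y \<in> S" for y unfolding T_def using that S(2) by (rule cSup_upper)
  have "0 < T" using open_S[of 0] u0 le by fastforce
  moreover have "T \<le> pi" unfolding T_def using S(1) by (intro cSup_least) (blast, simp add: S_def)
  moreover have "u x > 0" if x: "0 \<le> x" "x < T" for x
  proof -
    obtain y where "y \<in> S" "x < y" using less_cSup_iff[of S x] S x unfolding T_def by blast
    then show ?thesis using dec[of x y] x by (auto simp: S_def)
  qed
  moreover have "u x = 0" if x: "T < pi" "T \<le> x" "x \<le> pi" for x
  proof (rule ccontr)
    assume "u x \<noteq> 0"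
    then have "u x > 0" using u(4)[of x] by simp
    then have "u T > 0" using dec[of T x] x \<open>0 < T\<close> by simp
    then obtain y where "y \<in> S" "T < y" using open_S[of T] \<open>0 < T\<close> x by auto
    then show False using le by fastforce
  qed
  ultimately show ?thesis using that by blast
qed

lemma periodic_continuous_bounded:
  assumes "periodic_2pi h" "continuous_on UNIV h"
  obtains C where "C > 0" "\<And>x. \<bar>h x\<bar> \<le> (C :: real)"
proof -
  have "bounded (h ` {-pi..pi})"
    using assms(2) by (intro compact_imp_bounded compact_continuous_image) (auto intro: continuous_on_subset)
  then obtain C where C: "C > 0" "\<And>x. x \<in> {-pi..pi} \<Longrightarrow> \<bar>h x\<bar> \<le> C" by (auto simp: bounded_pos)
  have "\<bar>h x\<bar> \<le> C" for x
    using C(2)[of "wrap x"] wrap_range[of x] periodic_2pi_wrap[OF assms(1)] by simp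
  then show ?thesis using that C(1) by blast
qed

lemma second_difference_bound:
  fixes U V :: "real \<Rightarrow> real"
  assumes U: "\<And>x. (U has_real_derivative V x) (at x)" and V: "\<And>x y. \<bar>V x - V y\<bar> \<le> C * \<bar>x - y\<bar>"
    and "d > 0"
  shows "- (2 * C * d\<^sup>2) \<le> 2 * U x - U (x - d) - U (x + d)"
proof -
  obtain a where a: "x - d < a" "a < x" "U x - U (x - d) = (x - (x - d)) * V a"
    using MVT2[of "x - d" x U V] U \<open>d > 0\<close> by auto
  obtain b where b: "x < b" "b < x + d" "U (x + d) - U x = (x + d - x) * V b"
    using MVT2[of x "x + d" U V] U \<open>d > 0\<close> by auto
  have C: "C \<ge> 0" using V[of 0 1] by simp
  have "V b - V a \<le> C * \<bar>b - a\<bar>" using V[of b a] by linarith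
  also have "\<dots> \<le> C * (2 * d)" using a b C by (intro mult_left_mono) auto
  finally have "d * (V b - V a) \<le> d * (C * (2 * d))" using \<open>d > 0\<close> by (intro mult_left_mono) auto
  moreover have "2 * U x - U (x - d) - U (x + d) = - (d * (V b - V a))"
    using a b by (simp add: algebra_simps)
  ultimately show ?thesis by (simp add: power2_eq_square algebra_simps)
qed

text \<open>Near the edge of the support \<open>u\<close> is bounded by a multiple of the squared grid width: the
  one-sided Euler-Lagrange inequality makes \<open>u\<close> semiconcave, while \<open>u\<close> vanishes beyond the edge,
  or is symmetric about it when the edge is \<open>\<pi>\<close>. Hence the slope at the edge is zero.\<close>

lemma minimizer_slope_zero:
  assumes min: "reduced_minimizer \<alpha> M u" and N0: "N0 \<ge> 1"
    and U: "\<And>x. (U has_real_derivative V x) (at x)" and V: "\<And>x y. \<bar>V x - V y\<bar> \<le> C * \<bar>x - y\<bar>"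
    and ineq: "\<And>N j. N \<ge> N0 \<Longrightarrow> 2 * U (grid N j) - U (grid N (j - 1)) - U (grid N (j + 1))
        \<le> 2 * u (grid N j) - u (grid N (j - 1)) - u (grid N (j + 1))"
    and T: "0 < T" "T \<le> pi" "\<And>x. T < pi \<Longrightarrow> T \<le> x \<Longrightarrow> x \<le> pi \<Longrightarrow> u x = 0"
    and eq: "\<And>x. 0 \<le> x \<Longrightarrow> x \<le> T \<Longrightarrow> u x = U x + k"
  shows "V T = 0"
proof -
  note u = reduced_minimizerD[OF min]
  note dec = reduced_minimizer_decreasing[OF min] and ev = reduced_minimizer_even[OF min]
  have C: "C \<ge> 0" using V[of 0 1] by simp
  have sec: "- (2 * C * (2 * pi / 2 ^ N)\<^sup>2) \<le> 2 * u (grid N j) - u (grid N j - 2 * pi / 2 ^ N) - u (grid N j + 2 * pi / 2 ^ N)"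
    if "N \<ge> N0" for N j
  proof -
    have "grid N (j - 1) = grid N j - 2 * pi / 2 ^ N" using grid_step[of N "j - 1"] by simp
    then show ?thesis
      using ineq[OF that, of j] grid_step[of N j]
        second_difference_bound[OF U V, of "2 * pi / 2 ^ N" "grid N j"] by simp
  qed
  have step: "\<bar>V T\<bar> \<le> 8 * C * (2 * pi / 2 ^ N)"
    if N: "N \<ge> N0" "3 * (2 * pi / 2 ^ N) \<le> T" "T < pi \<Longrightarrow> 3 * (2 * pi / 2 ^ N) \<le> pi - T" for N
  proof -
    define d where "d = 2 * pi / 2 ^ N"
    have d: "d > 0" by (simp add: d_def)
    \<comment> \<open>A comparison point one to two grid widths inside the edge, at which
      \<open>u\<close> exceeds its edge value only by a multiple of \<open>d^2\<close>.\<close>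
    obtain g where g: "d \<le> T - g" "T - g \<le> 2 * d" "u g - u T \<le> 6 * C * d\<^sup>2"
    proof (cases "T < pi")
      case True
      have Tr: "T \<in> {-pi..pi}" using T by auto
      define j where "j = \<lfloor>(T + pi) * 2 ^ N / (2 * pi)\<rfloor>"
      define g where "g = grid N j"
      have "g \<le> T" unfolding g_def j_def by (rule dyadic_approx(3)[OF Tr])
      have "(T + pi) * 2 ^ N / (2 * pi) < of_int j + 1" unfolding j_def by linarith
      then have "(T + pi) * 2 ^ N < (of_int j + 1) * (2 * pi)"
        by (simp only: pos_divide_less_eq pi_gt_zero mult_pos_pos zero_less_numeral)
      then have "T + pi < (of_int j + 1) * (2 * pi) / 2 ^ N"
        by (simp only: pos_less_divide_eq zero_less_power zero_less_numeral)
      \<comment> \<open>\<open>g\<close> is the last node up to the edge, so \<open>u\<close>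
        vanishes at the next two nodes. The inequality at \<open>g + d\<close> bounds
        \<open>u g\<close> by \<open>2 * C * d^2\<close>, and then the one at \<open>g\<close>
        bounds \<open>u (g - d)\<close> by \<open>6 * C * d^2\<close>.\<close>
      then have "T < g + d" by (simp add: g_def grid_def d_def add_divide_distrib algebra_simps)
      have z: "u (g + d) = 0" "u (g + 2 * d) = 0" "u T = 0"
        using N(3)[OF True, folded d_def] \<open>g \<le> T\<close> \<open>T < g + d\<close> d True by (auto intro!: T(3))
      have g1: "grid N (j + 1) = g + d" by (simp add: g_def d_def grid_step)
      have 1: "u g \<le> 2 * C * d\<^sup>2"
        using sec[OF N(1), of "j + 1", folded d_def] z unfolding g1 by (simp add: algebra_simps)
      have 2: "u (g - d) \<le> 2 * u g + 2 * C * d\<^sup>2"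
        using sec[OF N(1), of j, folded d_def g_def] z by simp
      show ?thesis
        by (rule that[of "g - d"]) (use \<open>g \<le> T\<close> \<open>T < g + d\<close> z 1 2 in auto)
    next
      case False
      then have Tpi: "T = pi" using T by simp
      have "u (pi + d) = u (- pi - d)" using ev[of "pi + d"] by simp
      also have "\<dots> = u (- pi - d + 2 * pi)"
        using u(1)[unfolded periodic_2pi_def, rule_format, of "- pi - d"] by simp
      finally have "u (pi + d) = u (pi - d)" by (simp add: algebra_simps)
      then have "u (pi - d) - u pi \<le> C * d\<^sup>2"
        using sec[OF N(1), of "2 ^ N", folded d_def] by (simp add: grid_2_power)
      also have "\<dots> \<le> 6 * C * d\<^sup>2" using C by simp
      finally show ?thesis by (intro that[of "pi - d"]) (use Tpi d in auto)
    qed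
    have g0: "0 \<le> g" using g N(2)[folded d_def] d by linarith
    have "g < T" using g d by linarith
    \<comment> \<open>The slope at some point between is at most \<open>6 * C * d\<close> in
      absolute value, and \<open>V\<close> changes by at most \<open>2 * C * d\<close> from there to
      the edge; hence the constant 8.\<close>
    then obtain \<xi> where \<xi>: "g < \<xi>" "\<xi> < T" "U T - U g = (T - g) * V \<xi>"
      using MVT2[of g T U V] U by auto
    have ug: "u g - u T = (T - g) * (- V \<xi>)" using eq[of g] eq[of T] \<xi> g0 T by (simp add: algebra_simps)
    moreover have "0 \<le> u g - u T" using dec[of g T] g0 \<xi> T by simp
    ultimately have V0: "0 \<le> - V \<xi>" using \<open>g < T\<close> by (simp add: zero_le_mult_iff mult_le_0_iff)
    have "d * (- V \<xi>) \<le> (T - g) * (- V \<xi>)" using g V0 by (intro mult_right_mono) auto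
    also have "\<dots> \<le> d * (6 * C * d)" using g ug by (simp add: power2_eq_square algebra_simps)
    finally have "- V \<xi> \<le> 6 * C * d" using d by (simp only: mult_le_cancel_left_pos)
    moreover have "\<bar>V T - V \<xi>\<bar> \<le> C * (2 * d)"
    proof -
      have "C * \<bar>T - \<xi>\<bar> \<le> C * (2 * d)" using \<xi> g C by (intro mult_left_mono) auto
      then show ?thesis using V[of T \<xi>] by linarith
    qed
    ultimately show ?thesis using V0 unfolding d_def[symmetric] by (simp add: abs_if split: if_splits)
  qed
  have lim: "(\<lambda>N. 2 * pi / 2 ^ N) \<longlonglongrightarrow> 0" by (rule LIMSEQ_divide_realpow_zero) simp
  have lim3: "(\<lambda>N. 3 * (2 * pi / 2 ^ N)) \<longlonglongrightarrow> 3 * 0" by (intro tendsto_intros lim)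
  have "eventually (\<lambda>N. 3 * (2 * pi / 2 ^ N) < (if T < pi then min T (pi - T) else T)) sequentially"
    by (rule order_tendstoD(2)[OF lim3]) (use T in auto)
  then have "eventually (\<lambda>N. \<bar>V T\<bar> \<le> 8 * C * (2 * pi / 2 ^ N)) sequentially"
    using eventually_ge_at_top[of N0]
  proof eventually_elim
    case (elim N)
    show ?case by (rule step) (use elim in \<open>auto split: if_splits\<close>)
  qed
  moreover have "(\<lambda>N. 8 * C * (2 * pi / 2 ^ N)) \<longlonglongrightarrow> 8 * C * 0" by (intro tendsto_intros lim)
  ultimately have "\<bar>V T\<bar> \<le> 8 * C * 0" by (intro tendsto_lowerbound) auto
  then show ?thesis by simp
qed

text \<open>On its support \<open>u\<close> equals \<open>U + k\<close>; without the particular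
  solution \<open>u0\<close> and the constant \<open>- lam / \<alpha>^2\<close> it solves the
  homogeneous oscillator equation with zero slope at 0. The zero slope at the edge becomes the
  condition linking \<open>A\<close> and \<open>T\<close>.\<close>

lemma reduced_minimizer_structure:
  assumes \<alpha>: "\<alpha> > 0" and min: "reduced_minimizer \<alpha> M u" and M: "M > 0"
  obtains T A c where "0 < T" "T \<le> pi" "\<And>x. \<bar>x\<bar> \<le> T \<Longrightarrow> u x = u0 \<alpha> x + A * cos (\<alpha> * x) + c"
    "\<And>x. \<bar>x\<bar> < T \<Longrightarrow> u x > 0" "\<And>x. T < pi \<Longrightarrow> T \<le> \<bar>x\<bar> \<Longrightarrow> \<bar>x\<bar> \<le> pi \<Longrightarrow> u x = 0"
    "du0 \<alpha> T = A * \<alpha> * sin (\<alpha> * T)"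
proof -
  note u = reduced_minimizerD[OF min]
  note dec = reduced_minimizer_decreasing[OF min] and ev = reduced_minimizer_even[OF min]
  have abs: "u x = u \<bar>x\<bar>" for x using ev[of x] by (cases "x \<ge> 0") auto
  obtain N0 lam U V where N0: "N0 \<ge> 1"
    and V: "\<And>x. (V has_real_derivative - (\<alpha>\<^sup>2 * u x + cos x + lam)) (at x)" "V 0 = 0"
    and U: "\<And>x. (U has_real_derivative V x) (at x)" "\<And>x. U (- x) = U x"
    and low: "\<And>N j. N \<ge> N0 \<Longrightarrow> 2 * U (grid N j) - U (grid N (j - 1)) - U (grid N (j + 1))
        \<le> 2 * u (grid N j) - u (grid N (j - 1)) - u (grid N (j + 1))"
    and eq: "\<And>N j. N \<ge> N0 \<Longrightarrow> grid N j \<in> {-pi..pi} \<Longrightarrow> \<bar>grid N j\<bar> + 2 * pi / 2 ^ N \<le> pi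
      \<Longrightarrow> u (\<bar>grid N j\<bar> + 2 * pi / 2 ^ N) > 0 \<Longrightarrow> 2 * U (grid N j) - U (grid N (j - 1)) - U (grid N (j + 1))
        = 2 * u (grid N j) - u (grid N (j - 1)) - u (grid N (j + 1))"
    by (rule euler_lagrange_dyadic[OF min M], rule that)
  have cU: "continuous_on UNIV U" using U(1) by (intro DERIV_continuous_on) auto
  have cV: "continuous_on UNIV V" using V(1) by (intro DERIV_continuous_on) auto
  obtain T where T: "0 < T" "T \<le> pi" and pos: "\<And>x. 0 \<le> x \<Longrightarrow> x < T \<Longrightarrow> u x > 0"
    and zero: "\<And>x. T < pi \<Longrightarrow> T \<le> x \<Longrightarrow> x \<le> pi \<Longrightarrow> u x = 0"
    using positivity_radius[OF min M] by blast
  define k where "k = u 0 - U 0"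
  have in_lt: "u x = U x + k" if "0 \<le> x" "x < T" for x
    using minimizer_eq_primitive_on_positivity[OF min U(2) cU N0 eq that(1) _ pos[OF that]] that T
    by (simp add: k_def)
  have in_T: "u T = U T + k"
  proof -
    have c: "((\<lambda>x. u x - U x) \<longlongrightarrow> u T - U T) (at_left T)"
      using u(2) cU by (intro tendsto_intros)
        (simp_all add: continuous_on_eq_continuous_at isCont_def filterlim_at_split)
    have "eventually (\<lambda>x. x \<in> {0<..<T}) (at_left T)" using T by (intro eventually_at_left_real) auto
    then have "eventually (\<lambda>x. u x - U x = k) (at_left T)" by (elim eventually_mono) (auto simp: in_lt)
    then have "((\<lambda>x. u x - U x) \<longlongrightarrow> k) (at_left T)" by (rule tendsto_eventually)
    then have "u T - U T = k" using tendsto_unique[OF trivial_limit_at_left_real c] by blast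
    then show ?thesis by simp
  qed
  have inside: "u x = U x + k" if "0 \<le> x" "x \<le> T" for x
    using in_lt[of x] in_T that by (cases "x = T") auto
  obtain C where C: "C > 0" "\<And>x. \<bar>\<alpha>\<^sup>2 * u x + cos x + lam\<bar> \<le> C"
    by (rule periodic_continuous_bounded[of "\<lambda>x. \<alpha>\<^sup>2 * u x + cos x + lam"])
      (use u(1) in \<open>auto simp: periodic_2pi_def intro!: continuous_intros u(2)\<close>)
  have LV: "\<bar>V x - V y\<bar> \<le> C * \<bar>x - y\<bar>" for x y
  proof -
    have "norm (V x - V y) \<le> C * norm (x - y)"
    proof (rule field_differentiable_bound[of UNIV V "\<lambda>x. - (\<alpha>\<^sup>2 * u x + cos x + lam)"])
      show "norm (- (\<alpha>\<^sup>2 * u z + cos z + lam)) \<le> C" for z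
        using C(2)[of z] by (simp only: real_norm_def abs_minus_cancel)
    qed (use V(1) in \<open>auto simp del: minus_add_distrib\<close>)
    then show ?thesis by simp
  qed
  have VT: "V T = 0"
    by (rule minimizer_slope_zero[OF min N0 U(1) LV low T zero inside])
  \<comment> \<open>\<open>U + k\<close> stands in for \<open>u\<close> because it is differentiable
    everywhere, also at the edge.\<close>
  define y where "y x = U x + k - u0 \<alpha> x + lam / \<alpha>\<^sup>2" for x
  define y' where "y' x = V x - du0 \<alpha> x" for x
  have dy: "(y has_real_derivative y' x) (at x)" for x
    unfolding y_def y'_def by (auto intro!: derivative_eq_intros U(1) DERIV_u0)
  have cy': "continuous_on {0..T} y'"
    unfolding y'_def by (intro continuous_intros continuous_on_subset[OF cV]
      DERIV_continuous_on[OF has_field_derivative_at_within[OF DERIV_du0[OF \<alpha>]]]) auto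
  have dy': "(y' has_real_derivative - \<alpha>\<^sup>2 * y x) (at x)" if "0 < x" "x < T" for x
    unfolding y'_def using inside[of x] that \<alpha>
    by (auto intro!: derivative_eq_intros V(1) DERIV_du0[OF \<alpha>] simp: y_def field_simps)
  have y0: "y' 0 = 0" by (simp add: y'_def V(2) du0_0)
  note ho = harmonic_oscillator[OF \<alpha> T(1) dy cy' dy' y0]
  show ?thesis
  proof (rule that[of T "y 0" "- lam / \<alpha>\<^sup>2"])
    fix x assume x: "\<bar>x\<bar> \<le> T"
    have "cos (\<alpha> * \<bar>x\<bar>) = cos (\<alpha> * x)" "u0 \<alpha> \<bar>x\<bar> = u0 \<alpha> x"
      using u0_even[of \<alpha> x] by (auto simp: abs_if)
    then show "u x = u0 \<alpha> x + y 0 * cos (\<alpha> * x) + - lam / \<alpha>\<^sup>2"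
      using ho(1)[of "\<bar>x\<bar>"] inside[of "\<bar>x\<bar>"] abs[of x] x by (simp add: y_def)
  next
    show "u x > 0" if "\<bar>x\<bar> < T" for x using pos[of "\<bar>x\<bar>"] abs[of x] that by simp
    show "u x = 0" if "T < pi" "T \<le> \<bar>x\<bar>" "\<bar>x\<bar> \<le> pi" for x
      using zero[of "\<bar>x\<bar>"] abs[of x] that by simp
    show "du0 \<alpha> T = y 0 * \<alpha> * sin (\<alpha> * T)"
      using ho(2)[of T] T VT by (simp add: y'_def)
  qed (use T in auto)
qed

section \<open>The family of droplets\<close>

text \<open>The numerator of the derivative of \<open>coeff_A\<close>; its own derivative is
  \<open>sin t * sin (\<alpha> * t)\<close> because \<open>u0'' + \<alpha>\<^sup>2 u0 = - cos\<close>.\<close>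

definition wronskian :: "real \<Rightarrow> real \<Rightarrow> real" where
  "wronskian \<alpha> t = (- cos t - \<alpha>\<^sup>2 * u0 \<alpha> t) * sin (\<alpha> * t) - \<alpha> * du0 \<alpha> t * cos (\<alpha> * t)"

definition u0_primitive :: "real \<Rightarrow> real \<Rightarrow> real" where
  "u0_primitive \<alpha> t = (if \<alpha> = 1 then (t * cos t - sin t) / 2 else 1 / (1 - \<alpha>\<^sup>2) * sin t)"

text \<open>Closed form of the integral of \<open>droplet \<alpha> t\<close> over
  \<open>[-t, t]\<close>.\<close>

definition droplet_mass :: "real \<Rightarrow> real \<Rightarrow> real" where
  "droplet_mass \<alpha> t = 2 * (u0_primitive \<alpha> t + coeff_A \<alpha> t * sin (\<alpha> * t) / \<alpha> - t * u0 \<alpha> t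
     - t * coeff_A \<alpha> t * cos (\<alpha> * t))"

text \<open>\<open>coeff_A\<close> is chosen to make the slope vanish at \<open>t\<close>, the
  constant to make the value vanish there.\<close>

definition droplet :: "real \<Rightarrow> real \<Rightarrow> real \<Rightarrow> real" where
  "droplet \<alpha> t x = u0 \<alpha> x + coeff_A \<alpha> t * cos (\<alpha> * x) - u0 \<alpha> t - coeff_A \<alpha> t * cos (\<alpha> * t)"

lemma DERIV_u0_primitive: "(u0_primitive \<alpha> has_real_derivative u0 \<alpha> t) (at t)"
proof (cases "\<alpha> = 1")
  case True
  have "((\<lambda>t. (t * cos t - sin t) / 2) has_real_derivative - (1 / 2) * t * sin t) (at t)"
    by (auto intro!: derivative_eq_intros)
  then show ?thesis using True by (simp add: u0_primitive_def[abs_def] u0_def)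
next
  case False
  then show ?thesis
    using DERIV_cmult[OF DERIV_sin, of "1 / (1 - \<alpha>\<^sup>2)" t] by (simp add: u0_primitive_def[abs_def] u0_def)
qed

lemma u0_primitive_odd: "u0_primitive \<alpha> (- t) = - u0_primitive \<alpha> t"
proof -
  have "(- t * cos (- t) - sin (- t)) / 2 = - ((t * cos t - sin t) / 2)"
    by (simp add: diff_divide_distrib)
  then show ?thesis by (simp add: u0_primitive_def)
qed

lemma coeff_A_alt: "coeff_A \<alpha> t = du0 \<alpha> t / (\<alpha> * sin (\<alpha> * t))"
  by (simp add: coeff_A_def deriv_u0)

lemma DERIV_droplet: "(droplet \<alpha> t has_real_derivative du0 \<alpha> x - coeff_A \<alpha> t * \<alpha> * sin (\<alpha> * x)) (at x)"
  unfolding droplet_def[abs_def] by (auto intro!: derivative_eq_intros DERIV_u0)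

lemma droplet_edge: "droplet \<alpha> t t = 0" and droplet_even: "droplet \<alpha> t (- x) = droplet \<alpha> t x"
  by (simp_all add: droplet_def u0_even)

text \<open>At \<open>s = \<alpha> * t\<close> this is, up to a positive factor, the mass gained per
  unit growth of \<open>coeff_A\<close>. Its own derivative is \<open>s * sin s\<close>.\<close>

lemma sin_minus_mult_cos_pos:
  assumes "0 < s" "s \<le> pi"
  shows "sin s - s * cos s > 0"
proof -
  have "(\<lambda>s. sin s - s * cos s) 0 < (\<lambda>s. sin s - s * cos s) s"
  proof (rule DERIV_pos_imp_increasing_open[OF assms(1)])
    fix x assume x: "0 < x" "x < s"
    have "((\<lambda>s. sin s - s * cos s) has_real_derivative x * sin x) (at x)"
      by (auto intro!: derivative_eq_intros)
    moreover have "0 < x * sin x" using x assms by (intro mult_pos_pos sin_gt_zero) auto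
    ultimately show "\<exists>y. ((\<lambda>s. sin s - s * cos s) has_real_derivative y) (at x) \<and> 0 < y" by blast
  qed (intro continuous_intros)
  then show ?thesis by simp
qed

context
  fixes \<alpha> :: real
  assumes \<alpha>: "\<alpha> > 0"
begin

lemma DERIV_wronskian: "(wronskian \<alpha> has_real_derivative sin t * sin (\<alpha> * t)) (at t)"
  unfolding wronskian_def[abs_def]
  by (auto intro!: derivative_eq_intros DERIV_u0 DERIV_du0[OF \<alpha>] simp: algebra_simps power2_eq_square)

text \<open>The end point \<open>\<alpha> * t = pi\<close> is included because it is there that too
  large supports are excluded.\<close>

lemma wronskian_pos:
  assumes "0 < t" "t \<le> pi" "\<alpha> * t \<le> pi"
  shows "wronskian \<alpha> t > 0"
proof -
  have "wronskian \<alpha> 0 < wronskian \<alpha> t"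
  proof (rule DERIV_pos_imp_increasing_open[OF assms(1)])
    fix x assume x: "0 < x" "x < t"
    have "\<alpha> * x < \<alpha> * t" using x \<alpha> by simp
    then have "\<alpha> * x < pi" using assms by linarith
    then have "0 < sin x * sin (\<alpha> * x)" using x \<alpha> assms by (intro mult_pos_pos sin_gt_zero) auto
    then show "\<exists>y. (wronskian \<alpha> has_real_derivative y) (at x) \<and> 0 < y" using DERIV_wronskian by blast
  next
    show "continuous_on {0..t} (wronskian \<alpha>)"
      by (rule DERIV_continuous_on) (rule has_field_derivative_at_within[OF DERIV_wronskian])
  qed
  then show ?thesis by (simp add: wronskian_def du0_0)
qed

lemma DERIV_coeff_A:
  assumes "sin (\<alpha> * t) \<noteq> 0"
  shows "(coeff_A \<alpha> has_real_derivative wronskian \<alpha> t / (\<alpha> * (sin (\<alpha> * t))\<^sup>2)) (at t)"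
proof -
  have "((\<lambda>t. du0 \<alpha> t / (\<alpha> * sin (\<alpha> * t))) has_real_derivative
      ((- cos t - \<alpha>\<^sup>2 * u0 \<alpha> t) * (\<alpha> * sin (\<alpha> * t)) - du0 \<alpha> t * (\<alpha> * (cos (\<alpha> * t) * \<alpha>)))
        / ((\<alpha> * sin (\<alpha> * t)) * (\<alpha> * sin (\<alpha> * t)))) (at t)"
    using assms \<alpha> by (auto intro!: derivative_eq_intros DERIV_du0[OF \<alpha>])
  also have "((- cos t - \<alpha>\<^sup>2 * u0 \<alpha> t) * (\<alpha> * sin (\<alpha> * t)) - du0 \<alpha> t * (\<alpha> * (cos (\<alpha> * t) * \<alpha>)))
        / ((\<alpha> * sin (\<alpha> * t)) * (\<alpha> * sin (\<alpha> * t))) = \<alpha> * wronskian \<alpha> t / (\<alpha> * (\<alpha> * (sin (\<alpha> * t))\<^sup>2))"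
    by (rule arg_cong2[of _ _ _ _ "(/)"]) (simp_all add: wronskian_def algebra_simps power2_eq_square)
  also have "\<dots> = wronskian \<alpha> t / (\<alpha> * (sin (\<alpha> * t))\<^sup>2)" using \<alpha> by simp
  finally show ?thesis by (simp add: coeff_A_alt[abs_def])
qed

text \<open>By the choice of \<open>coeff_A\<close> the terms with \<open>du0\<close> cancel, and
  the whole derivative comes from the growth of \<open>coeff_A\<close>: it is \<open>2 * D\<close>
  times the integral of \<open>cos (\<alpha> * x) - cos (\<alpha> * t)\<close> over
  \<open>[0, t]\<close>.\<close>

lemma DERIV_droplet_mass:
  assumes "sin (\<alpha> * t) \<noteq> 0"
  shows "(droplet_mass \<alpha> has_real_derivative
    2 * (wronskian \<alpha> t / (\<alpha> * (sin (\<alpha> * t))\<^sup>2)) * (sin (\<alpha> * t) - \<alpha> * t * cos (\<alpha> * t)) / \<alpha>) (at t)"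
proof -
  define D where "D = wronskian \<alpha> t / (\<alpha> * (sin (\<alpha> * t))\<^sup>2)"
  have p: "du0 \<alpha> t = coeff_A \<alpha> t * (\<alpha> * sin (\<alpha> * t))" using assms \<alpha> by (simp add: coeff_A_alt)
  have dA: "(coeff_A \<alpha> has_real_derivative D) (at t)" using DERIV_coeff_A[OF assms] by (simp add: D_def)
  have "(droplet_mass \<alpha> has_real_derivative
      2 * (u0 \<alpha> t + (D * sin (\<alpha> * t) + coeff_A \<alpha> t * (cos (\<alpha> * t) * \<alpha>)) / \<alpha> - (u0 \<alpha> t + t * du0 \<alpha> t)
       - ((coeff_A \<alpha> t + t * D) * cos (\<alpha> * t) + t * coeff_A \<alpha> t * (- sin (\<alpha> * t) * \<alpha>)))) (at t)"
    unfolding droplet_mass_def[abs_def] using \<alpha>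
    by (auto intro!: derivative_eq_intros DERIV_u0 dA DERIV_u0_primitive simp: field_simps)
  also have "2 * (u0 \<alpha> t + (D * sin (\<alpha> * t) + coeff_A \<alpha> t * (cos (\<alpha> * t) * \<alpha>)) / \<alpha> - (u0 \<alpha> t + t * du0 \<alpha> t)
       - ((coeff_A \<alpha> t + t * D) * cos (\<alpha> * t) + t * coeff_A \<alpha> t * (- sin (\<alpha> * t) * \<alpha>)))
     = 2 * D * (sin (\<alpha> * t) - \<alpha> * t * cos (\<alpha> * t)) / \<alpha>"
    using \<alpha> by (simp add: p field_simps)
  finally show ?thesis by (simp add: D_def)
qed

lemma DERIV_droplet_param:
  assumes "sin (\<alpha> * t) \<noteq> 0"
  shows "((\<lambda>t. droplet \<alpha> t x) has_real_derivative
    wronskian \<alpha> t / (\<alpha> * (sin (\<alpha> * t))\<^sup>2) * (cos (\<alpha> * x) - cos (\<alpha> * t))) (at t)"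
proof -
  define D where "D = wronskian \<alpha> t / (\<alpha> * (sin (\<alpha> * t))\<^sup>2)"
  have p: "du0 \<alpha> t = coeff_A \<alpha> t * (\<alpha> * sin (\<alpha> * t))" using assms \<alpha> by (simp add: coeff_A_alt)
  have dA: "(coeff_A \<alpha> has_real_derivative D) (at t)" using DERIV_coeff_A[OF assms] by (simp add: D_def)
  have "((\<lambda>t. droplet \<alpha> t x) has_real_derivative
    D * cos (\<alpha> * x) - du0 \<alpha> t - (D * cos (\<alpha> * t) + coeff_A \<alpha> t * (- sin (\<alpha> * t) * \<alpha>))) (at t)"
    unfolding droplet_def[abs_def] using \<alpha> by (auto intro!: derivative_eq_intros DERIV_u0 dA)
  then show ?thesis unfolding D_def[symmetric] by (simp add: p algebra_simps)
qed

lemma integral_droplet: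
  assumes "0 \<le> t"
  shows "(droplet \<alpha> t has_integral droplet_mass \<alpha> t) {-t..t}"
proof -
  define P where "P x = u0_primitive \<alpha> x + coeff_A \<alpha> t * sin (\<alpha> * x) / \<alpha> - x * (u0 \<alpha> t + coeff_A \<alpha> t * cos (\<alpha> * t))" for x
  have "(droplet \<alpha> t has_integral (P t - P (- t))) {-t..t}"
  proof (rule fundamental_theorem_of_calculus)
    fix x
    have "(P has_real_derivative droplet \<alpha> t x) (at x)"
      unfolding P_def using \<alpha>
      by (auto intro!: derivative_eq_intros DERIV_u0_primitive simp: droplet_def)
    then show "(P has_vector_derivative droplet \<alpha> t x) (at x within {-t..t})"
      by (simp add: has_real_derivative_iff_has_vector_derivative has_vector_derivative_at_within)
  qed (use assms in simp)
  also have "P t - P (- t) = droplet_mass \<alpha> t"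
    by (simp add: P_def droplet_mass_def u0_primitive_odd algebra_simps)
  finally show ?thesis .
qed

lemma droplet_mass_pi:
  assumes "\<alpha> < 1"
  shows "droplet_mass \<alpha> pi = 2 * pi / (1 - \<alpha>\<^sup>2)"
proof -
  have "\<alpha> \<noteq> 1" using assms by simp
  then show ?thesis by (simp add: droplet_mass_def u0_primitive_def u0_def coeff_A_alt du0_def)
qed

text \<open>For \<open>\<alpha> < 1\<close> the parameter interval extends beyond \<open>\<pi>\<close>, which makes the support radius
  smooth across the critical mass.\<close>

lemma radius_bound_exists:
  obtains b where "\<alpha> \<ge> 1 \<Longrightarrow> b = pi / \<alpha>" "\<alpha> < 1 \<Longrightarrow> pi < b"
    "\<And>t. 0 < t \<Longrightarrow> t < b \<Longrightarrow> \<alpha> * t < pi \<and> wronskian \<alpha> t > 0"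
proof (cases "\<alpha> \<ge> 1")
  case True
  show ?thesis
  proof (rule that[of "pi / \<alpha>"])
    fix t assume t: "0 < t" "t < pi / \<alpha>"
    have "\<alpha> * t < pi" using t \<alpha> by (simp add: field_simps)
    moreover have "t \<le> \<alpha> * t" using True t by simp
    then have "t \<le> pi" using \<open>\<alpha> * t < pi\<close> by linarith
    ultimately show "\<alpha> * t < pi \<and> wronskian \<alpha> t > 0" using wronskian_pos[of t] t by simp
  qed (use True in auto)
next
  case False
  then have a: "\<alpha> * pi < pi" using \<alpha> by simp
  have "isCont (wronskian \<alpha>) pi" using DERIV_wronskian DERIV_isCont by blast
  then have "(wronskian \<alpha> \<longlongrightarrow> wronskian \<alpha> pi) (at_right pi)" by (simp add: isCont_def filterlim_at_split)
  then have "eventually (\<lambda>t. wronskian \<alpha> t > 0) (at_right pi)"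
    using wronskian_pos[of pi] a by (intro order_tendstoD(1)) auto
  then obtain b' where b': "b' > pi" "\<And>t. pi < t \<Longrightarrow> t < b' \<Longrightarrow> wronskian \<alpha> t > 0"
    unfolding eventually_at_right_field by blast
  show ?thesis
  proof (rule that[of "min b' (pi / \<alpha>)"])
    show "pi < min b' (pi / \<alpha>)" using b' a \<alpha> by (simp add: field_simps)
    fix t assume t: "0 < t" "t < min b' (pi / \<alpha>)"
    have "\<alpha> * t < pi" using t \<alpha> by (simp add: field_simps)
    moreover from this have "wronskian \<alpha> t > 0" using t b'(2)[of t] wronskian_pos[of t] by (cases "t \<le> pi") auto
    ultimately show "\<alpha> * t < pi \<and> wronskian \<alpha> t > 0" by simp
  qed (use False in auto)
qed

end

section \<open>The support radius as inverse of the mass function\<close>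

lemma elementary_sin_cos: "sin \<in> elementary_on S" "cos \<in> elementary_on S"
  using elementary_on.sin[of 1 S] elementary_on.cos[of 1 S] by simp_all

lemma elementary_u0: "u0 \<alpha> \<in> elementary_on S"
proof (cases "\<alpha> = 1")
  case True
  have "(\<lambda>x. - (1 / 2) * x * sin x) \<in> elementary_on S"
    by (intro elementary_on.mult elementary_on.const elementary_on.ident elementary_sin_cos)
  then show ?thesis using True by (simp add: u0_def[abs_def])
next
  case False
  have "(\<lambda>x. 1 / (1 - \<alpha>\<^sup>2) * cos x) \<in> elementary_on S"
    by (intro elementary_on.mult elementary_on.const elementary_sin_cos)
  then show ?thesis using False by (simp add: u0_def[abs_def])
qed

lemma elementary_du0: "du0 \<alpha> \<in> elementary_on S"
proof (cases "\<alpha> = 1")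
  case True
  have "(\<lambda>x. - (sin x + x * cos x) / 2) \<in> elementary_on S"
    by (intro elementary_on_divide elementary_on_uminus elementary_on.mult elementary_on.add
        elementary_on.const elementary_on.ident elementary_sin_cos) simp
  then show ?thesis using True by (simp add: du0_def[abs_def])
next
  case False
  have "(\<lambda>x. - 1 / (1 - \<alpha>\<^sup>2) * sin x) \<in> elementary_on S"
    by (intro elementary_on.mult elementary_on.const elementary_sin_cos)
  then show ?thesis using False by (simp add: du0_def[abs_def])
qed

lemma elementary_wronskian: "wronskian \<alpha> \<in> elementary_on S"
  unfolding wronskian_def[abs_def]
  by (intro elementary_on_diff elementary_on.mult elementary_on_uminus elementary_on.const
      elementary_on.sin elementary_on.cos elementary_sin_cos elementary_u0 elementary_du0)

text \<open>A choice is made because for \<open>\<alpha> < 1\<close> the extent of the interval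
  beyond pi comes from continuity and is not explicit.\<close>

definition radius_bound :: "real \<Rightarrow> real" where
  "radius_bound \<alpha> = (SOME b. (\<alpha> \<ge> 1 \<longrightarrow> b = pi / \<alpha>) \<and> (\<alpha> < 1 \<longrightarrow> pi < b) \<and>
     (\<forall>t. 0 < t \<and> t < b \<longrightarrow> \<alpha> * t < pi \<and> wronskian \<alpha> t > 0))"

definition radius :: "real \<Rightarrow> real \<Rightarrow> real" where
  "radius \<alpha> = inv_into {0<..<radius_bound \<alpha>} (droplet_mass \<alpha>)"

context
  fixes \<alpha> :: real
  assumes \<alpha>: "\<alpha> > 0"
begin

lemma radius_bound:
  "\<alpha> \<ge> 1 \<Longrightarrow> radius_bound \<alpha> = pi / \<alpha>" "\<alpha> < 1 \<Longrightarrow> pi < radius_bound \<alpha>"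
  "0 < t \<Longrightarrow> t < radius_bound \<alpha> \<Longrightarrow> \<alpha> * t < pi" "0 < t \<Longrightarrow> t < radius_bound \<alpha> \<Longrightarrow> wronskian \<alpha> t > 0"
proof -
  have "\<exists>b. (\<alpha> \<ge> 1 \<longrightarrow> b = pi / \<alpha>) \<and> (\<alpha> < 1 \<longrightarrow> pi < b) \<and>
     (\<forall>t. 0 < t \<and> t < b \<longrightarrow> \<alpha> * t < pi \<and> wronskian \<alpha> t > 0)"
    using radius_bound_exists[OF \<alpha>] by metis
  from someI_ex[OF this] have *: "(\<alpha> \<ge> 1 \<longrightarrow> radius_bound \<alpha> = pi / \<alpha>) \<and> (\<alpha> < 1 \<longrightarrow> pi < radius_bound \<alpha>) \<and>
     (\<forall>t. 0 < t \<and> t < radius_bound \<alpha> \<longrightarrow> \<alpha> * t < pi \<and> wronskian \<alpha> t > 0)"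
    unfolding radius_bound_def[symmetric] .
  then show "\<alpha> \<ge> 1 \<Longrightarrow> radius_bound \<alpha> = pi / \<alpha>" "\<alpha> < 1 \<Longrightarrow> pi < radius_bound \<alpha>"
    "0 < t \<Longrightarrow> t < radius_bound \<alpha> \<Longrightarrow> \<alpha> * t < pi" "0 < t \<Longrightarrow> t < radius_bound \<alpha> \<Longrightarrow> wronskian \<alpha> t > 0"
    by blast+
qed

lemma less_radius_bound:
  assumes "t \<le> pi" "\<alpha> * t < pi"
  shows "t < radius_bound \<alpha>"
proof (cases "\<alpha> \<ge> 1")
  case True
  then show ?thesis
    using assms(2) \<alpha> by (simp add: radius_bound(1) pos_less_divide_eq mult.commute)
next
  case False
  then show ?thesis using assms radius_bound(2) by simp
qed

lemma sin_radius_pos: "0 < t \<Longrightarrow> t < radius_bound \<alpha> \<Longrightarrow> sin (\<alpha> * t) > 0"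
  using radius_bound(3)[of t] \<alpha> by (intro sin_gt_zero) auto

lemma coeff_A_less:
  assumes "0 < s" "s < t" "t < radius_bound \<alpha>"
  shows "coeff_A \<alpha> s < coeff_A \<alpha> t"
proof (rule DERIV_pos_imp_increasing[OF assms(2)])
  fix x assume x: "s \<le> x" "x \<le> t"
  then have p: "0 < sin (\<alpha> * x)" "0 < wronskian \<alpha> x" using assms by (auto intro!: sin_radius_pos radius_bound(4))
  then have "0 < wronskian \<alpha> x / (\<alpha> * (sin (\<alpha> * x))\<^sup>2)" using \<alpha> by simp
  then show "\<exists>y. (coeff_A \<alpha> has_real_derivative y) (at x) \<and> 0 < y"
    using DERIV_coeff_A[OF \<alpha>, of x] p by auto
qed

lemma droplet_mass_deriv_pos:
  assumes "0 < t" "t < radius_bound \<alpha>"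
  shows "0 < 2 * (wronskian \<alpha> t / (\<alpha> * (sin (\<alpha> * t))\<^sup>2)) * (sin (\<alpha> * t) - \<alpha> * t * cos (\<alpha> * t)) / \<alpha>"
proof -
  have "0 < sin (\<alpha> * t) - \<alpha> * t * cos (\<alpha> * t)"
    using assms radius_bound(3)[of t] \<alpha> by (intro sin_minus_mult_cos_pos) auto
  then show ?thesis using sin_radius_pos[OF assms] radius_bound(4)[OF assms] \<alpha> by simp
qed

lemma droplet_mass_less:
  assumes "0 < s" "s < t" "t < radius_bound \<alpha>"
  shows "droplet_mass \<alpha> s < droplet_mass \<alpha> t"
proof (rule DERIV_pos_imp_increasing[OF assms(2)])
  fix x assume "s \<le> x" "x \<le> t"
  then have x: "0 < x" "x < radius_bound \<alpha>" using assms by auto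
  then show "\<exists>y. (droplet_mass \<alpha> has_real_derivative y) (at x) \<and> 0 < y"
    using DERIV_droplet_mass[OF \<alpha>, of x] droplet_mass_deriv_pos[OF x] sin_radius_pos[OF x] by (metis less_irrefl)
qed

lemma inj_droplet_mass: "inj_on (droplet_mass \<alpha>) {0<..<radius_bound \<alpha>}"
  using droplet_mass_less by (intro linorder_inj_onI') fastforce

lemma radius_droplet_mass: "0 < t \<Longrightarrow> t < radius_bound \<alpha> \<Longrightarrow> radius \<alpha> (droplet_mass \<alpha> t) = t"
  unfolding radius_def using inj_droplet_mass by (intro inv_into_f_f) auto

text \<open>By the definition of \<open>coeff_A\<close>, the slope at \<open>z\<close> equals
  \<open>\<alpha> * sin (\<alpha> * z) * (coeff_A \<alpha> z - coeff_A \<alpha> t)\<close>, which is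
  negative because \<open>coeff_A\<close> increases.\<close>

lemma droplet_decreasing:
  assumes "0 \<le> x" "x < y" "y \<le> t" "t < radius_bound \<alpha>"
  shows "droplet \<alpha> t y < droplet \<alpha> t x"
proof (rule DERIV_neg_imp_decreasing_open[OF assms(2)])
  fix z assume z: "x < z" "z < y"
  have sz: "sin (\<alpha> * z) > 0" using z assms by (intro sin_radius_pos) auto
  have "coeff_A \<alpha> z < coeff_A \<alpha> t" using z assms by (intro coeff_A_less) auto
  then have "\<alpha> * sin (\<alpha> * z) * coeff_A \<alpha> z < \<alpha> * sin (\<alpha> * z) * coeff_A \<alpha> t" using sz \<alpha> by simp
  then have "du0 \<alpha> z - coeff_A \<alpha> t * \<alpha> * sin (\<alpha> * z) < 0"
    using sz \<alpha> by (simp add: coeff_A_alt[of \<alpha> z] mult_ac)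
  then show "\<exists>d. (droplet \<alpha> t has_real_derivative d) (at z) \<and> d < 0" using DERIV_droplet by blast
next
  show "continuous_on {x..y} (droplet \<alpha> t)"
    by (rule DERIV_continuous_on) (rule has_field_derivative_at_within[OF DERIV_droplet])
qed

text \<open>With \<open>x\<close> fixed, the derivative in the radius \<open>r\<close> is a positive
  factor times \<open>cos (\<alpha> * x) - cos (\<alpha> * r)\<close>, and all radii between
  \<open>s\<close> and \<open>t\<close> exceed \<open>\<bar>x\<bar>\<close>.\<close>

lemma droplet_less:
  assumes "\<bar>x\<bar> < s" "s < t" "t < radius_bound \<alpha>"
  shows "droplet \<alpha> s x < droplet \<alpha> t x"
proof (rule DERIV_pos_imp_increasing[OF assms(2)])
  fix r assume "s \<le> r" "r \<le> t"
  then have r: "0 < r" "r < radius_bound \<alpha>" "\<bar>x\<bar> < r" using assms by auto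
  have "cos (\<alpha> * r) < cos (\<alpha> * \<bar>x\<bar>)"
    using r \<alpha> radius_bound(3)[OF r(1,2)] by (intro cos_monotone_0_pi) auto
  also have "cos (\<alpha> * \<bar>x\<bar>) = cos (\<alpha> * x)" by (auto simp: abs_if)
  finally have "0 < wronskian \<alpha> r / (\<alpha> * (sin (\<alpha> * r))\<^sup>2) * (cos (\<alpha> * x) - cos (\<alpha> * r))"
    using sin_radius_pos[OF r(1,2)] radius_bound(4)[OF r(1,2)] \<alpha> by simp
  then show "\<exists>y. ((\<lambda>t. droplet \<alpha> t x) has_real_derivative y) (at r) \<and> 0 < y"
    using DERIV_droplet_param[OF \<alpha>, of r x] sin_radius_pos[OF r(1,2)] by (metis less_irrefl)
qed

text \<open>The derivative of the inverse is \<open>1 / dm\<close> evaluated at the inverse. Hence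
  the functions \<open>h \<circ> radius \<alpha>\<close>, with \<open>h\<close> elementary on the
  interval of radii, form a class that is closed under differentiation and contains the
  radius.\<close>

lemma smooth_radius: "smooth_on (radius \<alpha>) (droplet_mass \<alpha> ` {0<..<radius_bound \<alpha>})"
proof -
  define J where "J = {0<..<radius_bound \<alpha>}"
  define dm where "dm t = 2 * (wronskian \<alpha> t / (\<alpha> * (sin (\<alpha> * t))\<^sup>2)) * (sin (\<alpha> * t) - \<alpha> * t * cos (\<alpha> * t)) / \<alpha>" for t
  have dm: "dm t > 0" "(droplet_mass \<alpha> has_real_derivative dm t) (at t)" if "t \<in> J" for t
  proof -
    have t: "0 < t" "t < radius_bound \<alpha>" using that by (auto simp: J_def)
    show "dm t > 0" unfolding dm_def by (rule droplet_mass_deriv_pos[OF t])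
    show "(droplet_mass \<alpha> has_real_derivative dm t) (at t)"
      unfolding dm_def using sin_radius_pos[OF t] by (intro DERIV_droplet_mass[OF \<alpha>]) simp
  qed
  have dm_el: "dm \<in> elementary_on J"
  proof -
    have nz: "\<alpha> * (sin (\<alpha> * t) * sin (\<alpha> * t)) \<noteq> 0" if "t \<in> J" for t
      using that sin_radius_pos[of t] \<alpha> by (auto simp: J_def)
    have "(\<lambda>t. 2 * (wronskian \<alpha> t / (\<alpha> * (sin (\<alpha> * t) * sin (\<alpha> * t)))) * (sin (\<alpha> * t) - \<alpha> * t * cos (\<alpha> * t)) / \<alpha>) \<in> elementary_on J"
      by (intro elementary_on_divide[OF elementary_on.mult] elementary_on_diff elementary_on.mult
          elementary_on_divide elementary_on.const elementary_on.ident elementary_on.sin elementary_on.cos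
          elementary_wronskian nz) (use \<alpha> in auto)
    then show ?thesis by (simp add: dm_def[abs_def] power2_eq_square)
  qed
  have cm: "continuous_on J (droplet_mass \<alpha>)"
    using dm(2) by (intro DERIV_continuous_on) (auto intro: has_field_derivative_at_within)
  have inj: "inj_on (droplet_mass \<alpha>) J" unfolding J_def by (rule inj_droplet_mass)
  have open_T: "open (droplet_mass \<alpha> ` J)"
    by (rule invariance_of_domain[OF cm _ inj]) (simp add: J_def)
  have inv: "radius \<alpha> (droplet_mass \<alpha> t) = t" if "t \<in> J" for t
    using that radius_droplet_mass by (simp add: J_def)
  have dr: "(radius \<alpha> has_real_derivative inverse (dm (radius \<alpha> y))) (at y)" if y: "y \<in> droplet_mass \<alpha> ` J" for y
  proof -
    obtain t where t: "t \<in> J" "y = droplet_mass \<alpha> t" using y by blast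
    have "(radius \<alpha> has_derivative (*) (inverse (dm t))) (at (droplet_mass \<alpha> t))"
    proof (rule has_derivative_inverse_strong[OF _ t(1) cm inv])
      show "open J" by (simp add: J_def)
      show "(droplet_mass \<alpha> has_derivative (*) (dm t)) (at t)"
        using dm(2)[OF t(1)] by (simp add: has_field_derivative_def)
      show "(*) (dm t) \<circ> (*) (inverse (dm t)) = id" using dm(1)[OF t(1)] by (auto simp: o_def)
    qed auto
    then show ?thesis using t inv[OF t(1)] by (simp add: has_field_derivative_def)
  qed
  show ?thesis
    unfolding J_def[symmetric]
  proof (rule smooth_on_if_closed_under_deriv[OF open_T order_refl, where F="(\<lambda>f. f \<circ> radius \<alpha>) ` elementary_on J" and f="(\<lambda>x. x) \<circ> radius \<alpha>"])
    fix f assume "f \<in> (\<lambda>f. f \<circ> radius \<alpha>) ` elementary_on J"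
    then obtain h where h: "h \<in> elementary_on J" "f = h \<circ> radius \<alpha>" by blast
    obtain h' where h': "h' \<in> elementary_on J" "\<forall>x\<in>J. (h has_real_derivative h' x) (at x)"
      using elementary_on_has_derivative[OF h(1)] by blast
    have "(\<lambda>t. h' t * inverse (dm t)) \<in> elementary_on J"
      using dm(1) by (intro elementary_on.mult elementary_on.inverse h' dm_el) fastforce
    moreover have "(f has_real_derivative ((\<lambda>t. h' t * inverse (dm t)) \<circ> radius \<alpha>) y) (at y)"
      if y: "y \<in> droplet_mass \<alpha> ` J" for y
    proof -
      have "radius \<alpha> y \<in> J" using y inv by auto
      then show ?thesis
        unfolding h(2) o_def using h'(2) dr[OF y] by (intro DERIV_chain2[of h]) auto
    qed
    ultimately show "\<exists>f'\<in>(\<lambda>f. f \<circ> radius \<alpha>) ` elementary_on J. \<forall>x\<in>droplet_mass \<alpha> ` J. (f has_real_derivative f' x) (at x)"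
      by blast
  qed (auto intro: elementary_on.ident)
qed

text \<open>Suppose \<open>\<alpha> * T \<ge> pi\<close> and consider
  \<open>t = pi / \<alpha>\<close>. There \<open>A * cos (\<alpha> * x)\<close> has slope 0 whatever
  \<open>A\<close> is, and the Wronskian reduces to \<open>\<alpha> * du0 \<alpha> t\<close>, so the
  profile has positive slope at \<open>t\<close>. This contradicts the slope condition if
  \<open>t = T\<close> and monotonicity if \<open>t < T\<close>.\<close>

lemma slope_condition_radius:
  assumes T: "0 < T" "T \<le> pi" and dec: "\<And>x y. 0 \<le> x \<Longrightarrow> x \<le> y \<Longrightarrow> y \<le> pi \<Longrightarrow> u y \<le> u x"
    and u: "\<And>x. \<bar>x\<bar> \<le> T \<Longrightarrow> u x = u0 \<alpha> x + A * cos (\<alpha> * x) + c"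
    and slope: "du0 \<alpha> T = A * \<alpha> * sin (\<alpha> * T)"
  shows "\<alpha> * T < pi" "A = coeff_A \<alpha> T"
proof -
  show less: "\<alpha> * T < pi"
  proof (rule ccontr)
    assume "\<not> \<alpha> * T < pi"
    define t where "t = pi / \<alpha>"
    have t: "0 < t" "t \<le> T" "\<alpha> * t = pi" using \<alpha> \<open>\<not> \<alpha> * T < pi\<close> by (auto simp: t_def field_simps)
    have "0 < wronskian \<alpha> t" using t T by (intro wronskian_pos[OF \<alpha>]) auto
    then have pos: "0 < du0 \<alpha> t" using \<alpha> t by (simp add: wronskian_def zero_less_mult_iff)
    show False
    proof (cases "t = T")
      case True
      then show False using slope pos t by simp
    next
      case False
      have "((\<lambda>x. u0 \<alpha> x + A * cos (\<alpha> * x) + c) has_real_derivative du0 \<alpha> t - A * \<alpha> * sin (\<alpha> * t)) (at t)"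
        by (auto intro!: derivative_eq_intros DERIV_u0)
      then have "((\<lambda>x. u0 \<alpha> x + A * cos (\<alpha> * x) + c) has_real_derivative du0 \<alpha> t) (at t)" by (simp add: t(3))
      from DERIV_pos_inc_right[OF this pos] obtain d where d: "d > 0"
        "\<And>h. 0 < h \<Longrightarrow> h < d \<Longrightarrow> u0 \<alpha> t + A * cos (\<alpha> * t) + c < u0 \<alpha> (t + h) + A * cos (\<alpha> * (t + h)) + c" by blast
      define h where "h = min (d / 2) (T - t)"
      have h: "0 < h" "h < d" "t + h \<le> T" using d(1) t False by (auto simp: h_def min_def)
      have "u t < u (t + h)" using d(2)[OF h(1,2)] u[of t] u[of "t + h"] t h by simp
      then show False using dec[of t "t + h"] t h T by simp
    qed
  qed
  then have "sin (\<alpha> * T) > 0" using T less_radius_bound by (intro sin_radius_pos) auto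
  then show "A = coeff_A \<alpha> T" using slope \<alpha> by (simp add: coeff_A_alt)
qed

text \<open>The edge value \<open>u T\<close> separates the cases. If it is 0, the constant is
  determined and the minimizer is the droplet of radius \<open>T\<close>, whose mass identifies
  \<open>T\<close>. If it is positive, then \<open>T = pi\<close>, hence
  \<open>\<alpha> < 1\<close>, and the slope condition at pi gives \<open>A = 0\<close>.\<close>

lemma reduced_minimizer_classification:
  assumes min: "reduced_minimizer \<alpha> M u" and M: "M > 0"
  shows "M \<in> full_support_masses \<alpha> \<and> (\<forall>x\<in>{-pi..pi}. u x = M / (2 * pi) + 1 / (1 - \<alpha>\<^sup>2) * cos x) \<or>
    M \<in> droplet_masses \<alpha> \<and> 0 < radius \<alpha> M \<and> radius \<alpha> M \<le> pi \<and> radius \<alpha> M < radius_bound \<alpha> \<and>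
      droplet_mass \<alpha> (radius \<alpha> M) = M \<and>
      (\<forall>x\<in>{-pi..pi}. u x = (if \<bar>x\<bar> < radius \<alpha> M then droplet \<alpha> (radius \<alpha> M) x else 0))"
proof -
  note u = reduced_minimizerD[OF min]
  obtain T A c where T: "0 < T" "T \<le> pi" and form: "\<And>x. \<bar>x\<bar> \<le> T \<Longrightarrow> u x = u0 \<alpha> x + A * cos (\<alpha> * x) + c"
    and pos: "\<And>x. \<bar>x\<bar> < T \<Longrightarrow> u x > 0" and zero: "\<And>x. T < pi \<Longrightarrow> T \<le> \<bar>x\<bar> \<Longrightarrow> \<bar>x\<bar> \<le> pi \<Longrightarrow> u x = 0"
    and slope: "du0 \<alpha> T = A * \<alpha> * sin (\<alpha> * T)"
    by (rule reduced_minimizer_structure[OF \<alpha> min M], rule that)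
  note sl = slope_condition_radius[OF T reduced_minimizer_decreasing[OF min] form slope]
  show ?thesis
  proof (cases "u T = 0")
    case True
    have b: "T < radius_bound \<alpha>" using T sl(1) by (intro less_radius_bound) auto
    have c: "c = - u0 \<alpha> T - A * cos (\<alpha> * T)" using form[of T] True T by simp
    have in_T: "u x = droplet \<alpha> T x" if "\<bar>x\<bar> \<le> T" for x
      using form[OF that] sl(2) by (simp add: droplet_def c)
    have out_T: "u x = 0" if "T \<le> \<bar>x\<bar>" "\<bar>x\<bar> \<le> pi" for x
    proof (cases "T < pi")
      case False
      then have "\<bar>x\<bar> = T" using T that by simp
      then have "u x = u T" using reduced_minimizer_even[OF min, of T] by (auto simp: abs_if split: if_splits)
      then show ?thesis using True by simp
    qed (use zero that in auto)
    have "integral {-pi..pi} u = integral {-pi..pi} (\<lambda>x. if x \<in> {-T..T} then u x else 0)"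
    proof (rule integral_cong)
      fix x assume "x \<in> {-pi..pi}"
      then show "u x = (if x \<in> {-T..T} then u x else 0)"
        using out_T[of x] by (auto simp: abs_if split: if_splits)
    qed
    also have "\<dots> = integral ({-T..T} \<inter> {-pi..pi}) u" by (rule integral_restrict_Int)
    also have "{-T..T} \<inter> {-pi..pi} = {-T..T}" using T by auto
    finally have "integral {-T..T} u = integral {-pi..pi} u" ..
    moreover have "integral {-T..T} u = integral {-T..T} (droplet \<alpha> T)"
      by (rule integral_cong) (use in_T in auto)
    ultimately have mass: "droplet_mass \<alpha> T = M"
      using integral_unique[OF integral_droplet[OF \<alpha>, of T]] T u(5) by simp
    then have r: "radius \<alpha> M = T" using radius_droplet_mass[OF T(1) b] by simp
    have "M \<notin> full_support_masses \<alpha>"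
    proof
      \<comment> \<open>The droplet of radius pi has the critical mass
        \<open>2 * pi / (1 - \<alpha>^2)\<close>, and droplets of smaller radius are
        lighter.\<close>
      assume "M \<in> full_support_masses \<alpha>"
      then have a: "\<alpha> < 1" "M * (1 - \<alpha>\<^sup>2) > 2 * pi" by (auto simp: full_support_masses_def)
      have "\<alpha>\<^sup>2 < 1" using a \<alpha> by (simp add: power_less_one_iff)
      have "droplet_mass \<alpha> T \<le> droplet_mass \<alpha> pi"
        using droplet_mass_less[of T pi] radius_bound(2)[OF a(1)] T by (cases "T = pi") auto
      then have "M * (1 - \<alpha>\<^sup>2) \<le> 2 * pi"
        using droplet_mass_pi[OF \<alpha> a(1)] mass \<open>\<alpha>\<^sup>2 < 1\<close> by (simp add: field_simps)
      then show False using a by simp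
    qed
    then have "M \<in> droplet_masses \<alpha>" using M by (simp add: droplet_masses_def)
    moreover have "u x = (if \<bar>x\<bar> < T then droplet \<alpha> T x else 0)" if "x \<in> {-pi..pi}" for x
    proof -
      have "\<bar>x\<bar> \<le> pi" using that by auto
      then show ?thesis using in_T[of x] out_T[of x] by (cases "\<bar>x\<bar> < T") simp_all
    qed
    ultimately show ?thesis using r T b mass by simp
  next
    case False
    then have Tpi: "T = pi" using zero[of T] T by (cases "T < pi") auto
    then have a: "\<alpha> < 1" using sl(1) by simp
    have a2: "\<alpha>\<^sup>2 < 1" using a \<alpha> by (simp add: power_less_one_iff)
    have "A = 0" using sl(2) a Tpi by (simp add: coeff_A_alt du0_def)
    then have ux: "u x = 1 / (1 - \<alpha>\<^sup>2) * cos x + c" if "x \<in> {-pi..pi}" for x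
      using form[of x] that a Tpi by (simp add: u0_def abs_le_iff)
    have "(u has_integral (1 / (1 - \<alpha>\<^sup>2) * 0 + c * (2 * pi))) {-pi..pi}"
    proof (rule has_integral_eq[where f="\<lambda>x. 1 / (1 - \<alpha>\<^sup>2) * cos x + c"])
      have "(cos has_integral (sin pi - sin (-pi))) {-pi..pi}"
        by (rule fundamental_theorem_of_calculus)
          (auto simp flip: has_real_derivative_iff_has_vector_derivative intro!: derivative_eq_intros)
      then show "((\<lambda>x. 1 / (1 - \<alpha>\<^sup>2) * cos x + c) has_integral 1 / (1 - \<alpha>\<^sup>2) * 0 + c * (2 * pi)) {-pi..pi}"
        using has_integral_const_real[of c "-pi" pi]
        by (intro has_integral_add has_integral_mult_right) (simp_all add: mult.commute)
    qed (simp add: ux)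
    then have "c * (2 * pi) = M" using u(5) by (simp add: integral_unique)
    then have c: "c = M / (2 * pi)" by (subst nonzero_eq_divide_eq) auto
    have "u pi > 0" using False u(4)[of pi] Tpi by simp
    then have "1 / (1 - \<alpha>\<^sup>2) < M / (2 * pi)" using ux[of pi] c by simp
    then have "M * (1 - \<alpha>\<^sup>2) > 2 * pi" using a2 by (simp add: field_simps)
    then show ?thesis using M a ux c by (simp add: full_support_masses_def)
  qed
qed

end

section \<open>Energy of Sobolev functions\<close>

lemma integral_AE_cong:
  fixes f g :: "real \<Rightarrow> real"
  assumes "AE x in lebesgue. x \<in> {a..b} \<longrightarrow> f x = g x"
  shows "integral {a..b} f = integral {a..b} g"
proof -
  obtain N where N: "N \<in> null_sets lebesgue" "{x. \<not> (x \<in> {a..b} \<longrightarrow> f x = g x)} \<subseteq> N"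
    using assms unfolding eventually_ae_filter by auto
  show ?thesis
    by (rule integral_spike[of N]) (use N in \<open>auto simp: negligible_iff_null_sets\<close>)
qed

lemma AE_continuous_everywhere:
  assumes "continuous_on UNIV V" "AE x in lebesgue. 0 \<le> (V x :: real)"
  shows "0 \<le> V x"
proof (rule ccontr)
  assume n: "\<not> 0 \<le> V x"
  obtain N where N: "N \<in> null_sets lebesgue" "{x. \<not> 0 \<le> V x} \<subseteq> N"
    using assms(2) unfolding eventually_ae_filter by auto
  have "open {x. V x < 0}" using assms(1) by (intro open_Collect_less continuous_intros) auto
  moreover have "negligible {x. V x < 0}"
    by (rule negligible_subset[of N]) (use N in \<open>auto simp: negligible_iff_null_sets\<close>)
  moreover have "{x. V x < 0} \<noteq> {}" using n by (auto simp: not_le)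
  ultimately show False using open_not_negligible by blast
qed

lemma energy_eq:
  assumes v: "v \<in> H1_circle" and g: "weak_deriv_circle v g"
  shows "energy \<alpha> v = ereal (integral {-pi..pi} (\<lambda>x. (g x)\<^sup>2) / 2
     - \<alpha>\<^sup>2 / 2 * integral {-pi..pi} (\<lambda>x. (v x)\<^sup>2) - integral {-pi..pi} (\<lambda>x. v x * cos x))"
proof -
  define h where "h = (SOME g. weak_deriv_circle v g)"
  have h: "weak_deriv_circle v h" unfolding h_def by (rule someI[where P="weak_deriv_circle v", OF g])
  have vL: "v \<in> L2_circle" using v by (simp add: H1_circle_def)
  have hL: "h \<in> L2_circle" using h by (simp add: weak_deriv_circle_def)
  note v2 = L2_circle_square_integrable[OF vL] and h2 = L2_circle_square_integrable[OF hL]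
  have av2: "(\<lambda>x. \<alpha>\<^sup>2 * (v x)\<^sup>2) absolutely_integrable_on {-pi..pi}"
    using v2 by simp
  have vc: "(\<lambda>x. v x * cos x) absolutely_integrable_on {-pi..pi}"
    by (intro abs_integrable_mult_continuous L2_circle_abs_integrable vL continuous_intros)
  have "(LINT x:{-pi..pi}|lebesgue. (h x)\<^sup>2 - \<alpha>\<^sup>2 * (v x)\<^sup>2)
      = integral {-pi..pi} (\<lambda>x. (h x)\<^sup>2) - integral {-pi..pi} (\<lambda>x. \<alpha>\<^sup>2 * (v x)\<^sup>2)"
    using set_integral_diff(2)[OF h2 av2] set_lebesgue_integral_eq_integral(2)[OF h2]
      set_lebesgue_integral_eq_integral(2)[OF av2] by simp
  moreover have "integral {-pi..pi} (\<lambda>x. (h x)\<^sup>2) = integral {-pi..pi} (\<lambda>x. (g x)\<^sup>2)"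
    by (rule integral_AE_cong, rule eventually_mono[OF weak_deriv_circle_unique[OF h g]]) auto
  ultimately show ?thesis
    using v set_lebesgue_integral_eq_integral(2)[OF vc]
    by (simp add: energy_def Let_def h_def[symmetric] diff_divide_distrib)
qed

text \<open>Passing to the continuous representative can only lower the energy, since the dyadic
  sums are bounded by the integral of the squared weak derivative. Continuity also turns
  nonnegativity almost everywhere into nonnegativity everywhere.\<close>

lemma energy_ge_reduced_energy:
  assumes v: "v \<in> admissible M" "v \<in> H1_circle"
  obtains V where "V \<in> competitors M" "AE x in lebesgue. v x = V x"
    "ereal (reduced_energy \<alpha> V) \<le> energy \<alpha> v"
proof -
  obtain g where g: "weak_deriv_circle v g" using v(2) by (auto simp: H1_circle_def)
  have vL: "v \<in> L2_circle" using v(2) by (simp add: H1_circle_def)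
  have gL: "g \<in> L2_circle" using g by (simp add: weak_deriv_circle_def)
  obtain V where V: "periodic_2pi V" "continuous_on UNIV V" "AE x in lebesgue. v x = V x"
    "\<And>x y. -pi \<le> x \<Longrightarrow> x \<le> y \<Longrightarrow> y \<le> pi \<Longrightarrow> V y - V x = integral {x..y} g"
    by (rule weak_deriv_circle_representative[OF vL g], rule that)
  note fin = dirichlet_leI[of 0, OF dyadic_form_le_integral[OF gL V(4)]]
  have "AE x in lebesgue. 0 \<le> v x" using v(1) by (simp add: admissible_def)
  with V(3) have "AE x in lebesgue. 0 \<le> V x" by eventually_elim simp
  then have pos: "0 \<le> V x" for x by (rule AE_continuous_everywhere[OF V(2)])
  have cong: "integral {-pi..pi} (\<lambda>x. F x (v x)) = integral {-pi..pi} (\<lambda>x. F x (V x))" for F :: "real \<Rightarrow> real \<Rightarrow> real"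
    by (rule integral_AE_cong, rule eventually_mono[OF V(3)]) auto
  have "(LINT x:{-pi..pi}|lebesgue. v x) = M" using v(1) by (simp add: admissible_def)
  then have "integral {-pi..pi} v = M"
    using set_lebesgue_integral_eq_integral(2)[OF L2_circle_abs_integrable[OF vL]] by simp
  then have "integral {-pi..pi} V = M" using cong[of "\<lambda>x y. y"] by simp
  then have "V \<in> competitors M" using V fin(1) pos by (simp add: competitors_def)
  moreover have "ereal (reduced_energy \<alpha> V) \<le> energy \<alpha> v"
    unfolding energy_eq[OF v(2) g] reduced_energy_def
    using fin(2) cong[of "\<lambda>x y. y\<^sup>2"] cong[of "\<lambda>x y. y * cos x"] by simp
  ultimately show ?thesis using that V(3) by blast
qed

text \<open>The reverse comparison, available because a Lipschitz derivative controls the error of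
  the dyadic sums. The classical derivative is a weak one by integration by parts over a
  period.\<close>

lemma C1_competitor_energy:
  assumes u: "u \<in> competitors M" and d: "\<And>x. (u has_real_derivative u' x) (at x)"
    and L: "L-lipschitz_on UNIV u'"
  shows "u \<in> admissible M" "u \<in> H1_circle" "energy \<alpha> u \<le> ereal (reduced_energy \<alpha> u)"
proof -
  have per: "periodic_2pi u" and cu: "continuous_on UNIV u" and fin: "finite_dirichlet u"
    and pos: "\<And>x. 0 \<le> u x" and M: "integral {-pi..pi} u = M" using u by (auto simp: competitors_def)
  have cu': "continuous_on UNIV u'" by (rule lipschitz_on_continuous_on[OF L])
  have L2: "w \<in> L2_circle" if w: "periodic_2pi w" "continuous_on UNIV w" for w
  proof -
    have "w \<in> borel_measurable borel" using w(2) by (rule borel_measurable_continuous_onI)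
    then have "w \<in> borel_measurable lebesgue" by (simp add: measurable_completion)
    moreover have "(\<lambda>x. (w x)\<^sup>2) absolutely_integrable_on {-pi..pi}"
      by (intro absolutely_integrable_continuous_real continuous_intros continuous_on_subset[OF w(2)]) auto
    ultimately show ?thesis using w(1) by (simp add: L2_circle_def)
  qed
  have per': "periodic_2pi u'"
    unfolding periodic_2pi_def
  proof
    fix x
    have "((\<lambda>x. u (x + 2 * pi)) has_real_derivative u' (x + 2 * pi)) (at x)"
      by (rule DERIV_shift[THEN iffD1, OF d])
    then have "(u has_real_derivative u' (x + 2 * pi)) (at x)" using per by (simp add: periodic_2pi_def)
    then show "u' (x + 2 * pi) = u' x" using d by (rule DERIV_unique)
  qed
  have uL: "u \<in> L2_circle" by (rule L2[OF per cu])
  show "u \<in> admissible M"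
    using uL pos M set_lebesgue_integral_eq_integral(2)[OF L2_circle_abs_integrable[OF uL]]
    by (simp add: admissible_def)
  have weak: "weak_deriv_circle u u'"
    unfolding weak_deriv_circle_def
  proof (intro conjI allI impI)
    show "u' \<in> L2_circle" by (rule L2[OF per' cu'])
    fix \<phi> assume \<phi>: "periodic_2pi \<phi> \<and> smooth_on \<phi> UNIV"
    then have p: "periodic_2pi \<phi>" "smooth_on \<phi> UNIV" by auto
    note d\<phi> = smooth_on_has_derivative[OF p(2)]
    have c: "continuous_on {-pi..pi} (\<lambda>x. u x * deriv \<phi> x)" "continuous_on {-pi..pi} (\<lambda>x. u' x * \<phi> x)"
      using smooth_on_has_derivative(2)[OF d\<phi>(3)] d\<phi>(2)
      by (auto intro!: continuous_intros continuous_on_subset[OF cu] continuous_on_subset[OF cu'])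
    have "((\<lambda>x. u x * deriv \<phi> x + u' x * \<phi> x) has_integral (u pi * \<phi> pi - u (-pi) * \<phi> (-pi))) {-pi..pi}"
    proof (rule fundamental_theorem_of_calculus)
      fix x
      have "((\<lambda>x. u x * \<phi> x) has_real_derivative u x * deriv \<phi> x + u' x * \<phi> x) (at x)"
        by (rule DERIV_mult'[OF d d\<phi>(1)])
      then show "((\<lambda>x. u x * \<phi> x) has_vector_derivative u x * deriv \<phi> x + u' x * \<phi> x) (at x within {-pi..pi})"
        by (simp add: has_real_derivative_iff_has_vector_derivative has_vector_derivative_at_within)
    qed simp
    moreover have "u (-pi) = u pi" "\<phi> (-pi) = \<phi> pi"
      using per[unfolded periodic_2pi_def, rule_format, of "-pi"] p(1)[unfolded periodic_2pi_def, rule_format, of "-pi"]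
      by simp_all
    ultimately have "integral {-pi..pi} (\<lambda>x. u x * deriv \<phi> x + u' x * \<phi> x) = 0" by (simp add: integral_unique)
    then have "integral {-pi..pi} (\<lambda>x. u x * deriv \<phi> x) = - integral {-pi..pi} (\<lambda>x. u' x * \<phi> x)"
      using c by (subst (asm) Henstock_Kurzweil_Integration.integral_add) (auto intro: integrable_continuous_real)
    then show "(LINT x:{-pi..pi}|lebesgue. u x * deriv \<phi> x) = - (LINT x:{-pi..pi}|lebesgue. u' x * \<phi> x)"
      using c[THEN absolutely_integrable_continuous_real, THEN set_lebesgue_integral_eq_integral(2)] by simp
  qed
  then show H: "u \<in> H1_circle" using uL by (auto simp: H1_circle_def)
  show "energy \<alpha> u \<le> ereal (reduced_energy \<alpha> u)"
    unfolding energy_eq[OF H weak] reduced_energy_def using integral_le_dirichlet[OF d L fin] by simp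
qed

text \<open>The one-sided comparisons form a chain: energy of \<open>u\<close>, reduced energy of
  \<open>u\<close>, reduced energy of a representative \<open>V\<close>, energy of the function
  represented. Minimality of \<open>u\<close> follows. For another minimizer the chain closes up, so
  \<open>V\<close> is a reduced minimizer as well and equals \<open>u\<close>.\<close>

lemma minimizer_if_reduced_minimizer:
  assumes min: "reduced_minimizer \<alpha> M u" and d: "\<And>x. (u has_real_derivative u' x) (at x)"
    and L: "L-lipschitz_on UNIV u'"
    and unique: "\<And>w. reduced_minimizer \<alpha> M w \<Longrightarrow> w = u"
  shows "minimizer \<alpha> M u" "minimizer \<alpha> M v \<Longrightarrow> AE x in lebesgue. v x = u x"
proof -
  have u: "u \<in> competitors M" using min by (simp add: reduced_minimizer_def)
  note C1 = C1_competitor_energy[OF u d L]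
  have lower: "energy \<alpha> u \<le> energy \<alpha> w" if w: "w \<in> admissible M" for w
  proof (cases "w \<in> H1_circle")
    case True
    obtain V where V: "V \<in> competitors M" "ereal (reduced_energy \<alpha> V) \<le> energy \<alpha> w"
      by (rule energy_ge_reduced_energy[OF w True], rule that)
    have "reduced_energy \<alpha> u \<le> reduced_energy \<alpha> V" using min V(1) by (simp add: reduced_minimizer_def)
    then have "ereal (reduced_energy \<alpha> u) \<le> ereal (reduced_energy \<alpha> V)" by simp
    from order_trans[OF C1(3) order_trans[OF this V(2)]] show ?thesis .
  qed (simp add: energy_def)
  show "minimizer \<alpha> M u"
    unfolding is_arg_min_def
  proof (intro conjI notI C1(1))
    assume "\<exists>y. y \<in> admissible M \<and> energy \<alpha> y < energy \<alpha> u"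
    then obtain y where "y \<in> admissible M" "energy \<alpha> y < energy \<alpha> u" by blast
    then show False using lower[of y] by (simp add: not_le[symmetric])
  qed
  assume v: "minimizer \<alpha> M v"
  then have va: "v \<in> admissible M" unfolding is_arg_min_def by blast
  have "\<not> energy \<alpha> u < energy \<alpha> v" using v C1(1) unfolding is_arg_min_def by blast
  then have le: "energy \<alpha> v \<le> energy \<alpha> u" by (rule leI)
  have leu: "energy \<alpha> v \<le> ereal (reduced_energy \<alpha> u)" using le C1(3) by (rule order_trans)
  have vH: "v \<in> H1_circle"
  proof (rule ccontr)
    assume "v \<notin> H1_circle"
    then have "energy \<alpha> v = \<infinity>" by (simp add: energy_def)
    then show False using leu by simp
  qed
  obtain V where V: "V \<in> competitors M" "AE x in lebesgue. v x = V x" "ereal (reduced_energy \<alpha> V) \<le> energy \<alpha> v"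
    by (rule energy_ge_reduced_energy[OF va vH], rule that)
  have "ereal (reduced_energy \<alpha> V) \<le> ereal (reduced_energy \<alpha> u)" using V(3) leu by (rule order_trans)
  then have le: "reduced_energy \<alpha> V \<le> reduced_energy \<alpha> u" by simp
  have "reduced_minimizer \<alpha> M V"
    unfolding reduced_minimizer_def
  proof (intro conjI ballI V(1))
    fix w assume "w \<in> competitors M"
    then have "reduced_energy \<alpha> u \<le> reduced_energy \<alpha> w" using min by (simp add: reduced_minimizer_def)
    with le show "reduced_energy \<alpha> V \<le> reduced_energy \<alpha> w" by (rule order_trans)
  qed
  then show "AE x in lebesgue. v x = u x" using unique V(2) by simp
qed

section \<open>Dependence on the mass\<close>

text \<open>Away from the seam \<open>u\<close> is locally \<open>F\<close>, up to a period. At -pi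
  the right derivative comes from \<open>F\<close> at -pi and the left one from \<open>F\<close> at
  pi; the hypothesis \<open>ends\<close> makes them agree.\<close>

lemma DERIV_periodic:
  assumes u: "periodic_2pi u" and eq: "\<And>x. x \<in> {-pi..pi} \<Longrightarrow> u x = F x"
    and F: "\<And>x. (F has_real_derivative F' x) (at x)" and ends: "F' (-pi) = F' pi"
  shows "(u has_real_derivative F' (wrap x)) (at x)"
proof -
  define y where "y = wrap x"
  have y: "-pi \<le> y" "y < pi" using wrap_range by (auto simp: y_def)
  have main: "(u has_real_derivative F' y) (at y)"
  proof (cases "y = -pi")
    case False
    show ?thesis
      by (rule has_field_derivative_transform_within_open[OF F, of "{-pi<..<pi}"])
        (use y False in \<open>auto simp: eq\<close>)
  next
    case True
    have e: "u y = F (-pi)" "u y = F pi"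
      using eq[of "-pi"] eq[of pi] u[unfolded periodic_2pi_def, rule_format, of "-pi"] by (auto simp: True)
    have right: "((\<lambda>z. (u z - u y) / (z - y)) \<longlongrightarrow> F' y) (at_right y)"
    proof (rule Lim_transform_eventually)
      show "((\<lambda>z. (F z - F y) / (z - y)) \<longlongrightarrow> F' y) (at_right y)"
        using F[of y] by (simp add: has_field_derivative_iff filterlim_at_split)
      have "eventually (\<lambda>z. z \<in> {y<..<pi}) (at_right y)"
        using y by (intro eventually_at_right_real) auto
      then show "eventually (\<lambda>z. (F z - F y) / (z - y) = (u z - u y) / (z - y)) (at_right y)"
        by eventually_elim (use True e in \<open>simp add: eq\<close>)
    qed
    have left: "((\<lambda>z. (u z - u y) / (z - y)) \<longlongrightarrow> F' y) (at_left y)"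
    proof (rule Lim_transform_eventually)
      have "((\<lambda>z. F (z + 2 * pi)) has_real_derivative F' (y + 2 * pi)) (at y)"
        by (rule DERIV_shift[THEN iffD1, OF F])
      then show "((\<lambda>z. (F (z + 2 * pi) - F (y + 2 * pi)) / (z - y)) \<longlongrightarrow> F' y) (at_left y)"
        using ends True by (simp add: has_field_derivative_iff filterlim_at_split)
      have "eventually (\<lambda>z. z \<in> {y - 1<..<y}) (at_left y)"
        by (intro eventually_at_left_real) auto
      then show "eventually (\<lambda>z. (F (z + 2 * pi) - F (y + 2 * pi)) / (z - y) = (u z - u y) / (z - y)) (at_left y)"
      proof eventually_elim
        case (elim z)
        have "u z = u (z + 2 * pi)" using u by (simp add: periodic_2pi_def)
        also have "\<dots> = F (z + 2 * pi)" by (rule eq) (use elim True pi_gt3 in auto)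
        finally show ?case using True e by simp
      qed
    qed
    show ?thesis using left right by (simp add: has_field_derivative_iff filterlim_at_split)
  qed
  obtain k where k: "x = y + 2 * pi * of_int k" using ex_wrap unfolding y_def by blast
  have "((\<lambda>z. u (z + 2 * pi * of_int k)) has_real_derivative F' y) (at y)"
    using main by (simp only: periodic_2pi_int[OF u])
  then show ?thesis unfolding y_def[symmetric] by (subst k) (simp only: DERIV_shift)
qed

text \<open>Points of the same period are compared directly; for points of different periods the
  comparison passes through the seam, where \<open>f\<close> has equal values at both ends.\<close>

lemma lipschitz_wrap:
  assumes f: "L-lipschitz_on {-pi..pi} f" and ends: "f (-pi) = (f pi :: real)"
  shows "L-lipschitz_on UNIV (\<lambda>x. f (wrap x))"
proof -
  have L: "L \<ge> 0" using f by (rule lipschitz_on_nonneg)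
  have fL: "\<bar>f x - f y\<bar> \<le> L * \<bar>x - y\<bar>" if "x \<in> {-pi..pi}" "y \<in> {-pi..pi}" for x y
    using lipschitz_onD[OF f that] by (simp add: dist_real_def)
  have le: "\<bar>f (wrap x) - f (wrap y)\<bar> \<le> L * (y - x)" if xy: "x \<le> y" for x y
  proof -
    obtain k m where k: "x = wrap x + 2 * pi * of_int k" and m: "y = wrap y + 2 * pi * of_int m"
      using ex_wrap by blast
    note r = wrap_range[of x] wrap_range[of y]
    have "2 * pi * of_int k < 2 * pi * (of_int m + 1)"
      using k m r xy by (simp add: algebra_simps)
    then have "real_of_int k < of_int (m + 1)" by simp
    then have "k \<le> m" by linarith
    show ?thesis
    proof (cases "k = m")
      case True
      have e: "wrap y - wrap x = y - x" using k m unfolding True by linarith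
      then have "wrap x \<le> wrap y" using xy by linarith
      moreover note e
      ultimately show ?thesis using fL[of "wrap x" "wrap y"] r by simp
    next
      case False
      then have "k + 1 \<le> m" using \<open>k \<le> m\<close> by simp
      then have "real_of_int (k + 1) \<le> real_of_int m" by (simp only: of_int_le_iff)
      then have "2 * pi * (of_int k + 1) \<le> 2 * pi * of_int m" by simp
      then have ge: "(pi - wrap x) + (wrap y + pi) \<le> y - x"
        using k m by (simp add: algebra_simps)
      have "\<bar>f (wrap x) - f pi\<bar> \<le> L * (pi - wrap x)" using fL[of "wrap x" pi] r by simp
      moreover have "\<bar>f (wrap y) - f (-pi)\<bar> \<le> L * (wrap y + pi)" using fL[of "wrap y" "-pi"] r by simp
      ultimately have "\<bar>f (wrap x) - f (wrap y)\<bar> \<le> L * (pi - wrap x) + L * (wrap y + pi)"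
        using ends by linarith
      also have "\<dots> = L * ((pi - wrap x) + (wrap y + pi))" by (simp add: algebra_simps)
      also have "\<dots> \<le> L * (y - x)" using ge L by (intro mult_left_mono)
      finally show ?thesis .
    qed
  qed
  show ?thesis
  proof (rule lipschitz_onI[OF _ L])
    fix x y
    show "dist (f (wrap x)) (f (wrap y)) \<le> L * dist x y"
      using le[of x y] le[of y x] by (cases "x \<le> y") (simp_all add: dist_real_def abs_minus_commute)
  qed
qed

text \<open>Nearest-point projection to \<open>[-t, t]\<close>. Since a droplet vanishes at both
  edges, its composition with \<open>clip t\<close> is its extension by 0, without a case
  distinction.\<close>

definition clip :: "real \<Rightarrow> real \<Rightarrow> real" where
  "clip t x = max (- t) (min t x)"

lemma clip_lipschitz: "\<bar>clip t x - clip t y\<bar> \<le> \<bar>x - y\<bar>"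
  by (auto simp: clip_def max_def min_def)

text \<open>Only the edges need care. There \<open>F\<close> has slope 0, so the increment of
  \<open>F\<close> is small relative to \<open>clip t y - x\<close>, and the true denominator
  \<open>y - x\<close> is at least as large.\<close>

lemma DERIV_clip:
  assumes t: "0 < t" and F: "\<And>x. (F has_real_derivative F' x) (at x)" and ends: "F' t = 0" "F' (- t) = 0"
  shows "((\<lambda>x. F (clip t x)) has_real_derivative F' (clip t x)) (at x)"
proof -
  consider "\<bar>x\<bar> < t" | "t < \<bar>x\<bar>" | "\<bar>x\<bar> = t" by linarith
  then show ?thesis
  proof cases
    case 1
    have "((\<lambda>x. F (clip t x)) has_real_derivative F' x) (at x)"
      by (rule has_field_derivative_transform_within_open[OF F, of "{-t<..<t}"])
        (use 1 in \<open>auto simp: clip_def\<close>)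
    then show ?thesis using 1 by (simp add: clip_def)
  next
    case 2
    have "((\<lambda>x. F (clip t x)) has_real_derivative 0) (at x)"
    proof (cases "x > 0")
      case True
      show ?thesis
        by (rule has_field_derivative_transform_within_open[of "\<lambda>_. F t" _ _ "{t<..}"])
          (use 2 t True in \<open>auto simp: clip_def\<close>)
    next
      case False
      show ?thesis
        by (rule has_field_derivative_transform_within_open[of "\<lambda>_. F (- t)" _ _ "{..<-t}"])
          (use 2 t False in \<open>auto simp: clip_def\<close>)
    qed
    moreover have "clip t x = t \<or> clip t x = - t" using 2 t by (auto simp: clip_def)
    ultimately show ?thesis using ends by auto
  next
    case 3
    then have cx: "clip t x = x" "F' x = 0" using t ends by (auto simp: clip_def abs_if split: if_splits)
    have "((\<lambda>y. (F (clip t y) - F (clip t x)) / (y - x)) \<longlongrightarrow> 0) (at x)"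
    proof (rule LIM_I)
      fix e :: real assume "e > 0"
      moreover have "((\<lambda>y. (F y - F x) / (y - x)) \<longlongrightarrow> 0) (at x)"
        using F[of x] cx by (simp add: has_field_derivative_iff)
      ultimately obtain d where d: "d > 0" "\<And>y. y \<noteq> x \<Longrightarrow> \<bar>y - x\<bar> < d \<Longrightarrow> \<bar>(F y - F x) / (y - x)\<bar> < e"
        unfolding LIM_def by (auto simp: dist_real_def)
      have "norm ((F (clip t y) - F (clip t x)) / (y - x) - 0) < e" if y: "y \<noteq> x \<and> norm (y - x) < d" for y
      proof (cases "clip t y = x")
        case True
        then show ?thesis using \<open>e > 0\<close> cx by simp
      next
        case False
        have le: "\<bar>clip t y - x\<bar> \<le> \<bar>y - x\<bar>" using clip_lipschitz[of t y x] cx by simp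
        then have "\<bar>(F (clip t y) - F x) / (clip t y - x)\<bar> < e" using d(2)[OF False] y by simp
        then have "\<bar>F (clip t y) - F x\<bar> < e * \<bar>clip t y - x\<bar>" using False by (simp add: pos_divide_less_eq)
        also have "\<dots> \<le> e * \<bar>y - x\<bar>" using le \<open>e > 0\<close> by (intro mult_left_mono) auto
        finally show ?thesis using y cx by (simp add: pos_divide_less_eq)
      qed
      then show "\<exists>d>0. \<forall>y. y \<noteq> x \<and> norm (y - x) < d \<longrightarrow> norm ((F (clip t y) - F (clip t x)) / (y - x) - 0) < e"
        using d(1) by blast
    qed
    then show ?thesis using cx by (simp add: has_field_derivative_iff)
  qed
qed

text \<open>Bounds are supplied for all three suprema because only for bounded families does a real
  supremum lie above its members; nonnegativity then follows from single values.\<close>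

lemma C1_holder_norm_bounds:
  assumes "\<And>x. \<bar>u x\<bar> \<le> B0" "\<And>x. \<bar>deriv u x\<bar> \<le> B1"
    and "\<And>x y. x \<noteq> y \<Longrightarrow> \<bar>deriv u x - deriv u y\<bar> \<le> B2 * \<bar>x - y\<bar> powr \<gamma>"
  shows "0 \<le> C1_holder_norm \<gamma> u" "C1_holder_norm \<gamma> u \<le> B0 + B1 + B2"
proof -
  define S where "S = {(x :: real, y :: real). x \<noteq> y}"
  define q where "q = (\<lambda>(x, y). \<bar>deriv u x - deriv u y\<bar> / \<bar>x - y\<bar> powr \<gamma>)"
  have q: "q z \<le> B2" if "z \<in> S" for z
    using assms(3)[of "fst z" "snd z"] that by (auto simp: q_def S_def divide_le_eq)
  have S: "(0, 1) \<in> S" by (simp add: S_def)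
  have "(SUP x. \<bar>u x\<bar>) \<le> B0" "(SUP x. \<bar>deriv u x\<bar>) \<le> B1" "(SUP z\<in>S. q z) \<le> B2"
    using assms(1,2) q S by (auto intro!: cSUP_least)
  moreover have "\<bar>u 0\<bar> \<le> (SUP x. \<bar>u x\<bar>)" "\<bar>deriv u 0\<bar> \<le> (SUP x. \<bar>deriv u x\<bar>)"
    using assms(1,2) by (auto intro!: cSUP_upper bdd_aboveI2)
  moreover have "q (0, 1) \<le> (SUP z\<in>S. q z)"
    using q S by (intro cSUP_upper bdd_aboveI2) auto
  moreover have "0 \<le> q (0, 1)" by (simp add: q_def)
  moreover have "C1_holder_norm \<gamma> u = (SUP x. \<bar>u x\<bar>) + (SUP x. \<bar>deriv u x\<bar>) + (SUP z\<in>S. q z)"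
    unfolding C1_holder_norm_def S_def q_def ..
  ultimately show "0 \<le> C1_holder_norm \<gamma> u" "C1_holder_norm \<gamma> u \<le> B0 + B1 + B2" by linarith+
qed

text \<open>Weighted geometric mean of two bounds. With \<open>a\<close> a uniform bound on the
  difference of two derivatives and \<open>b\<close> a Lipschitz bound, it makes Hoelder seminorms
  of exponent below 1 small.\<close>

lemma interpolate_powr:
  assumes "0 \<le> q" "q \<le> a" "q \<le> b" "0 \<le> \<gamma>" "\<gamma> \<le> (1 :: real)"
  shows "q \<le> a powr (1 - \<gamma>) * b powr \<gamma>"
proof (cases "q = 0")
  case False
  then have "q = q powr (1 - \<gamma>) * q powr \<gamma>" using assms by (simp flip: powr_add)
  also have "\<dots> \<le> a powr (1 - \<gamma>) * b powr \<gamma>"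
    using assms False by (intro mult_mono powr_mono2) auto
  finally show ?thesis .
qed simp

lemma du0_odd: "du0 \<alpha> (- x) = - du0 \<alpha> x"
proof (cases "\<alpha> = 1")
  case True
  have "- (sin (- x) + - x * cos (- x)) / 2 = - (- (sin x + x * cos x) / 2)"
    by (simp add: add_divide_distrib diff_divide_distrib)
  then show ?thesis using True unfolding du0_def by simp
qed (simp add: du0_def)

text \<open>Support radius for all masses; it equals \<open>\<pi>\<close> for minimizers of full support, for which the
  droplet formula remains valid up to an additive constant because \<open>coeff_A \<alpha> \<pi> = 0\<close> if \<open>\<alpha> < 1\<close>.\<close>

definition full_radius :: "real \<Rightarrow> real \<Rightarrow> real" where
  "full_radius \<alpha> M = (if M \<in> full_support_masses \<alpha> then pi else radius \<alpha> M)"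

text \<open>The minimum of the minimizer, taken at pi: 0 for droplets, and otherwise the height by
  which the full-support profile is lifted above the critical one.\<close>

definition floor_height :: "real \<Rightarrow> real \<Rightarrow> real" where
  "floor_height \<alpha> M = (if \<alpha> < 1 then max 0 (M / (2 * pi) - 1 / (1 - \<alpha>\<^sup>2)) else 0)"

definition droplet_slope :: "real \<Rightarrow> real \<Rightarrow> real \<Rightarrow> real" where
  "droplet_slope \<alpha> t x = du0 \<alpha> x - coeff_A \<alpha> t * \<alpha> * sin (\<alpha> * x)"

lemma clip_pi: "0 < t \<Longrightarrow> t \<le> pi \<Longrightarrow> clip t pi = t \<and> clip t (- pi) = - t"
  by (auto simp: clip_def)

section \<open>One explicit profile for all masses\<close>

context
  fixes \<alpha> :: real
  assumes \<alpha>: "\<alpha> > 0"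
begin

lemma square_less_1: "\<alpha> < 1 \<Longrightarrow> \<alpha>\<^sup>2 < 1"
  using \<alpha> by (simp add: power_less_one_iff)

lemma reduced_minimizer_unique:
  assumes "reduced_minimizer \<alpha> M u" "reduced_minimizer \<alpha> M w" and M: "M > 0"
  shows "w = u"
proof
  fix x
  have "wrap x \<in> {-pi..pi}" using wrap_range[of x] by simp
  then have "w (wrap x) = u (wrap x)"
    using reduced_minimizer_classification[OF \<alpha> assms(1) M] reduced_minimizer_classification[OF \<alpha> assms(2) M]
    by (auto simp: droplet_masses_def)
  then show "w x = u x" using assms(1,2)[THEN reduced_minimizerD(1)] by (simp add: periodic_2pi_wrap)
qed

text \<open>The choice is harmless: for positive mass a reduced minimizer exists and is
  unique.\<close>

definition min_profile :: "real \<Rightarrow> real \<Rightarrow> real" where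
  "min_profile M = (SOME u. reduced_minimizer \<alpha> M u)"

lemma min_profile: "M > 0 \<Longrightarrow> reduced_minimizer \<alpha> M (min_profile M)"
proof -
  assume "M > 0"
  then obtain u where "u \<in> competitors M" "\<And>v. v \<in> competitors M \<Longrightarrow> reduced_energy \<alpha> u \<le> reduced_energy \<alpha> v"
    using reduced_minimizer_exists[of M \<alpha>] by (metis less_imp_le)
  then have "reduced_minimizer \<alpha> M u" by (simp add: reduced_minimizer_def)
  then show ?thesis unfolding min_profile_def by (rule someI[where P="reduced_minimizer \<alpha> M"])
qed

lemma min_profile_full:
  assumes M: "M \<in> full_support_masses \<alpha>" and x: "x \<in> {-pi..pi}"
  shows "min_profile M x = M / (2 * pi) + 1 / (1 - \<alpha>\<^sup>2) * cos x"
proof -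
  have "M > 0" using M by (simp add: full_support_masses_def)
  then show ?thesis
    using reduced_minimizer_classification[OF \<alpha> min_profile[OF \<open>M > 0\<close>] \<open>M > 0\<close>] M x
    by (auto simp: droplet_masses_def)
qed

lemma min_profile_droplet:
  assumes M: "M \<in> droplet_masses \<alpha>"
  shows "0 < radius \<alpha> M" "radius \<alpha> M \<le> pi" "radius \<alpha> M < radius_bound \<alpha>"
    "droplet_mass \<alpha> (radius \<alpha> M) = M"
    "x \<in> {-pi..pi} \<Longrightarrow> min_profile M x = (if \<bar>x\<bar> < radius \<alpha> M then droplet \<alpha> (radius \<alpha> M) x else 0)"
proof -
  have "M > 0" "M \<notin> full_support_masses \<alpha>" using M by (auto simp: droplet_masses_def)
  then have "0 < radius \<alpha> M \<and> radius \<alpha> M \<le> pi \<and> radius \<alpha> M < radius_bound \<alpha> \<and>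
      droplet_mass \<alpha> (radius \<alpha> M) = M \<and>
      (\<forall>x\<in>{-pi..pi}. min_profile M x = (if \<bar>x\<bar> < radius \<alpha> M then droplet \<alpha> (radius \<alpha> M) x else 0))"
    using reduced_minimizer_classification[OF \<alpha> min_profile[OF \<open>M > 0\<close>] \<open>M > 0\<close>] by blast
  then show "0 < radius \<alpha> M" "radius \<alpha> M \<le> pi" "radius \<alpha> M < radius_bound \<alpha>"
    "droplet_mass \<alpha> (radius \<alpha> M) = M"
    "x \<in> {-pi..pi} \<Longrightarrow> min_profile M x = (if \<bar>x\<bar> < radius \<alpha> M then droplet \<alpha> (radius \<alpha> M) x else 0)"
    by auto
qed

lemma radius_strict_mono:
  assumes "M1 \<in> droplet_masses \<alpha>" "M2 \<in> droplet_masses \<alpha>" "M1 < M2"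
  shows "radius \<alpha> M1 < radius \<alpha> M2"
proof (rule ccontr)
  assume n: "\<not> radius \<alpha> M1 < radius \<alpha> M2"
  have "droplet_mass \<alpha> (radius \<alpha> M2) \<le> droplet_mass \<alpha> (radius \<alpha> M1)"
  proof (cases "radius \<alpha> M2 = radius \<alpha> M1")
    case False
    then have "radius \<alpha> M2 < radius \<alpha> M1" using n by simp
    then show ?thesis
      using droplet_mass_less[OF \<alpha>] min_profile_droplet(1)[OF assms(2)] min_profile_droplet(3)[OF assms(1)] by (meson less_imp_le)
  qed simp
  then show False using min_profile_droplet(4)[OF assms(1)] min_profile_droplet(4)[OF assms(2)] assms(3) by simp
qed

text \<open>Radius pi occurs exactly at the critical mass, where the droplet reaches 0 only at the
  point pi. This is the single droplet mass at which the strict bound on the radius fails.\<close>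

lemma radius_eq_pi_iff:
  assumes "M \<in> droplet_masses \<alpha>"
  shows "radius \<alpha> M = pi \<longleftrightarrow> M * (1 - \<alpha>\<^sup>2) = 2 * pi"
proof
  assume r: "radius \<alpha> M = pi"
  have "\<alpha> * pi < pi" using radius_bound(3)[OF \<alpha>, of pi] min_profile_droplet(3)[OF assms] r by simp
  then have a: "\<alpha> < 1" by simp
  then show "M * (1 - \<alpha>\<^sup>2) = 2 * pi"
    using min_profile_droplet(4)[OF assms] droplet_mass_pi[OF \<alpha> a] square_less_1[OF a] r by (simp add: field_simps)
next
  assume m: "M * (1 - \<alpha>\<^sup>2) = 2 * pi"
  have "M > 0" using assms by (simp add: droplet_masses_def)
  have "\<alpha> < 1"
  proof (rule ccontr)
    assume "\<not> \<alpha> < 1"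
    then have "1 - \<alpha>\<^sup>2 \<le> 0" by simp
    then have "M * (1 - \<alpha>\<^sup>2) \<le> 0" using \<open>M > 0\<close> by (simp add: mult_le_0_iff)
    then show False using m pi_gt_zero by linarith
  qed
  moreover have "M = 2 * pi / (1 - \<alpha>\<^sup>2)"
    using m square_less_1[OF \<open>\<alpha> < 1\<close>] by (subst nonzero_eq_divide_eq) auto
  ultimately have "droplet_mass \<alpha> pi = M" using droplet_mass_pi[OF \<alpha>] by simp
  then show "radius \<alpha> M = pi" using radius_droplet_mass[OF \<alpha>, of pi] radius_bound(2)[OF \<alpha> \<open>\<alpha> < 1\<close>] by simp
qed

text \<open>A by-product of existence: the minimizer of mass \<open>M\<close> is a droplet, and its
  radius is a preimage of \<open>M\<close>.\<close>

lemma droplet_masses_subset: "droplet_masses \<alpha> \<subseteq> droplet_mass \<alpha> ` {0<..<radius_bound \<alpha>}"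
proof
  fix M assume "M \<in> droplet_masses \<alpha>"
  note r = min_profile_droplet[OF this]
  show "M \<in> droplet_mass \<alpha> ` {0<..<radius_bound \<alpha>}"
    using r(1,3) r(4)[symmetric] by (intro image_eqI[of _ _ "radius \<alpha> M"]) auto
qed

lemma full_radius:
  assumes "M > 0"
  shows "0 < full_radius \<alpha> M" "full_radius \<alpha> M \<le> pi" "full_radius \<alpha> M < radius_bound \<alpha>"
  using min_profile_droplet[of M] assms radius_bound(2)[OF \<alpha>]
  by (auto simp: full_radius_def droplet_masses_def full_support_masses_def)

lemma full_support_upward: "M1 \<in> full_support_masses \<alpha> \<Longrightarrow> M1 \<le> M2 \<Longrightarrow> M2 \<in> full_support_masses \<alpha>"
proof -
  assume M: "M1 \<in> full_support_masses \<alpha>" "M1 \<le> M2"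
  then have "\<alpha>\<^sup>2 < 1" using square_less_1 by (simp add: full_support_masses_def)
  then have "M1 * (1 - \<alpha>\<^sup>2) \<le> M2 * (1 - \<alpha>\<^sup>2)" using M by (intro mult_right_mono) auto
  then show ?thesis using M by (auto simp: full_support_masses_def)
qed

lemma full_radius_mono:
  assumes "0 < M1" "M1 \<le> M2"
  shows "full_radius \<alpha> M1 \<le> full_radius \<alpha> M2"
proof (cases "M2 \<in> full_support_masses \<alpha> \<or> M1 = M2")
  case True
  then show ?thesis using full_radius(2)[OF assms(1)] by (auto simp: full_radius_def)
next
  case False
  then have "M1 \<notin> full_support_masses \<alpha>" using full_support_upward assms by blast
  then show ?thesis
    using False assms radius_strict_mono[of M1 M2] by (simp add: full_radius_def droplet_masses_def)
qed

text \<open>A single formula makes the two regimes comparable: beyond the critical mass the shape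
  stays that of the droplet of radius pi and only \<open>floor_height\<close> grows.\<close>

lemma min_profile_profile:
  assumes M: "M > 0" and x: "x \<in> {-pi..pi}"
  shows "min_profile M x = floor_height \<alpha> M + droplet \<alpha> (full_radius \<alpha> M) (clip (full_radius \<alpha> M) x)"
proof (cases "M \<in> full_support_masses \<alpha>")
  case True
  then have a: "\<alpha> < 1" "M * (1 - \<alpha>\<^sup>2) > 2 * pi" by (auto simp: full_support_masses_def)
  have "1 / (1 - \<alpha>\<^sup>2) < M / (2 * pi)" using a square_less_1[OF a(1)] by (simp add: field_simps)
  then have "floor_height \<alpha> M = M / (2 * pi) - 1 / (1 - \<alpha>\<^sup>2)" using a by (simp add: floor_height_def)
  moreover have "clip pi x = x" using x by (simp add: clip_def)
  moreover have "droplet \<alpha> pi x = 1 / (1 - \<alpha>\<^sup>2) * cos x + 1 / (1 - \<alpha>\<^sup>2)"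
    using a by (simp add: droplet_def coeff_A_alt du0_def u0_def)
  ultimately show ?thesis using min_profile_full[OF True x] True by (simp add: full_radius_def)
next
  case False
  then have D: "M \<in> droplet_masses \<alpha>" using M by (simp add: droplet_masses_def)
  note r = min_profile_droplet[OF D]
  have "floor_height \<alpha> M = 0"
  proof (cases "\<alpha> < 1")
    case True
    then have "M * (1 - \<alpha>\<^sup>2) \<le> 2 * pi" using False M by (simp add: full_support_masses_def)
    then have "M / (2 * pi) \<le> 1 / (1 - \<alpha>\<^sup>2)" using square_less_1[OF True] by (simp add: field_simps)
    then show ?thesis by (simp add: floor_height_def)
  qed (simp add: floor_height_def)
  moreover have "droplet \<alpha> (radius \<alpha> M) (clip (radius \<alpha> M) x)
      = (if \<bar>x\<bar> < radius \<alpha> M then droplet \<alpha> (radius \<alpha> M) x else 0)"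
  proof -
    consider "\<bar>x\<bar> < radius \<alpha> M" | "radius \<alpha> M \<le> x" | "x \<le> - radius \<alpha> M" by linarith
    then show ?thesis using r(1) by cases (simp_all add: clip_def droplet_edge droplet_even)
  qed
  ultimately show ?thesis using r(5)[OF x] False by (simp add: full_radius_def)
qed

lemma droplet_slope_edge:
  assumes "0 < t" "t < radius_bound \<alpha>"
  shows "droplet_slope \<alpha> t t = 0" "droplet_slope \<alpha> t (- t) = 0"
  using sin_radius_pos[OF \<alpha> assms] \<alpha> by (simp_all add: droplet_slope_def coeff_A_alt du0_odd)

lemma DERIV_min_profile:
  assumes M: "M > 0"
  shows "(min_profile M has_real_derivative droplet_slope \<alpha> (full_radius \<alpha> M) (clip (full_radius \<alpha> M) (wrap x))) (at x)"
proof -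
  define t where "t = full_radius \<alpha> M"
  have t: "0 < t" "t \<le> pi" "t < radius_bound \<alpha>" unfolding t_def by (rule full_radius[OF M])+
  have d: "(droplet \<alpha> t has_real_derivative droplet_slope \<alpha> t x) (at x)" for x
    unfolding droplet_slope_def by (rule DERIV_droplet)
  have "((\<lambda>x. floor_height \<alpha> M + droplet \<alpha> t (clip t x)) has_real_derivative droplet_slope \<alpha> t (clip t x)) (at x)" for x
    using DERIV_add[OF DERIV_const DERIV_clip[OF t(1) d droplet_slope_edge[OF t(1,3)]]] by simp
  then show ?thesis
    unfolding t_def[symmetric]
    by (intro DERIV_periodic[where F'="\<lambda>x. droplet_slope \<alpha> t (clip t x)"] reduced_minimizerD(1)[OF min_profile[OF M]])
      (use min_profile_profile[OF M] droplet_slope_edge[OF t(1,3)] clip_pi[OF t(1,2)] in \<open>auto simp: t_def\<close>)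
qed

lemma deriv_min_profile:
  "M > 0 \<Longrightarrow> deriv (min_profile M) x = droplet_slope \<alpha> (full_radius \<alpha> M) (clip (full_radius \<alpha> M) (wrap x))"
  by (rule DERIV_imp_deriv[OF DERIV_min_profile])

text \<open>The second derivative of a droplet is bounded by a constant plus
  \<open>\<alpha>^2 * \<bar>coeff_A \<alpha> t\<bar>\<close>. As \<open>K\<close> does not depend on
  \<open>t\<close>, the estimate is uniform wherever \<open>coeff_A\<close> stays bounded.\<close>

lemma slope_bounds:
  obtains K where "K > 0" "\<And>t x y. x \<in> {-pi..pi} \<Longrightarrow> y \<in> {-pi..pi} \<Longrightarrow>
      \<bar>droplet_slope \<alpha> t x - droplet_slope \<alpha> t y\<bar> \<le> (K + \<alpha>\<^sup>2 * \<bar>coeff_A \<alpha> t\<bar>) * \<bar>x - y\<bar>"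
    "\<And>t x. x \<in> {-pi..pi} \<Longrightarrow> \<bar>droplet_slope \<alpha> t x\<bar> \<le> (K + \<alpha>\<^sup>2 * \<bar>coeff_A \<alpha> t\<bar>) * pi"
proof -
  have "continuous_on UNIV (u0 \<alpha>)"
    by (rule DERIV_continuous_on) (rule has_field_derivative_at_within[OF DERIV_u0])
  then have "bounded (u0 \<alpha> ` {-pi..pi})"
    by (intro compact_imp_bounded compact_continuous_image) (auto intro: continuous_on_subset)
  then obtain C where C: "C > 0" "\<And>x. x \<in> {-pi..pi} \<Longrightarrow> \<bar>u0 \<alpha> x\<bar> \<le> C" by (auto simp: bounded_pos)
  define K where "K = 1 + \<alpha>\<^sup>2 * C"
  have lip: "\<bar>droplet_slope \<alpha> t x - droplet_slope \<alpha> t y\<bar> \<le> (K + \<alpha>\<^sup>2 * \<bar>coeff_A \<alpha> t\<bar>) * \<bar>x - y\<bar>"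
    if "x \<in> {-pi..pi}" "y \<in> {-pi..pi}" for t x y
  proof -
    have "norm (droplet_slope \<alpha> t x - droplet_slope \<alpha> t y) \<le> (K + \<alpha>\<^sup>2 * \<bar>coeff_A \<alpha> t\<bar>) * norm (x - y)"
    proof (rule field_differentiable_bound[where S="{-pi..pi}" and f'="\<lambda>z. (- cos z - \<alpha>\<^sup>2 * u0 \<alpha> z) - coeff_A \<alpha> t * \<alpha> * (cos (\<alpha> * z) * \<alpha>)"])
      fix z assume z: "z \<in> {-pi..pi}"
      show "(droplet_slope \<alpha> t has_real_derivative (- cos z - \<alpha>\<^sup>2 * u0 \<alpha> z) - coeff_A \<alpha> t * \<alpha> * (cos (\<alpha> * z) * \<alpha>)) (at z within {-pi..pi})"
        unfolding droplet_slope_def[abs_def]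
        by (auto intro!: derivative_eq_intros has_field_derivative_at_within[OF DERIV_du0[OF \<alpha>]])
      have "\<bar>\<alpha>\<^sup>2 * u0 \<alpha> z\<bar> \<le> \<alpha>\<^sup>2 * C" using C(2)[OF z] by (simp add: abs_mult mult_left_mono)
      moreover have "\<bar>coeff_A \<alpha> t * \<alpha> * (cos (\<alpha> * z) * \<alpha>)\<bar> \<le> \<alpha>\<^sup>2 * \<bar>coeff_A \<alpha> t\<bar>"
      proof -
        have "\<bar>coeff_A \<alpha> t * \<alpha> * (cos (\<alpha> * z) * \<alpha>)\<bar> = (\<alpha>\<^sup>2 * \<bar>coeff_A \<alpha> t\<bar>) * \<bar>cos (\<alpha> * z)\<bar>"
          using \<alpha> by (simp add: abs_mult power2_eq_square mult_ac)
        also have "\<dots> \<le> (\<alpha>\<^sup>2 * \<bar>coeff_A \<alpha> t\<bar>) * 1" by (intro mult_left_mono) auto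
        finally show ?thesis by simp
      qed
      moreover have "\<bar>cos z\<bar> \<le> 1" by simp
      ultimately show "norm ((- cos z - \<alpha>\<^sup>2 * u0 \<alpha> z) - coeff_A \<alpha> t * \<alpha> * (cos (\<alpha> * z) * \<alpha>)) \<le> K + \<alpha>\<^sup>2 * \<bar>coeff_A \<alpha> t\<bar>"
        unfolding K_def real_norm_def by linarith
    qed (use that in auto)
    then show ?thesis by simp
  qed
  have "K > 0" using C(1) by (simp add: K_def add_pos_nonneg)
  moreover have "\<bar>droplet_slope \<alpha> t x\<bar> \<le> (K + \<alpha>\<^sup>2 * \<bar>coeff_A \<alpha> t\<bar>) * pi" if x: "x \<in> {-pi..pi}" for t x
  proof -
    have "\<bar>droplet_slope \<alpha> t x\<bar> \<le> (K + \<alpha>\<^sup>2 * \<bar>coeff_A \<alpha> t\<bar>) * \<bar>x\<bar>"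
      using lip[of x 0 t] x by (simp add: droplet_slope_def du0_0)
    also have "\<dots> \<le> (K + \<alpha>\<^sup>2 * \<bar>coeff_A \<alpha> t\<bar>) * pi"
      using x \<open>K > 0\<close> by (intro mult_left_mono) auto
    finally show ?thesis .
  qed
  ultimately show ?thesis using that lip by blast
qed

lemma lipschitz_deriv_min_profile:
  obtains K where "K > 0" "\<And>M. M > 0 \<Longrightarrow> (K + \<alpha>\<^sup>2 * \<bar>coeff_A \<alpha> (full_radius \<alpha> M)\<bar>)-lipschitz_on UNIV (deriv (min_profile M))"
    "\<And>M x. M > 0 \<Longrightarrow> \<bar>deriv (min_profile M) x\<bar> \<le> (K + \<alpha>\<^sup>2 * \<bar>coeff_A \<alpha> (full_radius \<alpha> M)\<bar>) * pi"
proof -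
  obtain K where K: "K > 0" "\<And>t x y. x \<in> {-pi..pi} \<Longrightarrow> y \<in> {-pi..pi} \<Longrightarrow>
      \<bar>droplet_slope \<alpha> t x - droplet_slope \<alpha> t y\<bar> \<le> (K + \<alpha>\<^sup>2 * \<bar>coeff_A \<alpha> t\<bar>) * \<bar>x - y\<bar>"
    "\<And>t x. x \<in> {-pi..pi} \<Longrightarrow> \<bar>droplet_slope \<alpha> t x\<bar> \<le> (K + \<alpha>\<^sup>2 * \<bar>coeff_A \<alpha> t\<bar>) * pi"
    by (rule slope_bounds, rule that)
  have clip_range: "clip t x \<in> {-pi..pi}" if "0 < t" "t \<le> pi" for t x
    using that by (auto simp: clip_def)
  show ?thesis
  proof (rule that[OF K(1)])
    fix M :: real assume M: "M > 0"
    define t where "t = full_radius \<alpha> M"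
    have t: "0 < t" "t \<le> pi" "t < radius_bound \<alpha>" unfolding t_def by (rule full_radius[OF M])+
    define L where "L = K + \<alpha>\<^sup>2 * \<bar>coeff_A \<alpha> t\<bar>"
    have L: "L \<ge> 0" using K(1) by (simp add: L_def)
    have "L-lipschitz_on {-pi..pi} (\<lambda>x. droplet_slope \<alpha> t (clip t x))"
    proof (rule lipschitz_onI[OF _ L])
      fix x y
      have "\<bar>droplet_slope \<alpha> t (clip t x) - droplet_slope \<alpha> t (clip t y)\<bar> \<le> L * \<bar>clip t x - clip t y\<bar>"
        unfolding L_def by (intro K(2) clip_range t)
      also have "\<dots> \<le> L * \<bar>x - y\<bar>" using clip_lipschitz L by (intro mult_left_mono)
      finally show "dist (droplet_slope \<alpha> t (clip t x)) (droplet_slope \<alpha> t (clip t y)) \<le> L * dist x y"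
        by (simp add: dist_real_def)
    qed
    from lipschitz_wrap[OF this] have "L-lipschitz_on UNIV (\<lambda>x. droplet_slope \<alpha> t (clip t (wrap x)))"
      using droplet_slope_edge[OF t(1,3)] clip_pi[OF t(1,2)] by simp
    then show "(K + \<alpha>\<^sup>2 * \<bar>coeff_A \<alpha> (full_radius \<alpha> M)\<bar>)-lipschitz_on UNIV (deriv (min_profile M))"
      unfolding t_def[symmetric] L_def[symmetric] using deriv_min_profile[OF M, folded t_def] by (simp add: fun_eq_iff[symmetric] ext)
    show "\<bar>deriv (min_profile M) x\<bar> \<le> (K + \<alpha>\<^sup>2 * \<bar>coeff_A \<alpha> (full_radius \<alpha> M)\<bar>) * pi" for x
      unfolding deriv_min_profile[OF M] using full_radius[OF M] by (intro K(3) clip_range)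
  qed
qed

end

section \<open>Continuity and monotonicity in the mass\<close>

context
  fixes \<alpha> :: real
  assumes \<alpha>: "\<alpha> > 0"
begin

text \<open>Inside the smaller support the slopes differ by
  \<open>\<alpha> * sin (\<alpha> * x)\<close> times the difference of the coefficients. Between the
  edges only the larger droplet has a slope, \<open>\<alpha> * (coeff_A \<alpha> x - coeff_A
  \<alpha> t) * sin (\<alpha> * x)\<close>, and monotonicity of \<open>coeff_A\<close> bounds it by
  the same quantity. Oddness covers negative \<open>x\<close>.\<close>

lemma clipped_slope_diff:
  assumes "0 < s" "s \<le> t" "t < radius_bound \<alpha>"
  shows "\<bar>droplet_slope \<alpha> s (clip s x) - droplet_slope \<alpha> t (clip t x)\<bar> \<le> \<alpha> * \<bar>coeff_A \<alpha> s - coeff_A \<alpha> t\<bar>"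
proof -
  have t: "0 < t" and s: "s < radius_bound \<alpha>" using assms by auto
  have mono: "coeff_A \<alpha> a \<le> coeff_A \<alpha> b" if "s \<le> a" "a \<le> b" "b \<le> t" for a b
    using coeff_A_less[OF \<alpha>, of a b] that assms by (cases "a = b") auto
  have pos: "\<bar>droplet_slope \<alpha> s (clip s x) - droplet_slope \<alpha> t (clip t x)\<bar> \<le> \<alpha> * \<bar>coeff_A \<alpha> s - coeff_A \<alpha> t\<bar>"
    if x: "0 \<le> x" for x
  proof -
    consider "x < s" | "s \<le> x" "x < t" | "t \<le> x" by linarith
    then show ?thesis
    proof cases
      case 1
      then have "clip s x = x" "clip t x = x" using x assms by (auto simp: clip_def)
      then have "\<bar>droplet_slope \<alpha> s (clip s x) - droplet_slope \<alpha> t (clip t x)\<bar>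
          = \<alpha> * \<bar>coeff_A \<alpha> s - coeff_A \<alpha> t\<bar> * \<bar>sin (\<alpha> * x)\<bar>"
      proof -
        have "droplet_slope \<alpha> s x - droplet_slope \<alpha> t x = - (\<alpha> * (coeff_A \<alpha> s - coeff_A \<alpha> t) * sin (\<alpha> * x))"
          by (simp add: droplet_slope_def algebra_simps)
        then show ?thesis using \<open>clip s x = x\<close> \<open>clip t x = x\<close> \<alpha> by (simp add: abs_mult)
      qed
      also have "\<dots> \<le> \<alpha> * \<bar>coeff_A \<alpha> s - coeff_A \<alpha> t\<bar> * 1" using \<alpha> by (intro mult_left_mono) auto
      finally show ?thesis by simp
    next
      case 2
      then have c: "clip s x = s" "clip t x = x" using assms by (auto simp: clip_def)
      have sx: "sin (\<alpha> * x) > 0" using 2 assms by (intro sin_radius_pos[OF \<alpha>]) auto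
      have "droplet_slope \<alpha> t x = \<alpha> * (coeff_A \<alpha> x - coeff_A \<alpha> t) * sin (\<alpha> * x)"
        using sx \<alpha> by (simp add: droplet_slope_def coeff_A_alt[of \<alpha> x] algebra_simps)
      then have "\<bar>droplet_slope \<alpha> s (clip s x) - droplet_slope \<alpha> t (clip t x)\<bar>
          = \<alpha> * \<bar>coeff_A \<alpha> x - coeff_A \<alpha> t\<bar> * \<bar>sin (\<alpha> * x)\<bar>"
        using c droplet_slope_edge[OF \<alpha> assms(1) s] \<alpha> by (simp add: abs_mult)
      also have "\<dots> \<le> \<alpha> * \<bar>coeff_A \<alpha> x - coeff_A \<alpha> t\<bar> * 1" using \<alpha> by (intro mult_left_mono) auto
      also have "\<bar>coeff_A \<alpha> x - coeff_A \<alpha> t\<bar> \<le> \<bar>coeff_A \<alpha> s - coeff_A \<alpha> t\<bar>"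
        using mono[of s x] mono[of x t] 2 by simp
      finally show ?thesis using \<alpha> by simp
    next
      case 3
      then have "clip s x = s" "clip t x = t" using assms by (auto simp: clip_def)
      then show ?thesis
        using droplet_slope_edge[OF \<alpha> assms(1) s] droplet_slope_edge[OF \<alpha> t assms(3)] \<alpha> by simp
    qed
  qed
  have odd: "droplet_slope \<alpha> r (clip r (- x)) = - droplet_slope \<alpha> r (clip r x)" if "r > 0" for r x
  proof -
    have "clip r (- x) = - clip r x" using that by (auto simp: clip_def min_def max_def)
    then show ?thesis by (simp add: droplet_slope_def du0_odd)
  qed
  show ?thesis
    using pos[of x] pos[of "- x"] unfolding odd[OF assms(1)] odd[OF t]
    by (cases "0 \<le> x") (auto simp: abs_minus_commute)
qed

abbreviation slope_coeff :: "real \<Rightarrow> real" where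
  "slope_coeff M \<equiv> coeff_A \<alpha> (full_radius \<alpha> M)"

lemma deriv_profile_diff:
  assumes "M1 > 0" "M2 > 0"
  shows "\<bar>deriv (min_profile \<alpha> M1) x - deriv (min_profile \<alpha> M2) x\<bar> \<le> \<alpha> * \<bar>slope_coeff M1 - slope_coeff M2\<bar>"
  unfolding deriv_min_profile[OF \<alpha> assms(1)] deriv_min_profile[OF \<alpha> assms(2)]
  using clipped_slope_diff[of "full_radius \<alpha> M1" "full_radius \<alpha> M2" "wrap x"]
    clipped_slope_diff[of "full_radius \<alpha> M2" "full_radius \<alpha> M1" "wrap x"]
    full_radius[OF \<alpha> assms(1)] full_radius[OF \<alpha> assms(2)]
  by (cases "full_radius \<alpha> M1 \<le> full_radius \<alpha> M2") (auto simp: abs_minus_commute)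

lemma profile_pi: "M > 0 \<Longrightarrow> min_profile \<alpha> M pi = floor_height \<alpha> M"
  using min_profile_profile[OF \<alpha>, of M pi] full_radius[OF \<alpha>, of M] by (simp add: clip_pi droplet_edge)

lemma has_derivative_profile:
  "M > 0 \<Longrightarrow> (min_profile \<alpha> M has_real_derivative deriv (min_profile \<alpha> M) x) (at x)"
  using DERIV_min_profile[OF \<alpha>] deriv_min_profile[OF \<alpha>] by simp

text \<open>The slope estimate is integrated from pi, where both profiles equal their floor
  heights.\<close>

lemma profile_diff:
  assumes M: "M1 > 0" "M2 > 0"
  shows "\<bar>min_profile \<alpha> M1 x - min_profile \<alpha> M2 x\<bar>
    \<le> \<bar>floor_height \<alpha> M1 - floor_height \<alpha> M2\<bar> + \<alpha> * \<bar>slope_coeff M1 - slope_coeff M2\<bar> * (2 * pi)"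
proof -
  define h where "h x = min_profile \<alpha> M1 x - min_profile \<alpha> M2 x" for x
  define B where "B = \<alpha> * \<bar>slope_coeff M1 - slope_coeff M2\<bar>"
  have "norm (h (wrap x) - h pi) \<le> B * norm (wrap x - pi)"
  proof (rule field_differentiable_bound[where S=UNIV and f'="\<lambda>x. deriv (min_profile \<alpha> M1) x - deriv (min_profile \<alpha> M2) x"])
    fix z :: real
    show "(h has_real_derivative deriv (min_profile \<alpha> M1) z - deriv (min_profile \<alpha> M2) z) (at z within UNIV)"
      unfolding h_def[abs_def] using DERIV_diff[OF has_derivative_profile[OF M(1)] has_derivative_profile[OF M(2)]] by simp
    show "norm (deriv (min_profile \<alpha> M1) z - deriv (min_profile \<alpha> M2) z) \<le> B"
      using deriv_profile_diff[OF M] by (simp add: B_def)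
  qed auto
  also have "\<dots> \<le> B * (2 * pi)"
    using wrap_range[of x] \<alpha> by (intro mult_left_mono) (auto simp: B_def)
  finally have "\<bar>h (wrap x)\<bar> \<le> \<bar>h pi\<bar> + B * (2 * pi)" by simp
  moreover have "h (wrap x) = h x"
    using reduced_minimizerD(1)[OF min_profile[OF \<alpha>]] M by (simp add: h_def periodic_2pi_wrap)
  ultimately show ?thesis using profile_pi[OF M(1)] profile_pi[OF M(2)] by (simp add: h_def B_def)
qed

text \<open>Across the critical mass the inverse of \<open>droplet_mass\<close> continues smoothly
  to radii beyond pi, and \<open>full_radius\<close> is locally the minimum of pi and this
  continuation.\<close>

lemma isCont_full_radius:
  assumes M: "M > 0"
  shows "isCont (full_radius \<alpha>) M"
proof (cases "M \<in> full_support_masses \<alpha>")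
  case True
  have "full_support_masses \<alpha> = {M. 0 < M} \<inter> {M. 2 * pi < M * (1 - \<alpha>\<^sup>2)}"
    using True by (auto simp: full_support_masses_def)
  also have "open \<dots>" by (intro open_Int open_Collect_less continuous_intros)
  finally have "eventually (\<lambda>y. full_radius \<alpha> y = pi) (nhds M)"
    using True by (auto simp: eventually_nhds full_radius_def)
  then show ?thesis by (subst isCont_cong) auto
next
  case False
  define T where "T = droplet_mass \<alpha> ` {0<..<radius_bound \<alpha>}"
  have MT: "M \<in> T"
    using droplet_masses_subset[OF \<alpha>] False M by (auto simp: T_def droplet_masses_def)
  obtain S g where S: "open S" "T \<subseteq> S" "\<forall>x\<in>T. g x = radius \<alpha> x" "\<forall>n. (deriv ^^ n) g differentiable_on S"
    using smooth_radius[OF \<alpha>] unfolding smooth_on_def T_def by blast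
  have "g differentiable_on S" using S(4)[rule_format, of 0] by simp
  then have "continuous_on S g" by (rule differentiable_imp_continuous_on)
  then have cg: "isCont g M" using S(1,2) MT by (auto simp: continuous_on_eq_continuous_at)
  have oT: "open T"
  proof -
    have "continuous_on {0<..<radius_bound \<alpha>} (droplet_mass \<alpha>)"
    proof (rule DERIV_continuous_on)
      fix t assume "t \<in> {0<..<radius_bound \<alpha>}"
      then show "(droplet_mass \<alpha> has_real_derivative 2 * (wronskian \<alpha> t / (\<alpha> * (sin (\<alpha> * t))\<^sup>2)) *
          (sin (\<alpha> * t) - \<alpha> * t * cos (\<alpha> * t)) / \<alpha>) (at t within {0<..<radius_bound \<alpha>})"
        using sin_radius_pos[OF \<alpha>, of t] by (intro has_field_derivative_at_within[OF DERIV_droplet_mass[OF \<alpha>]]) auto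
    qed
    then show ?thesis unfolding T_def by (intro invariance_of_domain inj_droplet_mass[OF \<alpha>]) auto
  qed
  have eq: "full_radius \<alpha> y = min pi (g y)" if y: "y \<in> T" "y > 0" for y
  proof (cases "y \<in> full_support_masses \<alpha>")
    case True
    obtain t where t: "0 < t" "t < radius_bound \<alpha>" "y = droplet_mass \<alpha> t" using y by (auto simp: T_def)
    have a: "\<alpha> < 1" "y * (1 - \<alpha>\<^sup>2) > 2 * pi" using True by (auto simp: full_support_masses_def)
    have "pi \<le> t"
    proof (rule ccontr)
      assume "\<not> pi \<le> t"
      then have "y < droplet_mass \<alpha> pi"
        using droplet_mass_less[OF \<alpha>, of t pi] t radius_bound(2)[OF \<alpha> a(1)] by simp
      then have "y * (1 - \<alpha>\<^sup>2) < 2 * pi"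
        using droplet_mass_pi[OF \<alpha> a(1)] square_less_1[OF \<alpha> a(1)] by (simp add: pos_less_divide_eq)
      then show False using a by simp
    qed
    then show ?thesis
      using True S(3) y radius_droplet_mass[OF \<alpha> t(1,2)] t(3) by (simp add: full_radius_def)
  next
    case False
    then have "y \<in> droplet_masses \<alpha>" using y by (simp add: droplet_masses_def)
    then show ?thesis
      using False S(3) y min_profile_droplet(2)[OF \<alpha>, of y] by (simp add: full_radius_def)
  qed
  have "isCont (\<lambda>y. min pi (g y)) M" by (intro continuous_intros cg)
  moreover have "eventually (\<lambda>y. y \<in> T \<inter> {0<..}) (nhds M)"
    using oT MT M by (intro eventually_nhds_in_open) auto
  then have "eventually (\<lambda>y. full_radius \<alpha> y = min pi (g y)) (nhds M)"
    by eventually_elim (auto simp: eq)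
  ultimately show ?thesis by (subst isCont_cong)
qed

lemma isCont_slope_coeff:
  assumes M: "M > 0"
  shows "isCont slope_coeff M"
proof (rule isCont_o2[OF isCont_full_radius[OF M]])
  have "sin (\<alpha> * full_radius \<alpha> M) > 0"
    using full_radius[OF \<alpha> M] by (intro sin_radius_pos[OF \<alpha>])
  then show "isCont (coeff_A \<alpha>) (full_radius \<alpha> M)"
    using DERIV_coeff_A[OF \<alpha>] DERIV_isCont by (metis less_irrefl)
qed

lemma isCont_floor_height: "isCont (floor_height \<alpha>) M"
  unfolding floor_height_def[abs_def] by (cases "\<alpha> < 1") (auto intro!: continuous_intros)

text \<open>The norm is dominated by an expression in \<open>floor_height\<close> and
  \<open>slope_coeff\<close> that is continuous in the mass, hence bounded on a compact interval of
  positive masses.\<close>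

lemma profile_norm_bounded:
  assumes a: "0 < a"
  shows "bdd_above ((\<lambda>M. C1_holder_norm 1 (min_profile \<alpha> M)) ` {a..b})"
proof -
  obtain K where K: "K > 0"
    "\<And>M. M > 0 \<Longrightarrow> (K + \<alpha>\<^sup>2 * \<bar>slope_coeff M\<bar>)-lipschitz_on UNIV (deriv (min_profile \<alpha> M))"
    "\<And>M x. M > 0 \<Longrightarrow> \<bar>deriv (min_profile \<alpha> M) x\<bar> \<le> (K + \<alpha>\<^sup>2 * \<bar>slope_coeff M\<bar>) * pi"
    by (rule lipschitz_deriv_min_profile[OF \<alpha>], rule that)
  define B where "B M = (\<bar>floor_height \<alpha> M\<bar> + (K + \<alpha>\<^sup>2 * \<bar>slope_coeff M\<bar>) * pi * (2 * pi))
    + (K + \<alpha>\<^sup>2 * \<bar>slope_coeff M\<bar>) * pi + (K + \<alpha>\<^sup>2 * \<bar>slope_coeff M\<bar>)" for M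
  have le: "C1_holder_norm 1 (min_profile \<alpha> M) \<le> B M" if M: "M > 0" for M
    unfolding B_def
  proof (rule C1_holder_norm_bounds(2))
    define L where "L = K + \<alpha>\<^sup>2 * \<bar>slope_coeff M\<bar>"
    have L: "L \<ge> 0" using K(1) by (simp add: L_def)
    fix x y :: real
    show "\<bar>deriv (min_profile \<alpha> M) x\<bar> \<le> (K + \<alpha>\<^sup>2 * \<bar>slope_coeff M\<bar>) * pi" by (rule K(3)[OF M])
    show "\<bar>deriv (min_profile \<alpha> M) x - deriv (min_profile \<alpha> M) y\<bar> \<le> (K + \<alpha>\<^sup>2 * \<bar>slope_coeff M\<bar>) * \<bar>x - y\<bar> powr 1"
      using lipschitz_onD[OF K(2)[OF M], of x y] by (simp add: dist_real_def)
    have "norm (min_profile \<alpha> M (wrap x) - min_profile \<alpha> M pi) \<le> (L * pi) * norm (wrap x - pi)"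
      by (rule field_differentiable_bound[where S=UNIV and f'="deriv (min_profile \<alpha> M)"])
        (use has_derivative_profile[OF M] K(3)[OF M] in \<open>auto simp: L_def\<close>)
    also have "\<dots> \<le> (L * pi) * (2 * pi)"
      using wrap_range[of x] L by (intro mult_left_mono) auto
    finally have "\<bar>min_profile \<alpha> M (wrap x)\<bar> \<le> \<bar>floor_height \<alpha> M\<bar> + L * pi * (2 * pi)"
      using profile_pi[OF M] by simp
    then show "\<bar>min_profile \<alpha> M x\<bar> \<le> \<bar>floor_height \<alpha> M\<bar> + (K + \<alpha>\<^sup>2 * \<bar>slope_coeff M\<bar>) * pi * (2 * pi)"
      using periodic_2pi_wrap[OF reduced_minimizerD(1)[OF min_profile[OF \<alpha> M]], of x]
      by (simp add: L_def)
  qed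
  have "continuous_on {a..b} B"
  proof (rule continuous_at_imp_continuous_on, rule ballI)
    fix M assume "M \<in> {a..b}"
    then have M: "M > 0" using a by simp
    show "isCont B M"
      unfolding B_def[abs_def] by (intro continuous_intros isCont_slope_coeff[OF M] isCont_floor_height)
  qed
  then have "bdd_above (B ` {a..b})"
    by (intro bounded_imp_bdd_above compact_imp_bounded compact_continuous_image) auto
  then obtain C where C: "\<forall>M\<in>{a..b}. B M \<le> C" by (auto simp: bdd_above_def)
  have "C1_holder_norm 1 (min_profile \<alpha> M) \<le> C" if M: "M \<in> {a..b}" for M
  proof -
    have "M > 0" using M a by simp
    then have "C1_holder_norm 1 (min_profile \<alpha> M) \<le> B M" by (rule le)
    also have "B M \<le> C" using C M by blast
    finally show ?thesis .
  qed
  then show ?thesis by (rule bdd_aboveI2)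
qed

text \<open>The difference of the derivatives is uniformly small by continuity of
  \<open>slope_coeff\<close> and has a bounded Lipschitz constant; interpolation makes its Hoelder
  seminorm small for \<open>\<gamma> < 1\<close>. For \<open>\<gamma> = 1\<close> interpolation
  gains nothing, but near a full-support mass the profiles differ only by constants.\<close>

lemma profile_continuous_in_mass:
  assumes \<gamma>: "0 < \<gamma>" "\<gamma> \<le> 1" and M0: "0 < M0" and alt: "\<gamma> < 1 \<or> M0 \<in> full_support_masses \<alpha>"
  shows "((\<lambda>M. C1_holder_norm \<gamma> (\<lambda>x. min_profile \<alpha> M x - min_profile \<alpha> M0 x)) \<longlongrightarrow> 0) (at M0)"
proof -
  obtain K where K: "K > 0"
    "\<And>M. M > 0 \<Longrightarrow> (K + \<alpha>\<^sup>2 * \<bar>slope_coeff M\<bar>)-lipschitz_on UNIV (deriv (min_profile \<alpha> M))"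
    "\<And>M x. M > 0 \<Longrightarrow> \<bar>deriv (min_profile \<alpha> M) x\<bar> \<le> (K + \<alpha>\<^sup>2 * \<bar>slope_coeff M\<bar>) * pi"
    by (rule lipschitz_deriv_min_profile[OF \<alpha>], rule that)
  define e where "e M = \<alpha> * \<bar>slope_coeff M - slope_coeff M0\<bar>" for M
  define \<Lambda> where "\<Lambda> M = (K + \<alpha>\<^sup>2 * \<bar>slope_coeff M\<bar>) + (K + \<alpha>\<^sup>2 * \<bar>slope_coeff M0\<bar>)" for M
  define B where "B M = (\<bar>floor_height \<alpha> M - floor_height \<alpha> M0\<bar> + e M * (2 * pi)) + e M
    + (2 * e M) powr (1 - \<gamma>) * \<Lambda> M powr \<gamma>" for M
  have e0: "e M \<ge> 0" for M using \<alpha> by (simp add: e_def)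
  have \<Lambda>: "\<Lambda> M > 0" for M
    using K(1) by (simp add: \<Lambda>_def add_pos_nonneg)
  have bound: "0 \<le> C1_holder_norm \<gamma> (\<lambda>x. min_profile \<alpha> M x - min_profile \<alpha> M0 x)"
    "C1_holder_norm \<gamma> (\<lambda>x. min_profile \<alpha> M x - min_profile \<alpha> M0 x) \<le> B M" if M: "M > 0" for M
  proof -
    let ?u = "min_profile \<alpha> M" and ?w = "min_profile \<alpha> M0"
    have d: "deriv (\<lambda>x. ?u x - ?w x) x = deriv ?u x - deriv ?w x" for x
      by (rule DERIV_imp_deriv, rule DERIV_diff[OF has_derivative_profile[OF M] has_derivative_profile[OF M0]])
    have de: "\<bar>deriv ?u x - deriv ?w x\<bar> \<le> e M" for x
      unfolding e_def by (rule deriv_profile_diff[OF M M0])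
    have q: "\<bar>(deriv ?u x - deriv ?w x) - (deriv ?u y - deriv ?w y)\<bar>
        \<le> ((2 * e M) powr (1 - \<gamma>) * \<Lambda> M powr \<gamma>) * \<bar>x - y\<bar> powr \<gamma>" for x y
    proof -
      have "\<bar>deriv ?u x - deriv ?u y\<bar> \<le> (K + \<alpha>\<^sup>2 * \<bar>slope_coeff M\<bar>) * \<bar>x - y\<bar>"
        "\<bar>deriv ?w x - deriv ?w y\<bar> \<le> (K + \<alpha>\<^sup>2 * \<bar>slope_coeff M0\<bar>) * \<bar>x - y\<bar>"
        using lipschitz_onD[OF K(2)[OF M], of x y] lipschitz_onD[OF K(2)[OF M0], of x y]
        by (simp_all add: dist_real_def)
      then have "\<bar>(deriv ?u x - deriv ?w x) - (deriv ?u y - deriv ?w y)\<bar> \<le> \<Lambda> M * \<bar>x - y\<bar>"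
        unfolding \<Lambda>_def distrib_right by linarith
      moreover have "\<bar>(deriv ?u x - deriv ?w x) - (deriv ?u y - deriv ?w y)\<bar> \<le> 2 * e M"
        using de[of x] de[of y] by linarith
      ultimately have "\<bar>(deriv ?u x - deriv ?w x) - (deriv ?u y - deriv ?w y)\<bar>
          \<le> (2 * e M) powr (1 - \<gamma>) * (\<Lambda> M * \<bar>x - y\<bar>) powr \<gamma>"
        using \<gamma> by (intro interpolate_powr) auto
      then show ?thesis using \<Lambda>[of M] by (simp add: powr_mult)
    qed
    have ud: "\<bar>?u x - ?w x\<bar> \<le> \<bar>floor_height \<alpha> M - floor_height \<alpha> M0\<bar> + e M * (2 * pi)" for x
      unfolding e_def by (rule profile_diff[OF M M0])
    show "0 \<le> C1_holder_norm \<gamma> (\<lambda>x. ?u x - ?w x)"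
      by (rule C1_holder_norm_bounds(1)[OF ud]) (use de q in \<open>auto simp: d\<close>)
    show "C1_holder_norm \<gamma> (\<lambda>x. ?u x - ?w x) \<le> B M"
      unfolding B_def by (rule C1_holder_norm_bounds(2)[OF ud]) (use de q in \<open>auto simp: d\<close>)
  qed
  have ls: "(slope_coeff \<longlongrightarrow> slope_coeff M0) (at M0)" using isCont_slope_coeff[OF M0] by (simp add: isCont_def)
  have lf: "(floor_height \<alpha> \<longlongrightarrow> floor_height \<alpha> M0) (at M0)" using isCont_floor_height by (simp add: isCont_def)
  have "(e \<longlongrightarrow> \<alpha> * \<bar>slope_coeff M0 - slope_coeff M0\<bar>) (at M0)"
    unfolding e_def by (intro tendsto_intros ls)
  then have le: "(e \<longlongrightarrow> 0) (at M0)" by simp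
  have l\<Lambda>: "(\<Lambda> \<longlongrightarrow> \<Lambda> M0) (at M0)"
    unfolding \<Lambda>_def by (intro tendsto_intros ls)
  have lp: "((\<lambda>M. (2 * e M) powr (1 - \<gamma>) * \<Lambda> M powr \<gamma>) \<longlongrightarrow> 0 * \<Lambda> M0 powr \<gamma>) (at M0)"
  proof (rule tendsto_mult)
    show "((\<lambda>M. \<Lambda> M powr \<gamma>) \<longlongrightarrow> \<Lambda> M0 powr \<gamma>) (at M0)"
      by (intro tendsto_powr l\<Lambda> tendsto_const) (use \<Lambda>[of M0] in auto)
    show "((\<lambda>M. (2 * e M) powr (1 - \<gamma>)) \<longlongrightarrow> 0) (at M0)"
    proof (cases "\<gamma> < 1")
      case True
      have "((\<lambda>M. 2 * e M) \<longlongrightarrow> 2 * 0) (at M0)" by (intro tendsto_intros le)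
      then have "((\<lambda>M. 2 * e M) \<longlongrightarrow> 0) (at M0)" by simp
      then show ?thesis
        by (rule tendsto_zero_powrI[OF _ tendsto_const]) (use True e0 in auto)
    next
      case False
      then have F: "M0 \<in> full_support_masses \<alpha>" using alt by simp
      have "full_support_masses \<alpha> = {M. 0 < M} \<inter> {M. 2 * pi < M * (1 - \<alpha>\<^sup>2)}"
        using F by (auto simp: full_support_masses_def)
      also have "open \<dots>" by (intro open_Int open_Collect_less continuous_intros)
      finally have "eventually (\<lambda>M. M \<in> full_support_masses \<alpha>) (at M0)"
        using F by (intro eventually_at_in_open') auto
      \<comment> \<open>Here \<open>e M\<close> is 0, and \<open>0 powr 0\<close> is 0, so the
        factor vanishes although the exponent is 0 for \<open>\<gamma> = 1\<close>.\<close>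
      then have "eventually (\<lambda>M. (2 * e M) powr (1 - \<gamma>) = 0) (at M0)"
        by eventually_elim (simp add: e_def full_radius_def F)
      then show ?thesis by (rule tendsto_eventually)
    qed
  qed
  have "(B \<longlongrightarrow> (\<bar>floor_height \<alpha> M0 - floor_height \<alpha> M0\<bar> + 0 * (2 * pi)) + 0 + 0 * \<Lambda> M0 powr \<gamma>) (at M0)"
    unfolding B_def by (intro tendsto_intros lf le lp)
  then have lB: "(B \<longlongrightarrow> 0) (at M0)" by simp
  have ev: "eventually (\<lambda>M. M > 0) (at M0)"
    using M0 eventually_at_in_open'[of "{0<..}" M0] by simp
  show ?thesis
    by (rule tendsto_sandwich[OF _ _ tendsto_const lB]; rule eventually_mono[OF ev]) (rule bound, assumption)+
qed

lemma profile_C11: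
  assumes M: "M > 0"
  shows "min_profile \<alpha> M \<in> C11_circle"
proof -
  obtain K where K: "\<And>M. M > 0 \<Longrightarrow> (K + \<alpha>\<^sup>2 * \<bar>slope_coeff M\<bar>)-lipschitz_on UNIV (deriv (min_profile \<alpha> M))"
    by (rule lipschitz_deriv_min_profile[OF \<alpha>], rule that)
  have "min_profile \<alpha> M differentiable_on UNIV"
    using has_derivative_profile[OF M] by (auto simp: differentiable_on_def real_differentiable_def)
  then show ?thesis
    using K[OF M] reduced_minimizerD(1)[OF min_profile[OF \<alpha> M]] by (auto simp: C11_circle_def)
qed

text \<open>Between full-support masses only the mean grows. From a droplet mass on, either the
  radius grows and \<open>droplet_less\<close> applies on the smaller support, or both radii are pi;
  then the first mass is critical, the second has full support, and its positive floor height makes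
  the inequality strict.\<close>

lemma profile_strict_mono:
  assumes M: "0 < M1" "M1 < M2" and pos: "min_profile \<alpha> M1 x > 0"
  shows "min_profile \<alpha> M1 x < min_profile \<alpha> M2 x"
proof -
  have M2: "0 < M2" using M by simp
  define y where "y = wrap x"
  have y: "y \<in> {-pi..pi}" using wrap_range[of x] by (auto simp: y_def)
  have w: "min_profile \<alpha> M x = min_profile \<alpha> M y" if "M > 0" for M
    using periodic_2pi_wrap[OF reduced_minimizerD(1)[OF min_profile[OF \<alpha> that]], of x] by (simp add: y_def)
  show ?thesis
  proof (cases "M1 \<in> full_support_masses \<alpha>")
    case True
    have "M2 \<in> full_support_masses \<alpha>" using full_support_upward[OF \<alpha> True] M by simp
    then show ?thesis
      using min_profile_full[OF \<alpha> True y] min_profile_full[OF \<alpha> _ y] M w[OF M(1)] w[OF M2]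
      by (simp add: divide_strict_right_mono)
  next
    case False
    then have D: "M1 \<in> droplet_masses \<alpha>" using M by (simp add: droplet_masses_def)
    note r = min_profile_droplet[OF \<alpha> D]
    have yr: "\<bar>y\<bar> < radius \<alpha> M1" using pos r(5)[OF y] w[OF M(1)] by (auto split: if_splits)
    then have u1: "min_profile \<alpha> M1 y = droplet \<alpha> (radius \<alpha> M1) y" using r(5)[OF y] by simp
    have le: "radius \<alpha> M1 \<le> full_radius \<alpha> M2"
      using full_radius_mono[OF \<alpha> M(1), of M2] M False by (simp add: full_radius_def)
    have c2: "clip (full_radius \<alpha> M2) y = y" using yr le by (auto simp: clip_def)
    note u2 = min_profile_profile[OF \<alpha> M2 y, unfolded c2]
    have fl: "0 \<le> floor_height \<alpha> M2" by (simp add: floor_height_def)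
    show ?thesis
    proof (cases "radius \<alpha> M1 = full_radius \<alpha> M2")
      case False
      then have "droplet \<alpha> (radius \<alpha> M1) y < droplet \<alpha> (full_radius \<alpha> M2) y"
        using le yr full_radius(3)[OF \<alpha> M2] by (intro droplet_less[OF \<alpha>]) auto
      then show ?thesis using u1 u2 fl w[OF M(1)] w[OF M2] by simp
    next
      case True
      have "M2 \<in> full_support_masses \<alpha>"
      proof (rule ccontr)
        assume n: "M2 \<notin> full_support_masses \<alpha>"
        then have "M2 \<in> droplet_masses \<alpha>" using M2 by (simp add: droplet_masses_def)
        then show False using radius_strict_mono[OF \<alpha> D _ M(2)] True n by (simp add: full_radius_def)
      qed
      then have a: "\<alpha> < 1" "M2 * (1 - \<alpha>\<^sup>2) > 2 * pi" by (auto simp: full_support_masses_def)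
      have "1 / (1 - \<alpha>\<^sup>2) < M2 / (2 * pi)" using a square_less_1[OF \<alpha> a(1)] by (simp add: field_simps)
      then have "0 < floor_height \<alpha> M2" using a by (simp add: floor_height_def)
      then show ?thesis using u1 u2 True w[OF M(1)] w[OF M2] by simp
    qed
  qed
qed

lemma profile_strictly_decreasing:
  assumes M: "M > 0"
  shows "strictly_symmetric_decreasing_on_positivity_set (min_profile \<alpha> M)"
  unfolding strictly_symmetric_decreasing_on_positivity_set_def
proof (intro conjI allI ballI impI)
  show "min_profile \<alpha> M (- x) = min_profile \<alpha> M x" for x
    by (rule reduced_minimizer_even[OF min_profile[OF \<alpha> M]])
  fix x y
  assume "x \<in> positivity_set (min_profile \<alpha> M) \<inter> {-pi..pi}"
    and "y \<in> positivity_set (min_profile \<alpha> M) \<inter> {-pi..pi}" and xy: "\<bar>x\<bar> < \<bar>y\<bar>"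
  then have x: "x \<in> {-pi..pi}" and y: "y \<in> {-pi..pi}" "min_profile \<alpha> M y > 0"
    by (auto simp: positivity_set_def)
  show "min_profile \<alpha> M y < min_profile \<alpha> M x"
  proof (cases "M \<in> full_support_masses \<alpha>")
    case True
    then have "\<alpha>\<^sup>2 < 1" using square_less_1[OF \<alpha>] by (simp add: full_support_masses_def)
    moreover have "cos \<bar>y\<bar> < cos \<bar>x\<bar>" using xy y by (intro cos_monotone_0_pi) auto
    then have "cos y < cos x" by simp
    ultimately show ?thesis
      using min_profile_full[OF \<alpha> True x] min_profile_full[OF \<alpha> True y(1)]
      by (simp add: divide_strict_right_mono)
  next
    case False
    then have D: "M \<in> droplet_masses \<alpha>" using M by (simp add: droplet_masses_def)
    note r = min_profile_droplet[OF \<alpha> D]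
    have yr: "\<bar>y\<bar> < radius \<alpha> M" using r(5)[OF y(1)] y(2) by (auto split: if_splits)
    have "droplet \<alpha> (radius \<alpha> M) \<bar>y\<bar> < droplet \<alpha> (radius \<alpha> M) \<bar>x\<bar>"
      using xy yr r(3) by (intro droplet_decreasing[OF \<alpha>]) auto
    moreover have "droplet \<alpha> t \<bar>z\<bar> = droplet \<alpha> t z" for t z by (simp add: abs_if droplet_even)
    ultimately show ?thesis using r(5)[OF x] r(5)[OF y(1)] xy yr by simp
  qed
qed

lemma profile_minimizer:
  assumes M: "M > 0"
  shows "minimizer \<alpha> M (min_profile \<alpha> M)"
    "minimizer \<alpha> M v \<Longrightarrow> AE x in lebesgue. v x = min_profile \<alpha> M x"
proof -
  obtain K where K: "\<And>M. M > 0 \<Longrightarrow> (K + \<alpha>\<^sup>2 * \<bar>slope_coeff M\<bar>)-lipschitz_on UNIV (deriv (min_profile \<alpha> M))"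
    by (rule lipschitz_deriv_min_profile[OF \<alpha>], rule that)
  note min = min_profile[OF \<alpha> M]
  note m = minimizer_if_reduced_minimizer[OF min has_derivative_profile[OF M] K[OF M] reduced_minimizer_unique[OF \<alpha> min _ M]]
  show "minimizer \<alpha> M (min_profile \<alpha> M)" by (rule m(1))
  show "minimizer \<alpha> M v \<Longrightarrow> AE x in lebesgue. v x = min_profile \<alpha> M x" by (rule m(2))
qed

lemma profile_full_support:
  assumes M: "M \<in> full_support_masses \<alpha>"
  shows "min_profile \<alpha> M x = M / (2 * pi) + 1 / (1 - \<alpha>\<^sup>2) * cos x" "min_profile \<alpha> M x > 0"
proof -
  have a: "0 < M" "\<alpha> < 1" "M * (1 - \<alpha>\<^sup>2) > 2 * pi" using M by (auto simp: full_support_masses_def)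
  have a2: "\<alpha>\<^sup>2 < 1" by (rule square_less_1[OF \<alpha> a(2)])
  have y: "wrap x \<in> {-pi..pi}" using wrap_range[of x] by auto
  have "cos (wrap x) = cos x"
    by (rule periodic_2pi_wrap) (simp add: periodic_2pi_def)
  then show f: "min_profile \<alpha> M x = M / (2 * pi) + 1 / (1 - \<alpha>\<^sup>2) * cos x"
    using min_profile_full[OF \<alpha> M y] periodic_2pi_wrap[OF reduced_minimizerD(1)[OF min_profile[OF \<alpha> a(1)]], of x]
    by simp
  have "1 / (1 - \<alpha>\<^sup>2) < M / (2 * pi)" using a a2 by (simp add: field_simps)
  moreover have "1 / (1 - \<alpha>\<^sup>2) * (- 1) \<le> 1 / (1 - \<alpha>\<^sup>2) * cos x" using a2 by (intro mult_left_mono) auto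
  ultimately show "min_profile \<alpha> M x > 0" unfolding f by linarith
qed

lemma smooth_on_radius: "smooth_on (radius \<alpha>) (droplet_masses \<alpha>)"
  using smooth_radius[OF \<alpha>] droplet_masses_subset[OF \<alpha>] unfolding smooth_on_def by (meson subsetD subset_trans)

lemma radius_less:
  assumes M: "M \<in> droplet_masses \<alpha>" and crit: "M * (1 - \<alpha>\<^sup>2) \<noteq> 2 * pi"
  shows "radius \<alpha> M * max \<alpha> 1 < pi"
proof -
  note r = min_profile_droplet[OF \<alpha> M]
  have "radius \<alpha> M < pi" using r(2) radius_eq_pi_iff[OF \<alpha> M] crit by linarith
  moreover have "\<alpha> * radius \<alpha> M < pi" using radius_bound(3)[OF \<alpha> r(1,3)] .
  ultimately show ?thesis by (simp add: max_def mult.commute)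
qed

end

theorem theorem2p4:
  fixes \<alpha> :: real
  assumes "\<alpha> > 0"
  shows "\<exists>(ustar :: real \<Rightarrow> real \<Rightarrow> real) (\<tau> :: real \<Rightarrow> real).
    (\<forall>M>0. minimizer \<alpha> M (ustar M) \<and> continuous_on UNIV (ustar M) \<and>
       (\<forall>v. minimizer \<alpha> M v \<longrightarrow> (AE x in lebesgue. v x = ustar M x))) \<and>
    (\<forall>M>0. strictly_symmetric_decreasing_on_positivity_set (ustar M)) \<and>
    (\<forall>M>0. ustar M \<in> C11_circle) \<and>
    (\<forall>a b. 0 < a \<longrightarrow> bdd_above ((\<lambda>M. C1_holder_norm 1 (ustar M)) ` {a..b})) \<and>
    (\<forall>\<gamma> M\<^sub>0. 0 < \<gamma> \<and> \<gamma> \<le> 1 \<and> 0 < M\<^sub>0 \<and> (\<gamma> < 1 \<or> M\<^sub>0 \<in> full_support_masses \<alpha>) \<longrightarrow>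
       ((\<lambda>M. C1_holder_norm \<gamma> (\<lambda>x. ustar M x - ustar M\<^sub>0 x)) \<longlongrightarrow> 0) (at M\<^sub>0)) \<and>
    (\<forall>M\<^sub>1 M\<^sub>2. 0 < M\<^sub>1 \<and> M\<^sub>1 < M\<^sub>2 \<longrightarrow>
       (\<forall>x \<in> positivity_set (ustar M\<^sub>1). ustar M\<^sub>1 x < ustar M\<^sub>2 x)) \<and>
    (\<forall>M \<in> full_support_masses \<alpha>. \<forall>x.
       ustar M x > 0 \<and> ustar M x = M / (2 * pi) + 1 / (1 - \<alpha>\<^sup>2) * cos x) \<and>
    (\<forall>M \<in> droplet_masses \<alpha>. \<forall>x \<in> {-pi..pi}.
       ustar M x =
         (if \<bar>x\<bar> < \<tau> M
          then u0 \<alpha> x + coeff_A \<alpha> (\<tau> M) * cos (\<alpha> * x)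
               - u0 \<alpha> (\<tau> M) - coeff_A \<alpha> (\<tau> M) * cos (\<alpha> * \<tau> M)
          else 0)) \<and>
    smooth_on \<tau> (droplet_masses \<alpha>) \<and>
    strict_mono_on (droplet_masses \<alpha>) \<tau> \<and>
    (\<forall>M \<in> droplet_masses \<alpha>.
       0 < \<tau> M \<and>
       (M * (1 - \<alpha>\<^sup>2) \<noteq> 2 * pi \<longrightarrow> \<tau> M * max \<alpha> 1 < pi) \<and>
       (M * (1 - \<alpha>\<^sup>2) = 2 * pi \<longrightarrow> \<tau> M = pi))"
proof (rule exI[of _ "min_profile \<alpha>"], rule exI[of _ "radius \<alpha>"], intro conjI allI impI ballI)
  fix M :: real
  show "minimizer \<alpha> M (min_profile \<alpha> M)" if "0 < M" by (rule profile_minimizer(1)[OF assms that])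
  show "continuous_on UNIV (min_profile \<alpha> M)" if "0 < M"
    by (rule reduced_minimizerD(2)[OF min_profile[OF assms that]])
  show "AE x in lebesgue. v x = min_profile \<alpha> M x" if "0 < M" "minimizer \<alpha> M v" for v
    by (rule profile_minimizer(2)[OF assms that])
  show "strictly_symmetric_decreasing_on_positivity_set (min_profile \<alpha> M)" if "0 < M"
    by (rule profile_strictly_decreasing[OF assms that])
  show "min_profile \<alpha> M \<in> C11_circle" if "0 < M" by (rule profile_C11[OF assms that])
next
  show "bdd_above ((\<lambda>M. C1_holder_norm 1 (min_profile \<alpha> M)) ` {a..b})" if "0 < a" for a b
    by (rule profile_norm_bounded[OF assms that])
  show "((\<lambda>M. C1_holder_norm \<gamma> (\<lambda>x. min_profile \<alpha> M x - min_profile \<alpha> M0 x)) \<longlongrightarrow> 0) (at M0)"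
    if "0 < \<gamma> \<and> \<gamma> \<le> 1 \<and> 0 < M0 \<and> (\<gamma> < 1 \<or> M0 \<in> full_support_masses \<alpha>)" for \<gamma> M0
    using that by (intro profile_continuous_in_mass[OF assms]) auto
  show "min_profile \<alpha> M1 x < min_profile \<alpha> M2 x"
    if "0 < M1 \<and> M1 < M2" "x \<in> positivity_set (min_profile \<alpha> M1)" for M1 M2 x
    using that by (intro profile_strict_mono[OF assms]) (auto simp: positivity_set_def)
  show "smooth_on (radius \<alpha>) (droplet_masses \<alpha>)" by (rule smooth_on_radius[OF assms])
  show "strict_mono_on (droplet_masses \<alpha>) (radius \<alpha>)"
    by (rule strict_mono_onI) (rule radius_strict_mono[OF assms])
next
  fix M assume M: "M \<in> full_support_masses \<alpha>"
  show "0 < min_profile \<alpha> M x"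
    "min_profile \<alpha> M x = M / (2 * pi) + 1 / (1 - \<alpha>\<^sup>2) * cos x" for x
    by (rule profile_full_support[OF assms M])+
next
  fix M assume M: "M \<in> droplet_masses \<alpha>"
  note r = min_profile_droplet[OF assms M]
  show "min_profile \<alpha> M x = (if \<bar>x\<bar> < radius \<alpha> M
      then u0 \<alpha> x + coeff_A \<alpha> (radius \<alpha> M) * cos (\<alpha> * x)
        - u0 \<alpha> (radius \<alpha> M) - coeff_A \<alpha> (radius \<alpha> M) * cos (\<alpha> * radius \<alpha> M)
      else 0)" if "x \<in> {-pi..pi}" for x
    using r(5)[OF that] by (simp add: droplet_def)
  show "0 < radius \<alpha> M" by (rule r(1))
  show "radius \<alpha> M * max \<alpha> 1 < pi" if "M * (1 - \<alpha>\<^sup>2) \<noteq> 2 * pi"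
    by (rule radius_less[OF assms M that])
  show "radius \<alpha> M = pi" if "M * (1 - \<alpha>\<^sup>2) = 2 * pi"
    using radius_eq_pi_iff[OF assms M] that by simp
qed

end
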